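(* Let $q$ be a prime power, let $\mathcal{S}$ be a regular 2-spread of a hyperplane $\Sigma_\infty\cong \mathrm{PG}(5,q)$ of $\mathrm{PG}(6,q)$, and let $g,g^q,g^{q^2}$ be the three conjugate transversal lines of $\mathcal{S}$ in $\mathrm{PG}(6,q^3)$. In $\mathrm{PG}(6,q)$, let $\mathcal{C}$ be a conic in a spread element $\pi\in\mathcal{S}$ such that in the cubic extension $\mathrm{PG}(6,q^3)$, $\mathcal{C}^*$ contains the three transversal points $P=\pi^*\cap g$, $P^q=\pi^*\cap g^q$, $P^{q^2}=\pi^*\cap g^{q^2}$. Let $\Sigma$ be a 3-space of $\mathrm{PG}(6,q)$, not contained in $\Sigma_\infty$, that contains a spread element $\alpha\in\mathcal{S}$ distinct from $\pi$. Let $\mathcal{N}$ be a normal rational curve in $\Sigma$ such that in the cubic extension $\mathcal{N}^*$ contains the points $Q=\alpha^*\cap g$, $Q^q=\alpha^*\cap g^q$, $Q^{q^2}=\alpha^*\cap g^{q^2}$. In $\mathrm{PG}(6,q^3)$, let $\mathscr{B}^*$ be the unique ruled surface with directrices $\mathcal{C}^*,\mathcal{N}^*$ defined by the projectivity from $\mathcal{C}^*$ to $\mathcal{N}^*$ that maps $P^{q^i}\mapsto Q^{q^i}$, $i=1,2,3$. Then the ruled surface $\mathscr{B}=\mathscr{B}^*\cap \mathrm{PG}(6,q)$ of $\mathrm{PG}(6,q)$ corresponds to an order-$q$-subplane of $\mathrm{PG}(2,q^3)$ that is tangent to $\ell_\infty$.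
   Context: Regular 2-spread: a 2-spread of $\mathrm{PG}(5,q)$ is a set of $q^3+1$ planes partitioning the points of $\mathrm{PG}(5,q)$. Embed $\mathrm{PG}(5,q)$ in $\mathrm{PG}(5,q^3)$, and for a point or subspace $X$ let $X^q$ denote its image under the collineation induced by the Frobenius automorphism $x\mapsto x^q$ of $\mathrm{GF}(q^3)$. Let $g$ be a line of $\mathrm{PG}(5,q^3)$ such that $g,g^q,g^{q^2}$ are pairwise skew, span $\mathrm{PG}(5,q^3)$, and are disjoint from $\mathrm{PG}(5,q)$. For each point $P_i$ of $g$, the plane $\langle P_i,P_i^q,P_i^{q^2}\rangle$ meets $\mathrm{PG}(5,q)$ in a plane; the $q^3+1$ planes so obtained form a regular 2-spread $\mathcal{S}$, and $g,g^q,g^{q^2}$ are its (conjugate skew) transversal lines. Every regular 2-spread arises in this way from a unique set of three conjugate transversal lines. Elements of $\mathcal{S}$ are called spread elements. Bruck-Bose representation: the points of the affine plane $\mathcal{A}(\mathcal{S})$ are the points of $\mathrm{PG}(6,q)\setminus\Sigma_\infty$ (affine points); its lines are the 3-spaces of $\mathrm{PG}(6,q)$ not contained in $\Sigma_\infty$ that contain an element of $\mathcal{S}$; incidence is inherited. Its projective completion $\mathcal{P}(\mathcal{S})$, obtained by adding a line at infinity $\ell_\infty$ whose points correspond to the elements of $\mathcal{S}$, is isomorphic to $\mathrm{PG}(2,q^3)$ as $\mathcal{S}$ is regular, and is identified with $\mathrm{PG}(2,q^3)$. An order-$q$-subplane of $\mathrm{PG}(2,q^3)$ is a subplane of order $q$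 (a set of points that is an image of $\mathrm{PG}(2,q)$ under $\mathrm{PGL}(3,q^3)$); it is tangent to $\ell_\infty$ if it meets $\ell_\infty$ in exactly one point. For a subspace or curve $K$ of $\mathrm{PG}(6,q)$, $K^*$ denotes its natural extension to $\mathrm{PG}(6,q^3)$ (same equations/parametrisation over $\mathrm{GF}(q^3)$). A conic in a plane is the curve given by a nonzero quadratic form over $\mathrm{GF}(q)$. A normal rational curve in a 3-space is a curve projectively equivalent over $\mathrm{GF}(q)$ to $\{(s^3,s^2t,st^2,t^3)\}$, with $(s,t)\in\mathrm{PG}(1,q)$. Given a non-degenerate conic and a normal rational curve, each parametrised by the projective line, in disjoint subspaces, a projectivity between them is a bijection induced by a projectivity (element of $\mathrm{PGL}(2)$ over the relevant field) of the parameter lines. The ruled surface defined by the projectivity is the set of points on the (generator) lines joining corresponding points of the two curves, which are called its directrices. The ruled surface $\mathscr{B}$ with conic directrix in $\pi\subset\Sigma_\infty$ corresponds to an order-$q$-subplane tangent to $\ell_\infty$ means: the points of $\mathscr{B}$ not in $\Sigma_\infty$, together with the point $T\in\ell_\infty$ corresponding to $\pi$, form an order-$q$-subplane of $\mathrm{PG}(2,q^3)$ meeting $\ell_\infty$ in exactly $T$. *)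

theory Defs
  imports "HOL-Analysis.Analysis" "HOL-Number_Theory.Prime_Powers"
begin

text \<open>
  The field \<^typ>\<open>'f\<close> plays the role of \<open>GF(q)\<close>, the field \<^typ>\<open>'k\<close> that of \<open>GF(q^3)\<close>, and
  \<open>emb\<close> is a fixed embedding of the former into the latter. Subspaces of \<open>PG(n,q)\<close> are
  vector subspaces of \<open>'f^(n+1)\<close>, with a point being a one-dimensional vector subspace; a set of
  points is a set of such subspaces.
\<close>

definition field_embedding :: "('f::field \<Rightarrow> 'k::field) \<Rightarrow> bool" where
  "field_embedding emb \<longleftrightarrow>
     emb 1 = 1 \<and> (\<forall>x y. emb (x + y) = emb x + emb y) \<and> (\<forall>x y. emb (x * y) = emb x * emb y)"

definition pg_sub :: "nat \<Rightarrow> ('a::field ^ 'n) set \<Rightarrow> bool" where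
  "pg_sub d U \<longleftrightarrow> vec.subspace U \<and> vec.dim U = d + 1"

definition emb_vec :: "('f \<Rightarrow> 'k) \<Rightarrow> 'f ^ 'n \<Rightarrow> 'k ^ 'n" where
  "emb_vec emb v = (\<chi> i. emb (v $ i))"

text \<open>The natural extension \<open>U*\<close> of a subspace \<open>U\<close>.\<close>

definition pg_ext :: "('f \<Rightarrow> 'k) \<Rightarrow> ('f::field ^ 'n) set \<Rightarrow> ('k::field ^ 'n) set" where
  "pg_ext emb U = vec.span (emb_vec emb ` U)"

text \<open>The \<open>i\<close>-th Frobenius conjugate, \<open>X\<close> raised to \<open>q^i\<close>, of a subspace \<open>X\<close>.\<close>

definition frob_image :: "nat \<Rightarrow> nat \<Rightarrow> ('k::field ^ 'n) set \<Rightarrow> ('k ^ 'n) set" where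
  "frob_image q i X = (\<lambda>v. \<chi> j. (v $ j) ^ (q ^ i)) ` X"


section \<open>Regular 2-spreads\<close>

definition two_spread :: "nat \<Rightarrow> ('f::field ^ 'n) set \<Rightarrow> ('f ^ 'n) set set \<Rightarrow> bool" where
  "two_spread q H S \<longleftrightarrow>
     (\<forall>\<sigma>\<in>S. pg_sub 2 \<sigma> \<and> \<sigma> \<subseteq> H) \<and> card S = q ^ 3 + 1 \<and>
     (\<forall>X. pg_sub 0 X \<and> X \<subseteq> H \<longrightarrow> (\<exists>!\<sigma>. \<sigma> \<in> S \<and> X \<subseteq> \<sigma>))"

text \<open>
  \<open>g\<close> is one of three conjugate skew lines in the extension of the 5-space \<open>H\<close> such that \<open>S\<close> consists
  of the planes of \<open>H\<close> cut out by the planes spanned by a point of \<open>g\<close> and its conjugates.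
\<close>

definition transversal_line ::
  "nat \<Rightarrow> ('f \<Rightarrow> 'k) \<Rightarrow> ('f::field ^ 'n) set \<Rightarrow> ('f ^ 'n) set set \<Rightarrow> ('k::field ^ 'n) set \<Rightarrow> bool"
where
  "transversal_line q emb H S g \<longleftrightarrow>
     pg_sub 1 g \<and> g \<subseteq> pg_ext emb H \<and>
     (\<forall>i<3. \<forall>j<3. i \<noteq> j \<longrightarrow> frob_image q i g \<inter> frob_image q j g = {0}) \<and>
     vec.span (\<Union>i<3. frob_image q i g) = pg_ext emb H \<and>
     (\<forall>i<3. \<forall>X. pg_sub 0 X \<and> X \<subseteq> H \<longrightarrow> \<not> pg_ext emb X \<subseteq> frob_image q i g) \<and>
     S = {{v. emb_vec emb v \<in> vec.span (\<Union>i<3. frob_image q i P)} | P. pg_sub 0 P \<and> P \<subseteq> g}"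

definition regular_two_spread ::
  "nat \<Rightarrow> ('f \<Rightarrow> 'k::field) \<Rightarrow> ('f::field ^ 'n) set \<Rightarrow> ('f ^ 'n) set set \<Rightarrow> bool" where
  "regular_two_spread q emb H S \<longleftrightarrow> two_spread q H S \<and> (\<exists>g. transversal_line q emb H S g)"


section \<open>Bruck-Bose representation\<close>

text \<open>
  The point at infinity corresponding to a spread element is that spread element itself. A line is
  the set of its points. The line at infinity is \<open>S\<close>.
\<close>

definition affine_points :: "('f::field ^ 'n) set \<Rightarrow> ('f ^ 'n) set set" where
  "affine_points H = {X. pg_sub 0 X \<and> \<not> X \<subseteq> H}"

definition bb_points :: "('f::field ^ 'n) set \<Rightarrow> ('f ^ 'n) set set \<Rightarrow> ('f ^ 'n) set set" where
  "bb_points H S = affine_points H \<union> S"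

definition bb_lines :: "('f::field ^ 'n) set \<Rightarrow> ('f ^ 'n) set set \<Rightarrow> ('f ^ 'n) set set set" where
  "bb_lines H S =
     insert S {{X \<in> affine_points H. X \<subseteq> L} \<union> {\<sigma>} | L \<sigma>.
                 pg_sub 3 L \<and> \<not> L \<subseteq> H \<and> \<sigma> \<in> S \<and> \<sigma> \<subseteq> L}"

definition pg2_points :: "('k::field ^ 3) set set" where
  "pg2_points = {X. pg_sub 0 X}"

definition pg2_lines :: "('k::field ^ 3) set set set" where
  "pg2_lines = {{X. pg_sub 0 X \<and> X \<subseteq> l} | l. pg_sub 1 l}"

text \<open>
  The identification \<open>\<iota>\<close> of the projective completion with \<open>PG(2,q^3)\<close> may be any isomorphism of
  projective planes. Subplanes of order \<open>q\<close> do not depend on the choice, as every collineation of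
  \<open>PG(2,q^3)\<close> permutes them.
\<close>

definition bb_identification ::
  "('f::field ^ 'n) set \<Rightarrow> ('f ^ 'n) set set \<Rightarrow> (('f ^ 'n) set \<Rightarrow> ('k::field ^ 3) set) \<Rightarrow> bool" where
  "bb_identification H S \<iota> \<longleftrightarrow>
     bij_betw \<iota> (bb_points H S) pg2_points \<and> (\<lambda>l. \<iota> ` l) ` bb_lines H S = pg2_lines"

definition order_q_subplane :: "('f::field \<Rightarrow> 'k::field) \<Rightarrow> ('k ^ 3) set set \<Rightarrow> bool" where
  "order_q_subplane emb \<Delta> \<longleftrightarrow>
     (\<exists>A :: 'k ^ 3 ^ 3. invertible A \<and>
        \<Delta> = {(\<lambda>v. A *v v) ` pg_ext emb X | X. pg_sub 0 (X :: ('f ^ 3) set)})"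

definition corresponds_to_tangent_subplane ::
  "('f \<Rightarrow> 'k) \<Rightarrow> ('f::field ^ 'n) set \<Rightarrow> ('f ^ 'n) set set \<Rightarrow> (('f ^ 'n) set \<Rightarrow> ('k::field ^ 3) set) \<Rightarrow>
   ('f ^ 'n) set \<Rightarrow> ('f ^ 'n) set set \<Rightarrow> bool" where
  "corresponds_to_tangent_subplane emb H S \<iota> T B \<longleftrightarrow>
     (let \<Delta> = \<iota> ` ((B \<inter> affine_points H) \<union> {T})
      in order_q_subplane emb \<Delta> \<and> \<Delta> \<inter> \<iota> ` S = {\<iota> T})"


section \<open>Curves and ruled surfaces\<close>

definition quad_form :: "'a::field ^ 'n ^ 'n \<Rightarrow> 'a ^ 'n \<Rightarrow> 'a" where
  "quad_form A v = (\<Sum>i\<in>UNIV. \<Sum>j\<in>UNIV. A $ i $ j * v $ i * v $ j)"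

text \<open>
  The conic in the plane \<open>\<pi>\<close> defined by the restriction to \<open>\<pi>\<close> of the quadratic form with coefficient
  matrix \<open>A\<close>; every quadratic form on \<open>\<pi>\<close> is such a restriction. A quadratic form that is nonzero as
  a polynomial is nonzero as a function, also over \<open>GF(2)\<close>. The conic may be degenerate.
\<close>

definition conic_in :: "('f::field ^ 'n) set \<Rightarrow> 'f ^ 'n ^ 'n \<Rightarrow> bool" where
  "conic_in \<pi> A \<longleftrightarrow> pg_sub 2 \<pi> \<and> (\<exists>v\<in>\<pi>. quad_form A v \<noteq> 0)"

definition conic_ext ::
  "('f \<Rightarrow> 'k) \<Rightarrow> ('f::field ^ 'n) set \<Rightarrow> 'f ^ 'n ^ 'n \<Rightarrow> ('k::field ^ 'n) set set" where
  "conic_ext emb \<pi> A =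
     {X. pg_sub 0 X \<and> X \<subseteq> pg_ext emb \<pi> \<and> (\<forall>v\<in>X. quad_form (map_matrix emb A) v = 0)}"

text \<open>
  The point with parameter \<open>(s,t)\<close> on the image of \<open>(s^d, s^(d-1) t, ..., t^d)\<close> under the linear map
  taking the standard basis to \<open>b 0, ..., b d\<close>. For independent \<open>b 0, ..., b d\<close> this is a
  normal rational curve: a non-degenerate conic for \<open>d = 2\<close> and a twisted cubic for \<open>d = 3\<close>.
\<close>

definition curve_point :: "nat \<Rightarrow> (nat \<Rightarrow> 'a::field ^ 'n) \<Rightarrow> 'a \<Rightarrow> 'a \<Rightarrow> ('a ^ 'n) set" where
  "curve_point d b s t = vec.span {\<Sum>j\<le>d. (s ^ (d - j) * t ^ j) *s b j}"

definition curve :: "nat \<Rightarrow> (nat \<Rightarrow> 'a::field ^ 'n) \<Rightarrow> ('a ^ 'n) set set" where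
  "curve d b = {curve_point d b s t | s t. (s, t) \<noteq> (0, 0)}"

definition normal_rational_curve_in :: "nat \<Rightarrow> ('a::field ^ 'n) set \<Rightarrow> (nat \<Rightarrow> 'a ^ 'n) \<Rightarrow> bool" where
  "normal_rational_curve_in d V b \<longleftrightarrow> pg_sub d V \<and> vec.span (b ` {..d}) = V"

definition projectivity ::
  "nat \<Rightarrow> (nat \<Rightarrow> 'a::field ^ 'n) \<Rightarrow> nat \<Rightarrow> (nat \<Rightarrow> 'a ^ 'n) \<Rightarrow> (('a ^ 'n) set \<Rightarrow> ('a ^ 'n) set) \<Rightarrow> bool"
where
  "projectivity d b e m \<phi> \<longleftrightarrow>
     bij_betw \<phi> (curve d b) (curve e m) \<and>
     (\<exists>\<alpha> \<beta> \<gamma> \<delta>. \<alpha> * \<delta> - \<beta> * \<gamma> \<noteq> 0 \<and>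
        (\<forall>s t. (s, t) \<noteq> (0, 0) \<longrightarrow>
           \<phi> (curve_point d b s t) = curve_point e m (\<alpha> * s + \<beta> * t) (\<gamma> * s + \<delta> * t)))"

definition ruled_surface ::
  "('a::field ^ 'n) set set \<Rightarrow> (('a ^ 'n) set \<Rightarrow> ('a ^ 'n) set) \<Rightarrow> ('a ^ 'n) set set" where
  "ruled_surface C \<phi> = {X. pg_sub 0 X \<and> (\<exists>Y\<in>C. X \<subseteq> vec.span (Y \<union> \<phi> Y))}"

text \<open>
  \<open>B\<close> is a ruled surface whose directrices are the conic \<open>C\<close> in the plane \<open>E\<close> and the twisted cubic
  parametrised by \<open>m\<close>, defined by a projectivity taking \<open>P i\<close> to \<open>Q i\<close> for \<open>i = 1, 2, 3\<close>.
\<close>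

definition conic_cubic_surface ::
  "('a::field ^ 'n) set \<Rightarrow> ('a ^ 'n) set set \<Rightarrow> (nat \<Rightarrow> 'a ^ 'n) \<Rightarrow>
   (nat \<Rightarrow> ('a ^ 'n) set) \<Rightarrow> (nat \<Rightarrow> ('a ^ 'n) set) \<Rightarrow> ('a ^ 'n) set set \<Rightarrow> bool" where
  "conic_cubic_surface E C m P Q B \<longleftrightarrow>
     (\<exists>b \<phi>. normal_rational_curve_in 2 E b \<and> curve 2 b = C \<and>
            projectivity 2 b 3 m \<phi> \<and> (\<forall>i\<in>{1,2,3}. \<phi> (P i) = Q i) \<and>
            B = ruled_surface C \<phi>)"

definition rational_points ::
  "('f \<Rightarrow> 'k) \<Rightarrow> ('k::field ^ 'n) set set \<Rightarrow> ('f::field ^ 'n) set set" where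
  "rational_points emb B = {X. pg_sub 0 X \<and> pg_ext emb X \<in> B}"

end

theory Submission
  imports Defs
begin

text \<open>
  Write \<open>\<sigma>\<close> for the Frobenius map \<open>x \<mapsto> x^q\<close>, acting on \<open>GF(q^3)\<close> and on vectors over it, and let
  \<open>P = \<langle>p\<rangle>\<close>, \<open>Q = \<langle>r\<rangle>\<close>, so that \<open>g = \<langle>p, r\<rangle>\<close>. For an affine point \<open>\<langle>e\<rangle>\<close> the vectors \<open>e\<close>, \<open>p\<close>, \<open>\<sigma>p\<close>,
  \<open>\<sigma>\<sigma>p\<close>, \<open>r\<close>, \<open>\<sigma>r\<close>, \<open>\<sigma>\<sigma>r\<close> form a basis over \<open>GF(q^3)\<close>, and a vector is rational over \<open>GF(q)\<close> exactly
  when it is \<open>c e + (x p + \<sigma>x \<sigma>p + \<sigma>\<sigma>x \<sigma>\<sigma>p) + (y r + \<sigma>y \<sigma>r + \<sigma>\<sigma>y \<sigma>\<sigma>r)\<close> with \<open>c\<close> in \<open>GF(q)\<close>. The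
  coordinates \<open>(c, y, x)\<close> identify the Bruck-Bose plane with \<open>PG(2,q^3)\<close>: a point \<open>Y\<close> of \<open>PG(2,q^3)\<close>
  corresponds to the set \<open>\<Psi> Y\<close> of all rational vectors with coordinates in \<open>Y\<close>
  (\<open>bb_points_eq\<close>, \<open>\<Psi>_line\<close>).
  
  An arbitrary identification \<open>\<iota>\<close> differs from this one by a collineation of \<open>PG(2,q^3)\<close>. After a
  change of frame a collineation is a field automorphism acting on coordinates, and a field
  automorphism of \<open>GF(q^3)\<close> preserves the unique subfield of order \<open>q\<close>; so collineations permute the
  order-\<open>q\<close>-subplanes (\<open>collineation_order_q_subplane\<close>), and it suffices to work with \<open>\<Psi>\<close>.
  
  Put \<open>e = m 0\<close>. The twisted cubic passes through \<open>Q\<close> and its conjugates at conjugate parameters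
  \<open>(z, 1)\<close>, \<open>(\<sigma>z, 1)\<close>, \<open>(\<sigma>\<sigma>z, 1)\<close>. With \<open>D_i = s - \<sigma>^i(z) t\<close>, and after rescaling \<open>r\<close>, these zeros force
  the parametrisation
  \<open>D_0 D_1 D_2 e + t (D_1 D_2 r + D_0 D_2 \<sigma>r + D_0 D_1 \<sigma>\<sigma>r)\<close>
  (\<open>twisted_cubic_normal_form\<close>). Likewise a conic through \<open>P\<close> and its conjugates has an equation
  \<open>a y w + \<sigma>a w x + \<sigma>\<sigma>a x y = 0\<close> (\<open>quad_form_conjugate_zeros\<close>), and after rescaling \<open>p\<close> it is
  parametrised by \<open>D_1 D_2 p + D_0 D_2 \<sigma>p + D_0 D_1 \<sigma>\<sigma>p\<close>. Any projectivity with the prescribed values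
  at three points matches equal parameters \<open>(s, t)\<close>, whatever parametrisation of the conic it starts
  from (\<open>quadratic_parametrisation\<close>); hence the ruled surface exists and is unique.
  
  On the generator with parameter \<open>(s, t)\<close> the rational affine points are those with coordinates
  \<open>(1, t / D_0, \<rho> / D_0)\<close>, where rationality forces \<open>(s : t)\<close> and then \<open>\<rho>\<close> to lie over \<open>GF(q)\<close>.
  Up to a scalar this is \<open>(s - z t, t, \<rho>)\<close>, so together with \<open>(0, 0, 1)\<close>, which represents \<open>\<pi>\<close>, these
  points form the image of \<open>PG(2,q)\<close> under an invertible matrix over \<open>GF(q^3)\<close>
  (\<open>rational_surface_subplane\<close>).
\<close>

section \<open>Subspaces over finite fields\<close>

lemma card_span_independent:
  fixes B :: "('a::{field,finite} ^ 'n) set"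
  assumes "vec.independent B"
  shows "card (vec.span B) = CARD('a) ^ card B"
proof -
  have "finite B" by simp
  then show ?thesis using assms
  proof (induction B rule: finite_induct)
    case empty
    then show ?case by simp
  next
    case (insert b B)
    from insert have b: "b \<notin> vec.span B" and iB: "vec.independent B"
      by (auto simp: vec.independent_insert)
    let ?f = "\<lambda>(k, y). k *s b + y"
    have "vec.span (insert b B) = ?f ` (UNIV \<times> vec.span B)"
    proof (intro equalityI subsetI)
      fix x assume "x \<in> vec.span (insert b B)"
      then obtain k where "x - k *s b \<in> vec.span B" by (auto simp: vec.span_breakdown_eq)
      then show "x \<in> ?f ` (UNIV \<times> vec.span B)"
        by (intro image_eqI[of _ _ "(k, x - k *s b)"]) auto
    next
      fix x assume "x \<in> ?f ` (UNIV \<times> vec.span B)"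
      then show "x \<in> vec.span (insert b B)"
        by (auto intro!: vec.span_add vec.span_scale intro: vec.span_base
            vec.span_mono[THEN subsetD, OF subset_insertI])
    qed
    moreover have "inj_on ?f (UNIV \<times> vec.span B)"
    proof (rule inj_onI, clarify)
      fix k y k' y'
      assume y: "y \<in> vec.span B" "y' \<in> vec.span B" and eq: "k *s b + y = k' *s b + y'"
      have "(k - k') *s b = y' - y"
        using eq by (simp add: vec.scale_left_diff_distrib algebra_simps)
      then have s: "(k - k') *s b \<in> vec.span B" using y by (simp add: vec.span_diff)
      have "k = k'"
      proof (rule ccontr)
        assume "k \<noteq> k'"
        then have "b = inverse (k - k') *s ((k - k') *s b)"
          by (simp add: vector_smult_assoc del: vec.scale_left_diff_distrib vector_ssub_ldistrib vector_sub_rdistrib)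
        then show False using vec.span_scale[OF s] b by metis
      qed
      then show "k = k' \<and> y = y'" using eq by simp
    qed
    ultimately show ?case
      using insert iB by (simp add: card_image card_cartesian_product)
  qed
qed

lemma card_subspace:
  fixes W :: "('a::{field,finite} ^ 'n) set"
  assumes "vec.subspace W"
  shows "card W = CARD('a) ^ vec.dim W"
proof -
  obtain B where B: "B \<subseteq> W" "vec.independent B" "W \<subseteq> vec.span B" "card B = vec.dim W"
    by (rule vec.basis_exists)
  have "vec.span B = W" using B assms by (metis vec.span_subspace)
  then show ?thesis using card_span_independent[OF B(2)] B(4) by simp
qed

lemma CARD_field_gt_1: "CARD('a::{field,finite}) > 1"
proof -
  have "card {0, 1 :: 'a} \<le> CARD('a)" by (rule card_mono) auto
  then show ?thesis by simp
qed

lemma pg_sub_card_iff: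
  fixes W :: "('a::{field,finite} ^ 'n) set"
  shows "pg_sub d W \<longleftrightarrow> vec.subspace W \<and> card W = CARD('a) ^ (d + 1)"
  unfolding pg_sub_def using card_subspace[of W] CARD_field_gt_1[where 'a='a]
  by (auto simp del: power_Suc)

lemma pg_sub_0_iff: "pg_sub 0 X \<longleftrightarrow> (\<exists>v. v \<noteq> 0 \<and> X = vec.span {v})"
proof
  assume X: "pg_sub 0 X"
  then obtain B where B: "B \<subseteq> X" "vec.independent B" "X \<subseteq> vec.span B" "card B = 1"
    unfolding pg_sub_def by (metis vec.basis_exists add_0)
  then obtain v where "B = {v}" by (auto simp: card_1_singleton_iff)
  with B X show "\<exists>v. v \<noteq> 0 \<and> X = vec.span {v}"
    unfolding pg_sub_def by (metis vec.dependent_single vec.span_subspace)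
next
  assume "\<exists>v. v \<noteq> 0 \<and> X = vec.span {v}"
  then show "pg_sub 0 X" by (auto simp: pg_sub_def)
qed

lemma pg_sub_0_span [simp]: "pg_sub 0 (vec.span {v}) \<longleftrightarrow> v \<noteq> 0"
  by (auto simp: pg_sub_def)

lemma in_span_singleton: "x \<in> vec.span {v} \<longleftrightarrow> (\<exists>c. x = c *s v)"
  by (auto simp: vec.span_singleton)

lemma span_singleton_eq_iff:
  assumes "v \<noteq> 0"
  shows "vec.span {v} = vec.span {w} \<longleftrightarrow> (\<exists>c. c \<noteq> 0 \<and> w = c *s v)"
proof
  assume eq: "vec.span {v} = vec.span {w}"
  then have "w \<in> vec.span {v}" by (simp add: vec.span_base)
  then obtain c where c: "w = c *s v" by (auto simp: in_span_singleton)
  moreover have "c \<noteq> 0" using eq c assms by (auto simp: vec.span_base)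
  ultimately show "\<exists>c. c \<noteq> 0 \<and> w = c *s v" by blast
next
  assume "\<exists>c. c \<noteq> 0 \<and> w = c *s v"
  then obtain c where c: "c \<noteq> 0" "w = c *s v" by blast
  then have "v = inverse c *s w" by (simp add: vector_smult_assoc)
  then have "v \<in> vec.span {w}" by (auto simp: in_span_singleton)
  moreover have "w \<in> vec.span {v}" using c by (auto simp: in_span_singleton)
  ultimately show "vec.span {v} = vec.span {w}" by (simp add: vec.span_eq)
qed

lemma pg_sub_0_eq_span:
  assumes "pg_sub 0 X" "v \<in> X" "v \<noteq> 0"
  shows "X = vec.span {v}"
proof -
  obtain w where w: "w \<noteq> 0" "X = vec.span {w}" using assms(1) pg_sub_0_iff by blast
  then obtain c where "v = c *s w" using assms(2) by (auto simp: in_span_singleton)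
  with w assms(3) show ?thesis by (auto simp: span_singleton_eq_iff)
qed

lemma in_span_pair: "x \<in> vec.span {v, w} \<longleftrightarrow> (\<exists>a b. x = a *s v + b *s w)"
proof -
  have "x \<in> vec.span {v, w} \<longleftrightarrow> (\<exists>a b. x - a *s v = b *s w)"
    by (simp add: vec.span_breakdown_eq[of x v "{w}"] in_span_singleton)
  then show ?thesis by (simp add: diff_eq_eq add.commute)
qed

lemma in_span_triple:
  "x \<in> vec.span {u, v, w} \<longleftrightarrow> (\<exists>a b c. x = a *s u + b *s v + c *s w)"
proof -
  have "x \<in> vec.span {u, v, w} \<longleftrightarrow> (\<exists>a b c. x - a *s u = b *s v + c *s w)"
    by (simp add: vec.span_breakdown_eq[of x u "{v, w}"] in_span_pair)
  then show ?thesis by (simp add: diff_eq_eq add_ac)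
qed


section \<open>The field extension and its Frobenius map\<close>

lemma power_CARD_field:
  fixes x :: "'a::{field,finite}"
  shows "x ^ CARD('a) = x"
proof (cases "x = 0")
  case False
  have "x * (\<Prod>y\<in>UNIV-{0}. x * y) = x * x ^ (CARD('a) - 1) * \<Prod>(UNIV-{0})"
    by (simp add: prod.distrib mult_ac)
  also have "x * x ^ (CARD('a) - 1) = x ^ CARD('a)"
    using CARD_field_gt_1[where 'a='a] by (simp flip: power_Suc)
  also have "(\<Prod>y\<in>UNIV-{0}. x * y) = (\<Prod>y\<in>UNIV-{0}. y)"
    by (rule prod.reindex_bij_witness[of _ "\<lambda>y. y / x" "\<lambda>y. x * y"]) (use False in auto)
  finally show ?thesis by simp
qed simp

lemma CHAR_dvd_CARD_field: "CHAR('a::{field,finite}) dvd CARD('a)"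
proof -
  have "(\<Sum>x\<in>UNIV. x + 1 :: 'a) = (\<Sum>x\<in>UNIV. x)"
    by (rule sum.reindex_bij_witness[of _ "\<lambda>x. x - 1" "\<lambda>x. x + 1"]) auto
  then have "(of_nat CARD('a) :: 'a) = 0" by (simp add: sum.distrib)
  then show ?thesis by (simp add: of_nat_eq_0_iff_char_dvd)
qed

text \<open>
  The extension of \<open>GF(q)\<close> by \<open>GF(q^3)\<close>, given by an embedding \<open>emb\<close>.
\<close>
locale cubic_extension =
  fixes q :: nat and emb :: "'f::{field,finite} \<Rightarrow> 'k::{field,finite}"
  assumes pp: "primepow q" and card_f: "CARD('f) = q" and card_k: "CARD('k) = q ^ 3"
    and fe: "field_embedding emb"
begin

lemma emb_1 [simp]: "emb 1 = 1" and emb_add [simp]: "emb (x + y) = emb x + emb y"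
  and emb_mult [simp]: "emb (x * y) = emb x * emb y"
  using fe by (auto simp: field_embedding_def)

lemma emb_0 [simp]: "emb 0 = 0"
  by (metis add_cancel_right_right emb_add)

lemma emb_minus [simp]: "emb (- x) = - emb x"
  using emb_add[of x "-x"] by (simp del: emb_add add: eq_neg_iff_add_eq_0 add.commute)

lemma emb_diff [simp]: "emb (x - y) = emb x - emb y"
  using emb_add[of x "-y"] by (simp del: emb_add)

lemma emb_eq_0 [simp]: "emb x = 0 \<longleftrightarrow> x = 0"
proof
  assume "emb x = 0"
  then have "emb (x * inverse x) = 0" by simp
  then show "x = 0" by (cases "x = 0") (auto simp del: emb_mult)
qed simp

lemma emb_inj [simp]: "emb x = emb y \<longleftrightarrow> x = y"
  using emb_eq_0[of "x - y"] by (simp del: emb_eq_0)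

lemma inj_emb: "inj emb" by (simp add: inj_def)

lemma emb_power [simp]: "emb (x ^ n) = emb x ^ n"
  by (induction n) auto

lemma emb_inverse [simp]: "emb (inverse x) = inverse (emb x)"
proof (cases "x = 0")
  case False
  then have "emb x * emb (inverse x) = 1" by (simp flip: emb_mult)
  then show ?thesis by (metis inverse_unique)
qed simp

lemma emb_divide [simp]: "emb (x / y) = emb x / emb y"
  by (simp add: divide_inverse)

lemma emb_sum [simp]: "emb (sum f A) = (\<Sum>a\<in>A. emb (f a))"
  by (induction A rule: infinite_finite_induct) auto

lemma q_gt_1: "q > 1"
  using CARD_field_gt_1[where 'a='f] card_f by simp

text \<open>
  The Frobenius map, as a separate constant so that its algebraic laws can serve as rewrite rules.
\<close>
definition frob :: "'k \<Rightarrow> 'k" where "frob x = x ^ q"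

lemma frob_add [simp]: "frob (x + y) = frob x + frob y"
proof -
  obtain p n where pn: "prime p" "n > 0" "q = p ^ n"
    using pp by (auto simp: primepow_def)
  have "CHAR('k) > 0" by (simp add: finite_imp_CHAR_pos)
  then have pr: "prime CHAR('k)" by (rule prime_CHAR_semidom)
  have "CHAR('k) dvd (p ^ n) ^ 3"
    using CHAR_dvd_CARD_field[where 'a='k] card_k pn by simp
  then have "CHAR('k) dvd p" using pr prime_dvd_power by blast
  then have "CHAR('k) = p" using pr pn(1) primes_dvd_imp_eq by blast
  then show ?thesis unfolding frob_def using pr pn(3) by (intro freshmans_dream') auto
qed

lemma frob_mult [simp]: "frob (x * y) = frob x * frob y"
  by (simp add: frob_def power_mult_distrib)

lemma frob_0 [simp]: "frob 0 = 0"
  using q_gt_1 by (simp add: frob_def)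

lemma frob_1 [simp]: "frob 1 = 1"
  by (simp add: frob_def)

lemma frob_minus [simp]: "frob (- x) = - frob x"
  using frob_add[of x "-x"] by (simp del: frob_add add: eq_neg_iff_add_eq_0 add.commute)

lemma frob_diff [simp]: "frob (x - y) = frob x - frob y"
  using frob_add[of x "-y"] by (simp del: frob_add)

lemma frob_divide [simp]: "frob (x / y) = frob x / frob y"
  by (simp add: frob_def power_divide)

lemma frob_power [simp]: "frob (x ^ n) = frob x ^ n"
  by (simp add: frob_def flip: power_mult add: mult.commute)

lemma frob_eq_0 [simp]: "frob x = 0 \<longleftrightarrow> x = 0"
  using q_gt_1 by (simp add: frob_def)

lemma frob_inj [simp]: "frob x = frob y \<longleftrightarrow> x = y"
  using frob_eq_0[of "x - y"] by (simp del: frob_eq_0)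

lemma frob_frob_frob [simp]: "frob (frob (frob x)) = x"
proof -
  have "frob (frob (frob x)) = x ^ (q ^ 3)"
    by (simp add: frob_def power3_eq_cube flip: power_mult)
  then show ?thesis using power_CARD_field[of x] card_k by simp
qed

lemma frob_emb [simp]: "frob (emb x) = emb x"
  unfolding frob_def using power_CARD_field[of x] card_f by (simp flip: emb_power)

text \<open>
  The polynomial \<open>X^q - X\<close> has at most \<open>q\<close> roots, and the \<open>q\<close> elements of the image of \<open>emb\<close> are roots.
\<close>
lemma frob_fixed_iff: "frob x = x \<longleftrightarrow> x \<in> range emb"
proof -
  let ?R = "{x :: 'k. poly (Polynomial.monom 1 q - Polynomial.monom 1 1) x = 0}"
  have ne: "Polynomial.monom 1 q - Polynomial.monom 1 1 \<noteq> (0 :: 'k poly)"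
    using q_gt_1 by (simp add: monom_eq_iff')
  have "?R = {x. frob x = x}" by (auto simp: frob_def poly_monom)
  moreover have "card ?R \<le> degree (Polynomial.monom 1 q - Polynomial.monom 1 1 :: 'k poly)"
    using ne by (rule card_poly_roots_bound)
  moreover have "degree (Polynomial.monom 1 q - Polynomial.monom 1 1 :: 'k poly) \<le> q"
    using q_gt_1 by (intro degree_diff_le) (auto simp: degree_monom_eq)
  ultimately have "card {x. frob x = x} \<le> q" by simp
  moreover have "range emb \<subseteq> {x. frob x = x}" by auto
  moreover have "card (range emb) = q" using card_f inj_emb by (simp add: card_image)
  ultimately have "range emb = {x. frob x = x}"
    by (intro card_seteq) auto
  then show ?thesis by blast
qed

text \<open>
  The Frobenius map on vectors; its powers give the conjugates \<open>frob_image q i X\<close>.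
\<close>
definition frobv :: "'k ^ 'n \<Rightarrow> 'k ^ 'n" where "frobv v = (\<chi> i. frob (v $ i))"

lemma frobv_add [simp]: "frobv (v + w) = frobv v + frobv w"
  and frobv_scale [simp]: "frobv (c *s v) = frob c *s frobv v"
  and frobv_frobv_frobv [simp]: "frobv (frobv (frobv v)) = v"
  and frobv_0 [simp]: "frobv 0 = 0"
  by (simp_all add: frobv_def vec_eq_iff)

lemma frobv_inj [simp]: "frobv v = frobv w \<longleftrightarrow> v = w"
  by (metis frobv_frobv_frobv)

lemma frob_image_0: "frob_image q 0 X = X"
  by (simp add: frob_image_def)

lemma frob_image_Suc: "frob_image q (Suc i) X = frobv ` frob_image q i X"
proof -
  have "(x ^ q ^ i) ^ q = x ^ (q * q ^ i)" for x :: 'k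
    by (simp add: power_mult[symmetric] mult.commute)
  then show ?thesis
    by (simp add: frob_image_def frobv_def frob_def image_image vec_eq_iff cong: image_cong)
qed

lemma frob_image_simps:
  "frob_image q 1 X = frobv ` X" "frob_image q 2 X = (\<lambda>v. frobv (frobv v)) ` X"
  "frob_image q 3 X = X" "frob_image q (Suc 0) X = frobv ` X"
  by (simp_all add: numeral_eq_Suc frob_image_Suc frob_image_0 image_image)

lemma UN_frob_image: "(\<Union>i<3. frob_image q i X) = X \<union> frobv ` X \<union> (\<lambda>v. frobv (frobv v)) ` X"
proof -
  have "{..<3} = {0, 1, 2::nat}" by auto
  then show ?thesis by (auto simp: frob_image_0 frob_image_simps)
qed

lemma emb_vec_nth [simp]: "emb_vec emb v $ i = emb (v $ i)"
  by (simp add: emb_vec_def)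

lemma emb_vec_add [simp]: "emb_vec emb (v + w) = emb_vec emb v + emb_vec emb w"
  and emb_vec_diff [simp]: "emb_vec emb (v - w) = emb_vec emb v - emb_vec emb w"
  and emb_vec_scale [simp]: "emb_vec emb (c *s v) = emb c *s emb_vec emb v"
  and emb_vec_0 [simp]: "emb_vec emb 0 = 0"
  and emb_vec_inj [simp]: "emb_vec emb v = emb_vec emb w \<longleftrightarrow> v = w"
  by (simp_all add: vec_eq_iff)

lemma emb_vec_eq_0 [simp]: "emb_vec emb v = 0 \<longleftrightarrow> v = 0"
  by (simp add: vec_eq_iff)

lemma frobv_emb_vec [simp]: "frobv (emb_vec emb v) = emb_vec emb v"
  by (simp add: frobv_def vec_eq_iff)

lemma frobv_fixed: 
  assumes "frobv v = v"
  obtains w where "v = emb_vec emb w"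
proof -
  have "\<forall>i. \<exists>x. v $ i = emb x"
    using assms frob_fixed_iff by (simp add: frobv_def vec_eq_iff image_iff)
  then obtain w where "\<forall>i. v $ i = emb (w $ i)" by (auto simp: lambda_skolem)
  then have "v = emb_vec emb w" by (simp add: vec_eq_iff)
  then show ?thesis by (rule that)
qed

subsection \<open>Extension of subspaces\<close>

lemma emb_vec_span: "v \<in> vec.span B \<Longrightarrow> emb_vec emb v \<in> vec.span (emb_vec emb ` B)"
  by (induction rule: vec.span_induct_alt)
     (auto intro: vec.span_add vec.span_scale vec.span_base vec.span_zero)

lemma pg_ext_span: "pg_ext emb (vec.span B) = vec.span (emb_vec emb ` B)"
  unfolding pg_ext_def
  by (intro equalityI vec.span_minimal)
     (auto intro: emb_vec_span vec.span_mono[THEN subsetD, OF image_mono[OF vec.span_superset]] simp: vec.span_base)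

text \<open>
  An independent set extends to a basis of the whole space over \<open>GF(q)\<close>. The image of that basis
  spans the whole space over \<open>GF(q^3)\<close> and has the right cardinality, so it is independent.
\<close>
lemma independent_emb_vec:
  fixes B :: "('f ^ 'n) set"
  assumes "vec.independent B"
  shows "vec.independent (emb_vec emb ` B)"
proof -
  let ?C = "vec.extend_basis B"
  have C: "vec.independent ?C" "B \<subseteq> ?C" "vec.span ?C = UNIV"
    using assms by (auto simp: vec.independent_extend_basis vec.extend_basis_superset vec.span_extend_basis)
  have cC: "card ?C = CARD('n)"
    using C vec.dim_eq_card[of ?C UNIV] by (simp add: card_cart_basis)
  have "axis i 1 \<in> vec.span (emb_vec emb ` ?C)" for i
  proof -
    have "emb_vec emb (axis i 1) = axis i 1" by (simp add: vec_eq_iff axis_def)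
    then show ?thesis using emb_vec_span[of "axis i 1" ?C] C(3) by simp
  qed
  then have "(cart_basis :: ('k ^ 'n) set) \<subseteq> vec.span (emb_vec emb ` ?C)" by (auto simp: cart_basis_def)
  then have "UNIV \<subseteq> vec.span (emb_vec emb ` ?C)"
    by (metis span_cart_basis vec.span_minimal vec.subspace_span)
  moreover have "card (emb_vec emb ` ?C) = CARD('n)"
    using cC by (subst card_image) (auto simp: inj_on_def)
  ultimately have "vec.independent (emb_vec emb ` ?C)"
    by (subst vec.card_eq_dim[of _ UNIV]) (auto simp: card_cart_basis)
  then show ?thesis using C(2) by (metis image_mono vec.independent_mono)
qed

lemma dim_pg_ext:
  fixes U :: "('f ^ 'n) set"
  shows "vec.dim (pg_ext emb U) = vec.dim U"
proof -
  obtain B where B: "B \<subseteq> U" "vec.independent B" "U \<subseteq> vec.span B" "card B = vec.dim U"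
    by (rule vec.basis_exists)
  have "vec.span B = vec.span U" using B by (metis vec.span_mono vec.span_span subset_antisym)
  then have "pg_ext emb U = vec.span (emb_vec emb ` B)"
    using pg_ext_span[of B] pg_ext_span[of U] by (simp add: pg_ext_def)
  then show ?thesis using independent_emb_vec[OF B(2)] B(4)
    by (simp add: vec.dim_eq_card_independent card_image inj_on_def)
qed

lemma emb_vec_in_pg_ext:
  fixes U :: "('f ^ 'n) set"
  assumes "vec.subspace U"
  shows "emb_vec emb v \<in> pg_ext emb U \<longleftrightarrow> v \<in> U"
proof
  assume v: "emb_vec emb v \<in> pg_ext emb U"
  show "v \<in> U"
  proof (rule ccontr)
    assume nv: "v \<notin> U"
    obtain B where B: "B \<subseteq> U" "vec.independent B" "U \<subseteq> vec.span B" "card B = vec.dim U"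
      by (rule vec.basis_exists)
    have sB: "vec.span B = U" using B assms by (metis vec.span_subspace)
    with nv B(2) have "vec.independent (insert v B)" by (simp add: vec.independent_insertI)
    then have "vec.independent (insert (emb_vec emb v) (emb_vec emb ` B))"
      using independent_emb_vec by fastforce
    moreover have "emb_vec emb v \<notin> emb_vec emb ` B" using nv sB vec.span_base by fastforce
    ultimately have "emb_vec emb v \<notin> vec.span (emb_vec emb ` B)" 
      by (simp add: vec.independent_insert)
    then show False using v pg_ext_span[of B] sB by simp
  qed
qed (simp add: pg_ext_def vec.span_base)

lemma pg_ext_point: "pg_ext emb (vec.span {v}) = vec.span {emb_vec emb v}"
  by (simp add: pg_ext_span)

end


section \<open>Collineations of a projective plane over a field\<close>

text \<open>
  The determinant of three vectors. It vanishes exactly when the three points are collinear, so that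
  all incidence statements below become polynomial identities.
\<close>
definition det3 :: "'a::field ^ 3 \<Rightarrow> 'a ^ 3 \<Rightarrow> 'a ^ 3 \<Rightarrow> 'a" where
  "det3 a b c = a$1 * (b$2 * c$3 - b$3 * c$2) - a$2 * (b$1 * c$3 - b$3 * c$1)
     + a$3 * (b$1 * c$2 - b$2 * c$1)"

lemma det3_eq_det: "det3 a b c = det (vector [a, b, c] :: 'a::field ^ 3 ^ 3)"
  by (simp add: det3_def det_3 algebra_simps)

lemma det3_matrix: "det3 (A *v a) (A *v b) (A *v c) = det A * det3 a b c"
proof -
  have "(vector [A *v a, A *v b, A *v c] :: 'a ^ 3 ^ 3) = vector [a, b, c] ** transpose A"
    by (simp add: vec_eq_iff forall_3 matrix_matrix_mult_def matrix_vector_mult_def sum_3 transpose_def mult.commute)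
  then show ?thesis by (simp add: det3_eq_det det_mul det_transpose)
qed

lemma det3_scale: "det3 (r *s a) (s *s b) (t *s c) = r * s * t * det3 a b c"
  by (simp add: det3_def algebra_simps)

lemma vec3_eq_iff: "(v :: 'a ^ 3) = w \<longleftrightarrow> v$1 = w$1 \<and> v$2 = w$2 \<and> v$3 = w$3"
  by (simp add: vec_eq_iff forall_3)

lemma pg_sub_kernel3:
  fixes n :: "'a::field ^ 3"
  assumes "n \<noteq> 0"
  shows "pg_sub 1 {v :: 'a ^ 3. n$1 * v$1 + n$2 * v$2 + n$3 * v$3 = 0}" (is "pg_sub 1 ?W")
proof -
  define d where "d v = n$1 * v$1 + n$2 * v$2 + n$3 * v$3" for v :: "'a ^ 3"
  have W: "?W = {v. d v = 0}" by (simp add: d_def)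
  have d_add: "d (v + w) = d v + d w" and d_scale: "d (c *s v) = c * d v" for v w c
    by (simp_all add: d_def algebra_simps)
  have sub: "vec.subspace ?W"
    unfolding W by (rule vec.subspaceI) (simp_all add: d_add d_scale, simp add: d_def)
  have "d (vector [1, 0, 0]) = n$1" "d (vector [0, 1, 0]) = n$2" "d (vector [0, 0, 1]) = n$3"
    by (simp_all add: d_def)
  then obtain u where u: "d u \<noteq> 0"
    using assms by (metis vec3_eq_iff zero_index)
  have "x \<in> vec.span (insert u ?W)" for x
  proof -
    have "d (x - (d x / d u) *s u) = 0"
      using u d_add[of "x - (d x / d u) *s u" "(d x / d u) *s u"] by (simp add: d_scale)
    then have "x - (d x / d u) *s u \<in> vec.span ?W" by (intro vec.span_base) (simp add: W)
    then show ?thesis by (auto simp: vec.span_breakdown_eq)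
  qed
  then have "vec.span (insert u ?W) = UNIV" by blast
  then have "vec.dim (insert u ?W) = 3"
    using vec.dim_span[of "insert u ?W"] by (simp add: card_cart_basis del: vec.dim_span)
  moreover have "u \<notin> vec.span ?W" using sub u W by (metis (mono_tags) mem_Collect_eq vec.span_eq_iff)
  ultimately show ?thesis using sub by (simp add: pg_sub_def vec.dim_insert)
qed

lemma pg_sub_1_imp_span:
  assumes "pg_sub 1 W"
  obtains u v where "W = vec.span {u, v}"
proof -
  obtain B where B: "B \<subseteq> W" "vec.independent B" "W \<subseteq> vec.span B" "card B = 2"
    using assms unfolding pg_sub_def by (metis vec.basis_exists one_add_one)
  then obtain u v where "B = {u, v}" by (auto simp: card_2_iff)
  then show ?thesis using that B assms unfolding pg_sub_def by (metis vec.span_subspace)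
qed

lemma collinear_iff_det3:
  fixes a b c :: "'a::field ^ 3"
  assumes "a \<noteq> 0" "b \<noteq> 0" "c \<noteq> 0"
  shows "(\<exists>l\<in>pg2_lines. vec.span {a} \<in> l \<and> vec.span {b} \<in> l \<and> vec.span {c} \<in> l) \<longleftrightarrow>
    det3 a b c = 0"
proof
  assume "\<exists>l\<in>pg2_lines. vec.span {a} \<in> l \<and> vec.span {b} \<in> l \<and> vec.span {c} \<in> l"
  then obtain W where W: "pg_sub 1 W" "a \<in> W" "b \<in> W" "c \<in> W"
    unfolding pg2_lines_def using vec.span_base[of _ "{_}"] by fastforce
  then obtain u v where "W = vec.span {u, v}" using pg_sub_1_imp_span by blast
  with W show "det3 a b c = 0" by (auto simp: in_span_pair det3_def algebra_simps)
next
  assume "det3 a b c = 0"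
  then have "\<not> invertible (vector [a, b, c] :: 'a ^ 3 ^ 3)"
    by (simp add: det3_eq_det invertible_det_nz)
  then obtain n where n: "n \<noteq> 0" "(vector [a, b, c] :: 'a ^ 3 ^ 3) *v n = 0"
    by (metis invertible_left_inverse matrix_left_invertible_ker)
  let ?W = "{v :: 'a ^ 3. n$1 * v$1 + n$2 * v$2 + n$3 * v$3 = 0}"
  have W: "pg_sub 1 ?W" using n(1) by (rule pg_sub_kernel3)
  have "a \<in> ?W" "b \<in> ?W" "c \<in> ?W"
    using n(2) by (auto simp: vec3_eq_iff matrix_vector_mult_def sum_3 mult.commute)
  moreover have "vec.span {x} \<subseteq> ?W" if "x \<in> ?W" for x
    using W that unfolding pg_sub_def by (intro vec.span_minimal) auto
  ultimately have "vec.span {a} \<subseteq> ?W" "vec.span {b} \<subseteq> ?W" "vec.span {c} \<subseteq> ?W" by blast+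
  with W assms show "\<exists>l\<in>pg2_lines. vec.span {a} \<in> l \<and> vec.span {b} \<in> l \<and> vec.span {c} \<in> l"
    unfolding pg2_lines_def by (intro bexI[of _ "{X. pg_sub 0 X \<and> X \<subseteq> ?W}"]) auto
qed

text \<open>
  Lines are sets of points here, and a collineation is a bijection on points mapping every line onto
  a line. On a finite plane it then permutes the lines.
\<close>
definition collineation :: "(('a::field ^ 3) set \<Rightarrow> ('a ^ 3) set) \<Rightarrow> bool" where
  "collineation \<kappa> \<longleftrightarrow> bij_betw \<kappa> pg2_points pg2_points \<and> (\<forall>l\<in>pg2_lines. \<kappa> ` l \<in> pg2_lines)"

text \<open>
  A collineation acts on representing vectors by a function \<open>f\<close> that depends on the point only and
  preserves collinearity in both directions.
\<close>
lemma collineation_rep: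
  fixes \<kappa> :: "('a::{field,finite} ^ 3) set \<Rightarrow> ('a ^ 3) set"
  assumes "collineation \<kappa>"
  obtains f where "\<And>v. v \<noteq> 0 \<Longrightarrow> f v \<noteq> 0" "\<And>v. v \<noteq> 0 \<Longrightarrow> \<kappa> (vec.span {v}) = vec.span {f v}"
    "\<And>v c. c \<noteq> 0 \<Longrightarrow> f (c *s v) = f v"
    "\<And>a b c. a \<noteq> 0 \<Longrightarrow> b \<noteq> 0 \<Longrightarrow> c \<noteq> 0 \<Longrightarrow> det3 (f a) (f b) (f c) = 0 \<longleftrightarrow> det3 a b c = 0"
proof -
  have bij: "bij_betw \<kappa> pg2_points pg2_points" and lines: "\<And>l. l \<in> pg2_lines \<Longrightarrow> \<kappa> ` l \<in> pg2_lines"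
    using assms by (auto simp: collineation_def)
  define f where "f v = (SOME w. w \<noteq> 0 \<and> \<kappa> (vec.span {v}) = vec.span {w})" for v
  have f: "f v \<noteq> 0 \<and> \<kappa> (vec.span {v}) = vec.span {f v}" if "v \<noteq> 0" for v
  proof -
    have "\<kappa> (vec.span {v}) \<in> pg2_points"
      using bij that by (auto simp: bij_betw_def pg2_points_def)
    then have "\<exists>w. w \<noteq> 0 \<and> \<kappa> (vec.span {v}) = vec.span {w}"
      by (simp add: pg2_points_def pg_sub_0_iff)
    then show ?thesis unfolding f_def by (rule someI_ex)
  qed
  have sub: "l \<subseteq> pg2_points" if "l \<in> pg2_lines" for l
    using that by (auto simp: pg2_lines_def pg2_points_def)
  have inj: "inj_on \<kappa> pg2_points" using bij by (simp add: bij_betw_def)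
  \<comment> \<open>The collineation is injective on the finite set of lines, hence every line is an image of a line.\<close>
  have "inj_on ((`) \<kappa>) pg2_lines"
    using inj sub by (meson inj_onI inj_on_image_eq_iff)
  then have onto: "(`) \<kappa> ` pg2_lines = pg2_lines"
    using lines by (intro endo_inj_surj) auto
  show thesis
  proof (rule that)
    show "f v \<noteq> 0" "\<kappa> (vec.span {v}) = vec.span {f v}" if "v \<noteq> 0" for v using f that by auto
    show "f (c *s v) = f v" if "c \<noteq> 0" for c v
    proof (cases "v = 0")
      case False
      then have "vec.span {c *s v} = vec.span {v}" using that span_singleton_eq_iff[of v "c *s v"] by auto
      then show ?thesis by (simp add: f_def)
    qed simp
    fix a b c :: "'a ^ 3" assume nz: "a \<noteq> 0" "b \<noteq> 0" "c \<noteq> 0"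
    have pts: "vec.span {a} \<in> pg2_points" "vec.span {b} \<in> pg2_points" "vec.span {c} \<in> pg2_points"
      using nz by (auto simp: pg2_points_def)
    have mem: "\<kappa> X \<in> \<kappa> ` l \<longleftrightarrow> X \<in> l" if "l \<in> pg2_lines" "X \<in> pg2_points" for l X
      using inj_on_image_mem_iff[OF inj that(2) sub[OF that(1)]] .
    have "det3 (f a) (f b) (f c) = 0 \<longleftrightarrow>
        (\<exists>l\<in>pg2_lines. \<kappa> (vec.span {a}) \<in> l \<and> \<kappa> (vec.span {b}) \<in> l \<and> \<kappa> (vec.span {c}) \<in> l)"
      using collinear_iff_det3[of "f a" "f b" "f c"] f nz by simp
    also have "\<dots> \<longleftrightarrow> (\<exists>l\<in>(`) \<kappa> ` pg2_lines.
        \<kappa> (vec.span {a}) \<in> l \<and> \<kappa> (vec.span {b}) \<in> l \<and> \<kappa> (vec.span {c}) \<in> l)"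
      by (simp only: onto)
    also have "\<dots> \<longleftrightarrow> (\<exists>l\<in>pg2_lines. vec.span {a} \<in> l \<and> vec.span {b} \<in> l \<and> vec.span {c} \<in> l)"
      using mem pts by auto
    also have "\<dots> \<longleftrightarrow> det3 a b c = 0" using collinear_iff_det3[OF nz] .
    finally show "det3 (f a) (f b) (f c) = 0 \<longleftrightarrow> det3 a b c = 0" .
  qed
qed

text \<open>
  The fundamental theorem of projective geometry for a plane, normalised: a collineation fixing the
  points \<open>(1,0,0)\<close>, \<open>(0,1,0)\<close>, \<open>(0,0,1)\<close>, \<open>(1,1,1)\<close> applies a field endomorphism \<open>\<theta>\<close> to homogeneous
  coordinates. Here \<open>\<theta> x\<close> is read off from the image of \<open>(x, 0, 1)\<close>.
\<close>
lemma frame_fixing_collineation: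
  fixes h :: "'a::field ^ 3 \<Rightarrow> 'a ^ 3"
  assumes nz: "\<And>v. v \<noteq> 0 \<Longrightarrow> h v \<noteq> 0"
    and hom: "\<And>v c. c \<noteq> 0 \<Longrightarrow> h (c *s v) = h v"
    and det: "\<And>a b c. a \<noteq> 0 \<Longrightarrow> b \<noteq> 0 \<Longrightarrow> c \<noteq> 0 \<Longrightarrow> det3 (h a) (h b) (h c) = 0 \<longleftrightarrow> det3 a b c = 0"
    and e1: "h (vector [1, 0, 0]) = c1 *s vector [1, 0, 0]"
    and e2: "h (vector [0, 1, 0]) = c2 *s vector [0, 1, 0]"
    and e3: "h (vector [0, 0, 1]) = c3 *s vector [0, 0, 1]"
    and e0: "h (vector [1, 1, 1]) = c0 *s vector [1, 1, 1]"
  obtains \<theta> where "\<theta> 1 = 1" "\<And>x y. \<theta> (x + y) = \<theta> x + \<theta> y" "\<And>x y. \<theta> (x * y) = \<theta> x * \<theta> y"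
    "\<And>v. v \<noteq> 0 \<Longrightarrow> \<exists>c. c \<noteq> 0 \<and> h v = c *s (\<chi> i. \<theta> (v $ i))"
proof -
  let ?v = "\<lambda>x y z. vector [x, y, z] :: 'a ^ 3"
  have v0 [simp]: "?v x y z = 0 \<longleftrightarrow> x = 0 \<and> y = 0 \<and> z = 0" for x y z
    by (simp add: vec3_eq_iff)
  have c: "c1 \<noteq> 0" "c2 \<noteq> 0" "c3 \<noteq> 0" "c0 \<noteq> 0"
    using nz[of "?v 1 0 0"] nz[of "?v 0 1 0"] nz[of "?v 0 0 1"] nz[of "?v 1 1 1"] e0 e1 e2 e3 by auto
  have d: "det3 (h (?v x y z)) (h (?v x' y' z')) (h (?v x'' y'' z'')) = 0 \<longleftrightarrow>
      x * (y' * z'' - z' * y'') - y * (x' * z'' - z' * x'') + z * (x' * y'' - y' * x'') = 0"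
    if "x \<noteq> 0 \<or> y \<noteq> 0 \<or> z \<noteq> 0" "x' \<noteq> 0 \<or> y' \<noteq> 0 \<or> z' \<noteq> 0" "x'' \<noteq> 0 \<or> y'' \<noteq> 0 \<or> z'' \<noteq> 0"
    for x y z x' y' z' x'' y'' z''
    using det[of "?v x y z" "?v x' y' z'" "?v x'' y'' z''"] that by (simp add: det3_def)
  define \<theta> where "\<theta> x = h (?v x 0 1) $ 1 / h (?v x 0 1) $ 3" for x
  define \<theta>' where "\<theta>' y = h (?v 0 y 1) $ 2 / h (?v 0 y 1) $ 3" for y
  have h3: "h (?v x y 1) $ 3 \<noteq> 0" for x y
    using d[of 1 0 0 0 1 0 x y 1] c by (simp add: e1 e2 det3_def)
  \<comment> \<open>The line joining \<open>(0,1,0)\<close> and \<open>(x,0,1)\<close> contains \<open>(x,y,1)\<close>; similarly for the second coordinate.\<close>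
  have X: "h (?v x y 1) $ 1 = \<theta> x * h (?v x y 1) $ 3" for x y
    using d[of 0 1 0 x 0 1 x y 1] c h3[of x 0] by (simp add: e2 det3_def \<theta>_def field_simps)
  have Y: "h (?v x y 1) $ 2 = \<theta>' y * h (?v x y 1) $ 3" for x y
    using d[of 1 0 0 0 y 1 x y 1] c h3[of 0 y] by (simp add: e1 det3_def \<theta>'_def field_simps)
  \<comment> \<open>The line joining \<open>(0,0,1)\<close> and \<open>(1,1,1)\<close> is fixed and contains \<open>(x,x,1)\<close>.\<close>
  have "\<theta>' x = \<theta> x" for x
    using d[of 0 0 1 1 1 1 x x 1] c h3[of x x] X[of x x] Y[of x x] by (simp add: e3 e0 det3_def)
  note Y = Y[unfolded this]
  have h: "h (?v x y 1) = h (?v x y 1) $ 3 *s ?v (\<theta> x) (\<theta> y) 1" for x y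
    using X[of x y] Y[of x y] by (simp add: vec3_eq_iff)
  have \<theta>0: "\<theta> 0 = 0" using e3 c by (simp add: \<theta>_def)
  have \<theta>1: "\<theta> 1 = 1" using X[of 1 1] c by (simp add: e0)
  have i3: "h (?v 1 m 0) $ 3 = 0" for m
    using d[of 1 0 0 0 1 0 1 m 0] c by (simp add: e1 e2 det3_def)
  have i2: "h (?v 1 m 0) $ 2 = \<theta> m * h (?v 1 m 0) $ 1" for m
    using d[of 0 0 1 1 m 0 1 m 1] c h3[of 1 m] X[of 1 m] Y[of 1 m]
    by (simp add: e3 det3_def \<theta>1 field_simps)
  have i1: "h (?v 1 m 0) $ 1 \<noteq> 0" for m
    using nz[of "?v 1 m 0"] i3[of m] i2[of m] by (auto simp: vec3_eq_iff)
  \<comment> \<open>The point \<open>(x, m x, 1)\<close> lies on the line of slope \<open>m\<close> through the origin.\<close>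
  have mult: "\<theta> (m * x) = \<theta> m * \<theta> x" for m x
  proof -
    have "det3 (h (?v 0 0 1)) (h (?v 1 m 0)) (h (?v x (m * x) 1)) = 0" by (subst d) auto
    then show ?thesis using c i1[of m] i2[of m] i3[of m] h3[of x "m * x"] X[of x "m * x"] Y[of x "m * x"]
      by (simp add: e3 det3_def)
  qed
  \<comment> \<open>The point \<open>(x, x + b, 1)\<close> lies on the line of slope \<open>1\<close> through \<open>(0, b, 1)\<close>.\<close>
  have add: "\<theta> (x + b) = \<theta> x + \<theta> b" for x b
  proof -
    have "det3 (h (?v 0 b 1)) (h (?v 1 1 0)) (h (?v x (x + b) 1)) = 0" by (subst d) auto
    then have "h (?v 0 b 1) $ 3 * (h (?v 1 1 0) $ 1 * (h (?v x (x + b) 1) $ 3 * (\<theta> (x + b) - \<theta> x - \<theta> b))) = 0"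
      unfolding det3_def using i2[of 1] i3[of 1] X[of x "x + b"] Y[of x "x + b"] X[of 0 b] Y[of 0 b]
      by (simp add: \<theta>0 \<theta>1 algebra_simps)
    then have "\<theta> (x + b) - \<theta> x - \<theta> b = 0" using h3 i1 by simp
    then show ?thesis by (simp add: algebra_simps)
  qed
  show thesis
  proof (rule that[of \<theta>])
    fix v :: "'a ^ 3" assume v: "v \<noteq> 0"
    have vv: "v = ?v (v$1) (v$2) (v$3)" by (simp add: vec3_eq_iff)
    show "\<exists>c. c \<noteq> 0 \<and> h v = c *s (\<chi> i. \<theta> (v $ i))"
    proof (cases "v $ 3 = 0")
      case False
      let ?x = "v$1 / v$3" and ?y = "v$2 / v$3"
      have "v = v$3 *s ?v ?x ?y 1" using False by (simp add: vec3_eq_iff)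
      then have "h v = h (?v ?x ?y 1) $ 3 *s ?v (\<theta> ?x) (\<theta> ?y) 1"
        using hom[OF False] h by metis
      moreover have "\<theta> (v$1) = \<theta> ?x * \<theta> (v$3)" "\<theta> (v$2) = \<theta> ?y * \<theta> (v$3)"
        using mult[of ?x "v$3"] mult[of ?y "v$3"] False by auto
      moreover have "\<theta> (v$3) \<noteq> 0" using mult[of "v$3" "inverse (v$3)"] False \<theta>1 by auto
      ultimately have "h v = (h (?v ?x ?y 1) $ 3 / \<theta> (v$3)) *s (\<chi> i. \<theta> (v $ i))"
        by (simp add: vec3_eq_iff)
      then show ?thesis using h3[of ?x ?y] \<open>\<theta> (v$3) \<noteq> 0\<close> by (metis divide_eq_0_iff)
    next
      case v3: True
      show ?thesis
      proof (cases "v $ 1 = 0")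
        case False
        let ?m = "v$2 / v$1"
        have "v = v$1 *s ?v 1 ?m 0" using False v3 by (simp add: vec3_eq_iff)
        then have "h v = h (?v 1 ?m 0)" using hom[OF False] by metis
        then have "h v = h (?v 1 ?m 0) $ 1 *s ?v 1 (\<theta> ?m) 0"
          using i2[of ?m] i3[of ?m] by (simp add: vec3_eq_iff)
        moreover have "\<theta> (v$2) = \<theta> ?m * \<theta> (v$1)" using mult[of ?m "v$1"] False by auto
        moreover have "\<theta> (v$1) \<noteq> 0" using mult[of "v$1" "inverse (v$1)"] False \<theta>1 by auto
        ultimately have "h v = (h (?v 1 ?m 0) $ 1 / \<theta> (v$1)) *s (\<chi> i. \<theta> (v $ i))"
          using v3 by (simp add: vec3_eq_iff \<theta>0)
        then show ?thesis using i1[of ?m] \<open>\<theta> (v$1) \<noteq> 0\<close> by (metis divide_eq_0_iff)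
      next
        case v1: True
        have v2: "v $ 2 \<noteq> 0" using v v1 v3 by (auto simp: vec3_eq_iff)
        have "v = v$2 *s ?v 0 1 0" using v1 v3 by (simp add: vec3_eq_iff)
        then have "h v = c2 *s ?v 0 1 0" using hom[OF v2] e2 by metis
        moreover have "\<theta> (v$2) \<noteq> 0" using mult[of "v$2" "inverse (v$2)"] v2 \<theta>1 by auto
        ultimately have "h v = (c2 / \<theta> (v$2)) *s (\<chi> i. \<theta> (v $ i))"
          using v1 v3 by (simp add: vec3_eq_iff \<theta>0)
        then show ?thesis using c \<open>\<theta> (v$2) \<noteq> 0\<close> by (metis divide_eq_0_iff)
      qed
    qed
  qed (use \<theta>1 add mult in auto)
qed

text \<open>
  The group \<open>PGL(3)\<close> is transitive on frames: some matrix takes the standard frame to four given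
  points, no three of them collinear. The scalars come from Cramer's rule.
\<close>
lemma exists_frame_matrix:
  fixes u0 u1 u2 u3 :: "'a::field ^ 3"
  assumes "det3 u1 u2 u3 \<noteq> 0" "det3 u0 u2 u3 \<noteq> 0" "det3 u1 u0 u3 \<noteq> 0" "det3 u1 u2 u0 \<noteq> 0"
  obtains B :: "'a ^ 3 ^ 3" and l1 l2 l3 where "invertible B" "l1 \<noteq> 0" "l2 \<noteq> 0" "l3 \<noteq> 0"
    "B *v vector [1, 0, 0] = l1 *s u1" "B *v vector [0, 1, 0] = l2 *s u2"
    "B *v vector [0, 0, 1] = l3 *s u3" "B *v vector [1, 1, 1] = u0"
proof -
  define D where "D = det3 u1 u2 u3"
  define l1 where "l1 = det3 u0 u2 u3 / D"
  define l2 where "l2 = det3 u1 u0 u3 / D"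
  define l3 where "l3 = det3 u1 u2 u0 / D"
  have D: "D \<noteq> 0" using assms by (simp add: D_def)
  have l: "l1 \<noteq> 0" "l2 \<noteq> 0" "l3 \<noteq> 0" using assms D by (auto simp: l1_def l2_def l3_def)
  define B :: "'a ^ 3 ^ 3" where
    "B = transpose (vector [l1 *s u1, l2 *s u2, l3 *s u3])"
  have Bx: "B *v x = x$1 *s (l1 *s u1) + x$2 *s (l2 *s u2) + x$3 *s (l3 *s u3)" for x
    by (simp add: B_def transpose_def vec_eq_iff matrix_vector_mult_def sum_3 mult.commute)
  have "det B = det3 (l1 *s u1) (l2 *s u2) (l3 *s u3)"
    by (simp add: B_def det_transpose det3_eq_det)
  also have "\<dots> = l1 * l2 * l3 * D" by (simp add: det3_scale D_def)
  finally have "invertible B" using l D by (simp add: invertible_det_nz)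
  moreover have "l1 *s u1 + l2 *s u2 + l3 *s u3 = u0"
  proof -
    have "det3 u0 u2 u3 * u1 $ i + det3 u1 u0 u3 * u2 $ i + det3 u1 u2 u0 * u3 $ i = D * u0 $ i" for i
      using exhaust_3[of i] by (elim disjE) (simp_all add: det3_def D_def algebra_simps)
    then have "(det3 u0 u2 u3 * u1 $ i + det3 u1 u0 u3 * u2 $ i + det3 u1 u2 u0 * u3 $ i) / D = u0 $ i" for i
      using D by simp
    then show ?thesis by (simp add: vec_eq_iff l1_def l2_def l3_def add_divide_distrib)
  qed
  ultimately show thesis using that[of B l1 l2 l3] l by (simp add: Bx)
qed

context cubic_extension
begin

lemma image_span_matrix: "(\<lambda>v. A *v v) ` vec.span {v} = vec.span {A *v v}"
  using vec.span_image[of A "{v}"] by simp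

lemma order_q_subplane_iff:
  "order_q_subplane emb \<Delta> \<longleftrightarrow> (\<exists>A :: 'k ^ 3 ^ 3. invertible A \<and>
     \<Delta> = {vec.span {A *v emb_vec emb x} | x. x \<noteq> 0})"
proof -
  have "{(\<lambda>v. A *v v) ` pg_ext emb X | X. pg_sub 0 (X :: ('f ^ 3) set)} =
      {vec.span {A *v emb_vec emb x} | x. x \<noteq> 0}" for A :: "'k ^ 3 ^ 3"
  proof -
    have "{X :: ('f ^ 3) set. pg_sub 0 X} = (\<lambda>v. vec.span {v}) ` {v. v \<noteq> 0}"
      by (auto simp: pg_sub_0_iff)
    then have eq: "(\<lambda>X. (\<lambda>v. A *v v) ` pg_ext emb X) ` {X. pg_sub 0 (X :: ('f ^ 3) set)} =
        (\<lambda>x. vec.span {A *v emb_vec emb x}) ` {x. x \<noteq> 0}"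
      by (simp only: image_image pg_ext_point image_span_matrix)
    have "{(\<lambda>v. A *v v) ` pg_ext emb X | X. pg_sub 0 (X :: ('f ^ 3) set)} =
        (\<lambda>X. (\<lambda>v. A *v v) ` pg_ext emb X) ` {X. pg_sub 0 X}" by blast
    also have "\<dots> = {vec.span {A *v emb_vec emb x} | x. x \<noteq> 0}" unfolding eq by blast
    finally show ?thesis .
  qed
  then show ?thesis by (simp add: order_q_subplane_def)
qed

text \<open>
  The image of the subfield consists of fixed points of the Frobenius map, because \<open>\<theta>\<close> commutes with
  \<open>q\<close>-th powers; equality follows by counting.
\<close>
lemma endo_subfield:
  assumes "\<theta> 1 = 1" "\<And>x y. \<theta> (x + y) = \<theta> x + \<theta> y" "\<And>x y. \<theta> (x * y) = \<theta> x * \<theta> (y :: 'k)"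
  shows "(\<lambda>x. \<theta> (emb x)) ` UNIV = range emb"
proof -
  have pw: "\<theta> (x ^ n) = \<theta> x ^ n" for x n by (induction n) (auto simp: assms)
  have "frob (\<theta> (emb x)) = \<theta> (emb x)" for x
    by (metis frob_def frob_emb pw)
  then have sub: "(\<lambda>x. \<theta> (emb x)) ` UNIV \<subseteq> range emb" using frob_fixed_iff by auto
  have inj: "inj \<theta>"
  proof (rule injI)
    fix x y assume eq: "\<theta> x = \<theta> y"
    show "x = y"
    proof (rule ccontr)
      assume ne: "x \<noteq> y"
      have "\<theta> (x - y) = 0" using assms(2)[of "x - y" y] eq by simp
      then have "\<theta> ((x - y) * inverse (x - y)) = 0" by (simp add: assms(3) del: right_inverse)
      then show False using ne assms(1) by simp
    qed
  qed
  show ?thesis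
  proof (rule card_subset_eq[OF _ sub])
    have "inj (\<lambda>x. \<theta> (emb x))" using inj by (metis emb_inj injD injI)
    then show "card ((\<lambda>x. \<theta> (emb x)) ` UNIV) = card (range emb)"
      using inj_emb by (simp add: card_image)
  qed simp
qed

text \<open>
  For a subplane \<open>A PG(2,q)\<close> and a collineation \<open>\<kappa>\<close>, choose a matrix \<open>B\<close> with the same effect as \<open>\<kappa> A\<close>
  on the standard frame. Then \<open>B^-1 \<kappa> A\<close> fixes that frame and so preserves \<open>PG(2,q)\<close>, whence
  \<open>\<kappa> A PG(2,q) = B PG(2,q)\<close>.
\<close>
theorem collineation_order_q_subplane:
  assumes \<kappa>: "collineation (\<kappa> :: ('k ^ 3) set \<Rightarrow> ('k ^ 3) set)" and \<Delta>: "order_q_subplane emb \<Delta>"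
  shows "order_q_subplane emb (\<kappa> ` \<Delta>)"
proof -
  obtain A :: "'k ^ 3 ^ 3" where A: "invertible A"
    and \<Delta>_eq: "\<Delta> = {vec.span {A *v emb_vec emb x} | x. x \<noteq> 0}"
    using \<Delta> unfolding order_q_subplane_iff by blast
  obtain f where f: "\<And>v. v \<noteq> 0 \<Longrightarrow> f v \<noteq> 0" "\<And>v. v \<noteq> 0 \<Longrightarrow> \<kappa> (vec.span {v}) = vec.span {f v}"
    "\<And>v c. c \<noteq> 0 \<Longrightarrow> f (c *s v) = f v"
    "\<And>a b c. a \<noteq> 0 \<Longrightarrow> b \<noteq> 0 \<Longrightarrow> c \<noteq> 0 \<Longrightarrow> det3 (f a) (f b) (f c) = 0 \<longleftrightarrow> det3 a b c = 0"
  proof (rule collineation_rep[OF \<kappa>], goal_cases)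
    case (1 f)
    show thesis by (rule that[of f]; fact 1)
  qed
  have A0: "A *v v = 0 \<longleftrightarrow> v = 0" for v
  proof -
    obtain A' where "A' ** A = mat 1" using A by (auto simp: invertible_def)
    then have "A' *v (A *v v) = v" by (simp add: matrix_vector_mul_assoc)
    then show ?thesis by auto
  qed
  define f' where "f' v = f (A *v v)" for v
  have f'det: "det3 (f' a) (f' b) (f' c) = 0 \<longleftrightarrow> det3 a b c = 0"
    if "a \<noteq> 0" "b \<noteq> 0" "c \<noteq> 0" for a b c
    using f(4)[of "A *v a" "A *v b" "A *v c"] A A0 that
    by (simp add: f'_def det3_matrix invertible_det_nz)
  have f'hom: "f' (c *s v) = f' v" if "c \<noteq> 0" for c v
    using f(3)[OF that, of "A *v v"] by (simp add: f'_def vec.scale)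
  have f'nz: "f' v \<noteq> 0" if "v \<noteq> 0" for v using f(1) A0 that by (simp add: f'_def)
  have v0 [simp]: "(vector [x, y, z] :: 'k ^ 3) = 0 \<longleftrightarrow> x = 0 \<and> y = 0 \<and> z = 0" for x y z
    by (simp add: vec3_eq_iff)
  have "det3 (f' (vector [1, 0, 0])) (f' (vector [0, 1, 0])) (f' (vector [0, 0, 1])) \<noteq> 0"
    "det3 (f' (vector [1, 1, 1])) (f' (vector [0, 1, 0])) (f' (vector [0, 0, 1])) \<noteq> 0"
    "det3 (f' (vector [1, 0, 0])) (f' (vector [1, 1, 1])) (f' (vector [0, 0, 1])) \<noteq> 0"
    "det3 (f' (vector [1, 0, 0])) (f' (vector [0, 1, 0])) (f' (vector [1, 1, 1])) \<noteq> 0"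
    by (simp_all add: f'det, simp_all add: det3_def)
  then obtain B :: "'k ^ 3 ^ 3" and l1 l2 l3 where B: "invertible B" "l1 \<noteq> 0" "l2 \<noteq> 0" "l3 \<noteq> 0"
    "B *v vector [1, 0, 0] = l1 *s f' (vector [1, 0, 0])" "B *v vector [0, 1, 0] = l2 *s f' (vector [0, 1, 0])"
    "B *v vector [0, 0, 1] = l3 *s f' (vector [0, 0, 1])" "B *v vector [1, 1, 1] = f' (vector [1, 1, 1])"
  proof (rule exists_frame_matrix, goal_cases)
    case (1 B l1 l2 l3)
    show thesis by (rule that[of B l1 l2 l3]; fact 1)
  qed
  obtain C where C: "C ** B = mat 1" "B ** C = mat 1" using B(1) by (auto simp: invertible_def)
  have CB: "C *v (B *v v) = v" and BC: "B *v (C *v v) = v" for v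
    by (simp_all add: matrix_vector_mul_assoc C)
  have detC: "det C \<noteq> 0" using C by (metis invertible_def invertible_det_nz)
  define h where "h v = C *v f' v" for v
  have hl: "h v = inverse l *s w" if "B *v w = l *s f' v" "l \<noteq> 0" for v w l
  proof -
    have "w = l *s h v" using CB[of w] that(1) by (simp add: h_def vec.scale)
    then show ?thesis using that(2) by (simp add: vector_smult_assoc)
  qed
  have hnz: "h v \<noteq> 0" if "v \<noteq> 0" for v using f'nz[OF that] BC[of "f' v"] by (auto simp: h_def)
  have hhom: "h (c *s v) = h v" if "c \<noteq> 0" for c v using f'hom[OF that] by (simp add: h_def)
  have hdet: "det3 (h a) (h b) (h c) = 0 \<longleftrightarrow> det3 a b c = 0" if "a \<noteq> 0" "b \<noteq> 0" "c \<noteq> 0" for a b c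
    using f'det[OF that] detC by (simp add: h_def det3_matrix)
  have h0: "h (vector [1, 1, 1]) = 1 *s vector [1, 1, 1]"
    using CB[of "vector [1, 1, 1]"] B(8) by (simp add: h_def)
  obtain \<theta> where \<theta>: "\<theta> 1 = 1" "\<And>x y. \<theta> (x + y) = \<theta> x + \<theta> y" "\<And>x y. \<theta> (x * y) = \<theta> x * \<theta> y"
    "\<And>v. v \<noteq> 0 \<Longrightarrow> \<exists>c. c \<noteq> 0 \<and> h v = c *s (\<chi> i. \<theta> (v $ i))"
  proof (rule frame_fixing_collineation[of h "inverse l1" "inverse l2" "inverse l3" 1], goal_cases)
    case (8 \<theta>)
    show thesis by (rule that[of \<theta>]; fact 8)
  qed (erule hnz | erule hhom | (rule hdet; assumption) | rule hl[OF B(5,2)] hl[OF B(6,3)]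
      hl[OF B(7,4)] h0)+
  have \<kappa>A: "\<kappa> (vec.span {A *v v}) = vec.span {B *v (\<chi> i. \<theta> (v $ i))}" if v: "v \<noteq> 0" for v
  proof -
    obtain c where c: "c \<noteq> 0" "h v = c *s (\<chi> i. \<theta> (v $ i))" using \<theta>(4)[OF v] by blast
    then have "f' v = c *s (B *v (\<chi> i. \<theta> (v $ i)))"
      using BC[of "f' v"] by (simp add: h_def vec.scale)
    moreover have "\<kappa> (vec.span {A *v v}) = vec.span {f' v}" using f(2) A0 v by (simp add: f'_def)
    moreover have "B *v (\<chi> i. \<theta> (v $ i)) \<noteq> 0" using f'nz[OF v] calculation(1) by auto
    ultimately show ?thesis using c(1) by (metis span_singleton_eq_iff)
  qed
  have range: "(\<lambda>x. \<theta> (emb x)) ` UNIV = range emb" by (rule endo_subfield) (use \<theta> in auto)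
  have \<theta>0: "\<theta> 0 = 0" by (metis add_cancel_right_right \<theta>(2))
  have "\<kappa> ` \<Delta> = {vec.span {B *v emb_vec emb x} | x. x \<noteq> 0}"
  proof (intro equalityI subsetI)
    fix X assume "X \<in> \<kappa> ` \<Delta>"
    then obtain x where x: "x \<noteq> 0" "X = \<kappa> (vec.span {A *v emb_vec emb x})" by (auto simp: \<Delta>_eq)
    have "\<forall>i. \<exists>y. \<theta> (emb (x $ i)) = emb y" using range by (metis rangeE rangeI)
    then obtain y where y: "\<forall>i. \<theta> (emb (x $ i)) = emb (y $ i)" by (auto simp: lambda_skolem)
    then have ye: "(\<chi> i. \<theta> (emb_vec emb x $ i)) = emb_vec emb y" by (simp add: vec_eq_iff)
    have "X = vec.span {B *v emb_vec emb y}" using \<kappa>A[of "emb_vec emb x"] x ye by simp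
    moreover have "y \<noteq> 0"
    proof
      assume "y = 0"
      then have "\<exists>c. h (emb_vec emb x) = c *s 0" using \<theta>(4)[of "emb_vec emb x"] x ye by auto
      then have "f' (emb_vec emb x) = 0" using BC[of "f' (emb_vec emb x)"] by (auto simp: h_def)
      then show False using f'nz x by simp
    qed
    ultimately show "X \<in> {vec.span {B *v emb_vec emb x} | x. x \<noteq> 0}" by blast
  next
    fix X assume "X \<in> {vec.span {B *v emb_vec emb x} | x. x \<noteq> 0}"
    then obtain y where y: "y \<noteq> 0" "X = vec.span {B *v emb_vec emb y}" by blast
    have "\<forall>i. \<exists>x. \<theta> (emb x) = emb (y $ i)" using range by (metis rangeE rangeI)
    then obtain x where x: "\<forall>i. \<theta> (emb (x $ i)) = emb (y $ i)" by (auto simp: lambda_skolem)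
    then have xe: "(\<chi> i. \<theta> (emb_vec emb x $ i)) = emb_vec emb y" by (simp add: vec_eq_iff)
    have "x \<noteq> 0"
    proof
      assume "x = 0"
      then have "emb (y $ i) = 0" for i using x \<theta>0 by (metis emb_0 zero_index)
      then show False using y(1) by (simp add: vec_eq_iff)
    qed
    then show "X \<in> \<kappa> ` \<Delta>" using \<kappa>A[of "emb_vec emb x"] xe y(2) by (auto simp: \<Delta>_eq)
  qed
  then show ?thesis using B(1) unfolding order_q_subplane_iff by blast
qed

end


section \<open>Coordinates adapted to a transversal line\<close>

context cubic_extension
begin

lemma span_conjugates:
  "vec.span (\<Union>i<3. frob_image q i (vec.span {u})) = vec.span {u, frobv u, frobv (frobv u)}"
proof (rule antisym)
  show "vec.span (\<Union>i<3. frob_image q i (vec.span {u})) \<subseteq> vec.span {u, frobv u, frobv (frobv u)}"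
    by (rule vec.span_minimal)
       (auto simp: UN_frob_image in_span_singleton vec.span_base intro!: vec.span_scale)
  have "{u, frobv u, frobv (frobv u)} \<subseteq> (\<Union>i<3. frob_image q i (vec.span {u}))"
    by (auto simp: UN_frob_image vec.span_base)
  then show "vec.span {u, frobv u, frobv (frobv u)} \<subseteq> vec.span (\<Union>i<3. frob_image q i (vec.span {u}))"
    by (rule vec.span_mono)
qed

end

text \<open>
  An affine point \<open>e\<close> and two points \<open>p\<close>, \<open>r\<close> spanning the transversal line \<open>g\<close>.
\<close>
locale transversal_frame = cubic_extension q emb
  for q and emb :: "'f::{field,finite} \<Rightarrow> 'k::{field,finite}" +
  fixes H :: "('f ^ 7) set" and S :: "('f ^ 7) set set" and g :: "('k ^ 7) set"
    and e :: "'f ^ 7" and p r :: "'k ^ 7"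
  assumes pg_H: "pg_sub 5 H" and spread: "two_spread q H S"
    and transversal: "transversal_line q emb H S g"
    and e_notin: "e \<notin> H" and g_eq: "g = vec.span {p, r}"
begin

text \<open>
  The linear combination of the seven basis vectors \<open>e\<close>; \<open>p\<close> and its conjugates; \<open>r\<close> and its
  conjugates.
\<close>
definition comb :: "'k \<Rightarrow> 'k \<Rightarrow> 'k \<Rightarrow> 'k \<Rightarrow> 'k \<Rightarrow> 'k \<Rightarrow> 'k \<Rightarrow> 'k ^ 7" where
  "comb c x0 x1 x2 y0 y1 y2 = c *s emb_vec emb e
     + (x0 *s p + x1 *s frobv p + x2 *s frobv (frobv p))
     + (y0 *s r + y1 *s frobv r + y2 *s frobv (frobv r))"

lemma comb_add:
  "comb c x0 x1 x2 y0 y1 y2 + comb c' x0' x1' x2' y0' y1' y2' =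
     comb (c + c') (x0 + x0') (x1 + x1') (x2 + x2') (y0 + y0') (y1 + y1') (y2 + y2')"
  by (simp add: comb_def vec.scale_left_distrib algebra_simps)

lemma comb_scale:
  "a *s comb c x0 x1 x2 y0 y1 y2 = comb (a * c) (a * x0) (a * x1) (a * x2) (a * y0) (a * y1) (a * y2)"
  by (simp add: comb_def vec.scale_right_distrib vector_smult_assoc)

lemma comb_0: "comb 0 0 0 0 0 0 0 = 0"
  by (simp add: comb_def)

lemma frobv_comb:
  "frobv (comb c x0 x1 x2 y0 y1 y2) =
     comb (frob c) (frob x2) (frob x0) (frob x1) (frob y2) (frob y0) (frob y1)"
  by (simp add: comb_def algebra_simps)

lemma pg_ext_H: "pg_ext emb H = {comb 0 x0 x1 x2 y0 y1 y2 | x0 x1 x2 y0 y1 y2. True}" (is "_ = ?T")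
proof (rule antisym)
  have H: "pg_ext emb H = vec.span (\<Union>i<3. frob_image q i g)"
    using transversal by (simp add: transversal_line_def)
  have "vec.subspace ?T"
  proof (rule vec.subspaceI)
    show "0 \<in> ?T" using comb_0 by (metis (mono_tags, lifting) mem_Collect_eq)
    show "x + y \<in> ?T" if "x \<in> ?T" "y \<in> ?T" for x y
    proof -
      from that obtain x0 x1 x2 y0 y1 y2 x0' x1' x2' y0' y1' y2' where
        "x = comb 0 x0 x1 x2 y0 y1 y2" "y = comb 0 x0' x1' x2' y0' y1' y2'" by blast
      then have "x + y = comb 0 (x0 + x0') (x1 + x1') (x2 + x2') (y0 + y0') (y1 + y1') (y2 + y2')"
        by (simp add: comb_add)
      then show ?thesis by blast
    qed
    show "c *s x \<in> ?T" if "x \<in> ?T" for c x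
    proof -
      from that obtain x0 x1 x2 y0 y1 y2 where "x = comb 0 x0 x1 x2 y0 y1 y2" by blast
      then have "c *s x = comb 0 (c * x0) (c * x1) (c * x2) (c * y0) (c * y1) (c * y2)"
        by (simp add: comb_scale)
      then show ?thesis by blast
    qed
  qed
  moreover have "(\<Union>i<3. frob_image q i g) \<subseteq> ?T"
  proof
    fix v assume "v \<in> (\<Union>i<3. frob_image q i g)"
    then obtain u where "u \<in> g" and v: "v = u \<or> v = frobv u \<or> v = frobv (frobv u)"
      by (auto simp: UN_frob_image)
    then obtain a b where "u = a *s p + b *s r" by (auto simp: g_eq in_span_pair)
    with v have "v = comb 0 a 0 0 b 0 0 \<or> v = comb 0 0 (frob a) 0 0 (frob b) 0 \<or>
        v = comb 0 0 0 (frob (frob a)) 0 0 (frob (frob b))"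
      by (auto simp: comb_def)
    then show "v \<in> ?T" by blast
  qed
  ultimately show "pg_ext emb H \<subseteq> ?T" unfolding H by (rule vec.span_minimal[rotated])
  have "p \<in> g" "r \<in> g" by (auto simp: g_eq vec.span_base)
  then have "{p, frobv p, frobv (frobv p), r, frobv r, frobv (frobv r)} \<subseteq> (\<Union>i<3. frob_image q i g)"
    by (auto simp: UN_frob_image)
  then have "{p, frobv p, frobv (frobv p), r, frobv r, frobv (frobv r)} \<subseteq> pg_ext emb H"
    unfolding H using vec.span_superset by blast
  moreover have "vec.subspace (pg_ext emb H)" by (simp add: pg_ext_def)
  ultimately show "?T \<subseteq> pg_ext emb H"
    by (auto simp: comb_def intro!: vec.subspace_add vec.subspace_scale)
qed

lemma emb_e_notin: "emb_vec emb e \<notin> pg_ext emb H"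
  using e_notin pg_H emb_vec_in_pg_ext[of H e] by (simp add: pg_sub_def)

lemma comb_surj: "\<exists>c x0 x1 x2 y0 y1 y2. v = comb c x0 x1 x2 y0 y1 y2"
proof -
  have "emb_vec emb e \<notin> vec.span (pg_ext emb H)"
    using emb_e_notin unfolding pg_ext_def vec.span_span .
  then have "vec.dim (insert (emb_vec emb e) (pg_ext emb H)) = 7"
    using pg_H by (simp add: vec.dim_insert dim_pg_ext pg_sub_def)
  then have "vec.span (insert (emb_vec emb e) (pg_ext emb H)) = UNIV"
    using vec.dim_eq_full[of "insert (emb_vec emb e) (pg_ext emb H)"]
    by (simp add: card_cart_basis vec.dimension_def)
  then obtain c where "v - c *s emb_vec emb e \<in> vec.span (pg_ext emb H)"
    using vec.span_breakdown_eq[of v "emb_vec emb e" "pg_ext emb H"] by auto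
  then have "v - c *s emb_vec emb e \<in> pg_ext emb H" unfolding pg_ext_def vec.span_span .
  then obtain x0 x1 x2 y0 y1 y2 where "v - c *s emb_vec emb e = comb 0 x0 x1 x2 y0 y1 y2"
    unfolding pg_ext_H by blast
  then have "v = comb c x0 x1 x2 y0 y1 y2" by (simp add: comb_def algebra_simps)
  then show ?thesis by blast
qed

text \<open>
  The seven vectors span \<open>GF(q^3)^7\<close>, so by finiteness the coordinate map is also injective.
\<close>
lemma comb_eq_iff:
  "comb c x0 x1 x2 y0 y1 y2 = comb c' x0' x1' x2' y0' y1' y2' \<longleftrightarrow>
     c = c' \<and> x0 = x0' \<and> x1 = x1' \<and> x2 = x2' \<and> y0 = y0' \<and> y1 = y1' \<and> y2 = y2'"
proof -
  define F where "F = (\<lambda>(c, x0, x1, x2, y0, y1, y2). comb c x0 x1 x2 y0 y1 y2)"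
  have "surj F"
    unfolding surj_def
  proof
    fix v
    obtain c x0 x1 x2 y0 y1 y2 where "v = comb c x0 x1 x2 y0 y1 y2" using comb_surj by blast
    then have "v = F (c, x0, x1, x2, y0, y1, y2)" by (simp add: F_def)
    then show "\<exists>x. v = F x" ..
  qed
  moreover have "card (UNIV :: ('k \<times> 'k \<times> 'k \<times> 'k \<times> 'k \<times> 'k \<times> 'k) set) = CARD('k ^ 7)"
    by (simp add: card_prod numeral_eq_Suc)
  ultimately have "inj F" by (intro eq_card_imp_inj_on) simp_all
  then have "F (c, x0, x1, x2, y0, y1, y2) = F (c', x0', x1', x2', y0', y1', y2') \<longleftrightarrow>
      (c, x0, x1, x2, y0, y1, y2) = (c', x0', x1', x2', y0', y1', y2')" by (rule inj_eq)
  then show ?thesis by (simp add: F_def)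
qed

text \<open>
  The vector with coordinates \<open>(c, y, x)\<close>; it is rational over \<open>GF(q)\<close> if and only if \<open>c\<close> is.
\<close>
definition ratK :: "'k ^ 3 \<Rightarrow> 'k ^ 7" where
  "ratK w = comb (w$1) (w$3) (frob (w$3)) (frob (frob (w$3))) (w$2) (frob (w$2)) (frob (frob (w$2)))"

lemma ratK_add: "ratK (v + w) = ratK v + ratK w"
  by (simp add: ratK_def comb_add)

lemma ratK_scale: "frob a = a \<Longrightarrow> ratK (a *s w) = a *s ratK w"
  by (simp add: ratK_def comb_scale)

lemma ratK_eq_iff: "ratK v = ratK w \<longleftrightarrow> v = w"
  by (auto simp: ratK_def comb_eq_iff vec3_eq_iff)

text \<open>
  The coordinates \<open>(c, y, x)\<close> of a vector over \<open>GF(q)\<close>. The hyperplane at infinity is \<open>c = 0\<close>.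
\<close>
definition \<Phi> :: "'f ^ 7 \<Rightarrow> 'k ^ 3" where
  "\<Phi> v = (THE w. ratK w = emb_vec emb v)"

lemma ex_ratK: "\<exists>w. ratK w = emb_vec emb v \<and> frob (w$1) = w$1"
proof -
  obtain c x0 x1 x2 y0 y1 y2 where v: "emb_vec emb v = comb c x0 x1 x2 y0 y1 y2"
    using comb_surj by blast
  then have "frobv (comb c x0 x1 x2 y0 y1 y2) = comb c x0 x1 x2 y0 y1 y2"
    by (metis frobv_emb_vec)
  then have "frob c = c" "x1 = frob x0" "x2 = frob (frob x0)" "y1 = frob y0" "y2 = frob (frob y0)"
    unfolding frobv_comb comb_eq_iff by auto
  then show ?thesis
    by (intro exI[of _ "vector [c, y0, x0]"]) (simp add: ratK_def v)
qed

lemma \<Phi>_eqI: "ratK w = emb_vec emb v \<Longrightarrow> \<Phi> v = w"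
  unfolding \<Phi>_def by (rule the_equality) (auto simp: ratK_eq_iff[symmetric])

lemma ratK_\<Phi>: "ratK (\<Phi> v) = emb_vec emb v" and frob_\<Phi>1: "frob (\<Phi> v $ 1) = \<Phi> v $ 1"
  using ex_ratK[of v] \<Phi>_eqI by auto

lemma \<Phi>_add: "\<Phi> (v + w) = \<Phi> v + \<Phi> w"
  by (rule \<Phi>_eqI) (simp add: ratK_add ratK_\<Phi>)

lemma \<Phi>_scale: "\<Phi> (c *s v) = emb c *s \<Phi> v"
  by (rule \<Phi>_eqI) (simp add: ratK_scale ratK_\<Phi>)

lemma \<Phi>_0 [simp]: "\<Phi> 0 = 0"
  using \<Phi>_scale[of 0 0] by simp

lemma \<Phi>_eq_iff: "\<Phi> v = \<Phi> w \<longleftrightarrow> v = w"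
  by (metis emb_vec_inj ratK_\<Phi>)

lemma \<Phi>_eq_0 [simp]: "\<Phi> v = 0 \<longleftrightarrow> v = 0"
  using \<Phi>_eq_iff[of v 0] by simp

lemma \<Phi>_diff: "\<Phi> (v - w) = \<Phi> v - \<Phi> w"
  using \<Phi>_add[of "v - w" w] by simp

lemma \<Phi>_surj: 
  assumes "frob (w$1) = w$1"
  obtains v where "\<Phi> v = w"
proof -
  have "frobv (ratK w) = ratK w" using assms by (simp add: ratK_def frobv_comb)
  then obtain v where "ratK w = emb_vec emb v" by (rule frobv_fixed)
  then show thesis using that \<Phi>_eqI by blast
qed

lemma in_H_iff: "v \<in> H \<longleftrightarrow> \<Phi> v $ 1 = 0"
proof -
  have "v \<in> H \<longleftrightarrow> ratK (\<Phi> v) \<in> pg_ext emb H"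
    using pg_H emb_vec_in_pg_ext[of H v] by (simp add: pg_sub_def ratK_\<Phi>)
  also have "\<dots> \<longleftrightarrow> \<Phi> v $ 1 = 0"
    unfolding pg_ext_H by (auto simp: ratK_def comb_eq_iff)
  finally show ?thesis .
qed


section \<open>The Bruck-Bose plane in coordinates\<close>

text \<open>
  The Bruck-Bose point that corresponds to a point \<open>Y\<close> of \<open>PG(2,q^3)\<close>. If \<open>Y\<close> lies on the line \<open>c = 0\<close>
  this is a spread element, otherwise it is an affine point.
\<close>
definition \<Psi> :: "('k ^ 3) set \<Rightarrow> ('f ^ 7) set" where
  "\<Psi> Y = {v. \<Phi> v \<in> Y}"

lemma subspace_\<Psi>: "vec.subspace W \<Longrightarrow> vec.subspace (\<Psi> W)"
  by (rule vec.subspaceI)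
     (auto simp: \<Psi>_def \<Phi>_add \<Phi>_scale vec.subspace_0 vec.subspace_add vec.subspace_scale)

lemma comb_conj:
  "a *s (y *s r + x *s p) + b *s frobv (y *s r + x *s p) + c *s frobv (frobv (y *s r + x *s p)) =
     comb 0 (a * x) (b * frob x) (c * frob (frob x)) (a * y) (b * frob y) (c * frob (frob y))"
  by (simp add: comb_def algebra_simps vec.scale_right_distrib vector_smult_assoc)

lemma \<Psi>_infinity:
  "\<Psi> (vec.span {vector [0, y, x]}) =
     {v. emb_vec emb v \<in> vec.span (\<Union>i<3. frob_image q i (vec.span {y *s r + x *s p}))}"
proof -
  have "\<Phi> v \<in> vec.span {vector [0, y, x]} \<longleftrightarrow>
      emb_vec emb v \<in> vec.span (\<Union>i<3. frob_image q i (vec.span {y *s r + x *s p}))" for v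
  proof
    assume "\<Phi> v \<in> vec.span {vector [0, y, x]}"
    then obtain a where "\<Phi> v = a *s vector [0, y, x]" by (auto simp: in_span_singleton)
    then have "emb_vec emb v = ratK (a *s vector [0, y, x])" by (metis ratK_\<Phi>)
    also have "\<dots> = a *s (y *s r + x *s p) + frob a *s frobv (y *s r + x *s p)
        + frob (frob a) *s frobv (frobv (y *s r + x *s p))"
      unfolding comb_conj by (simp add: ratK_def)
    finally show "emb_vec emb v \<in> vec.span (\<Union>i<3. frob_image q i (vec.span {y *s r + x *s p}))"
      unfolding span_conjugates in_span_triple by blast
  next
    assume "emb_vec emb v \<in> vec.span (\<Union>i<3. frob_image q i (vec.span {y *s r + x *s p}))"
    then obtain a b c where "ratK (\<Phi> v) = comb 0 (a * x) (b * frob x) (c * frob (frob x))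
        (a * y) (b * frob y) (c * frob (frob y))"
      unfolding span_conjugates in_span_triple comb_conj ratK_\<Phi> by blast
    then have "\<Phi> v = a *s vector [0, y, x]"
      by (simp add: ratK_def comb_eq_iff vec3_eq_iff)
    then show "\<Phi> v \<in> vec.span {vector [0, y, x]}" by (auto simp: in_span_singleton)
  qed
  then show ?thesis by (simp add: \<Psi>_def)
qed

lemma yr_xp_eq_0: "y *s r + x *s p = 0 \<longleftrightarrow> y = 0 \<and> x = 0"
proof -
  have "y *s r + x *s p = 0 \<longleftrightarrow> comb 0 x 0 0 y 0 0 = comb 0 0 0 0 0 0 0"
    by (simp add: comb_def add.commute)
  then show ?thesis by (simp add: comb_eq_iff conj_commute)
qed

lemma S_eq: "S = \<Psi> ` {Y. pg_sub 0 Y \<and> Y \<subseteq> {w. w$1 = 0}}"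
proof -
  have S: "S = {{v. emb_vec emb v \<in> vec.span (\<Union>i<3. frob_image q i P)} | P. pg_sub 0 P \<and> P \<subseteq> g}"
    using transversal by (simp add: transversal_line_def)
  have pts: "pg_sub 0 P \<and> P \<subseteq> g \<longleftrightarrow>
      (\<exists>y x. (y \<noteq> 0 \<or> x \<noteq> 0) \<and> P = vec.span {y *s r + x *s p})" for P
  proof
    assume P: "pg_sub 0 P \<and> P \<subseteq> g"
    then obtain v where v: "v \<noteq> 0" "P = vec.span {v}" by (auto simp: pg_sub_0_iff)
    then have "v \<in> g" using P vec.span_base[of v "{v}"] by blast
    then obtain x y where "v = x *s p + y *s r" by (auto simp: g_eq in_span_pair)
    then show "\<exists>y x. (y \<noteq> 0 \<or> x \<noteq> 0) \<and> P = vec.span {y *s r + x *s p}"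
      using v by (intro exI[of _ y] exI[of _ x]) (auto simp: add.commute)
  next
    assume "\<exists>y x. (y \<noteq> 0 \<or> x \<noteq> 0) \<and> P = vec.span {y *s r + x *s p}"
    then obtain y x where yx: "y \<noteq> 0 \<or> x \<noteq> 0" "P = vec.span {y *s r + x *s p}" by blast
    have "y *s r + x *s p \<in> g" unfolding g_eq in_span_pair by (metis add.commute)
    then have "P \<subseteq> g" using yx(2) g_eq by (simp add: vec.span_minimal)
    then show "pg_sub 0 P \<and> P \<subseteq> g" using yx yr_xp_eq_0 by auto
  qed
  have pts': "pg_sub 0 Y \<and> Y \<subseteq> {w. w$1 = 0} \<longleftrightarrow>
      (\<exists>y x. (y \<noteq> 0 \<or> x \<noteq> 0) \<and> Y = vec.span {vector [0, y, x]})" for Y :: "('k ^ 3) set"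
  proof
    assume Y: "pg_sub 0 Y \<and> Y \<subseteq> {w. w$1 = 0}"
    then obtain v where v: "v \<noteq> 0" "Y = vec.span {v}" by (auto simp: pg_sub_0_iff)
    then have "v$1 = 0" using Y vec.span_base[of v "{v}"] by blast
    then have "v = vector [0, v$2, v$3]" by (simp add: vec3_eq_iff)
    then have "Y = vec.span {vector [0, v$2, v$3]}" using v(2) by simp
    moreover have "v$2 \<noteq> 0 \<or> v$3 \<noteq> 0" using v(1) \<open>v$1 = 0\<close> by (auto simp: vec3_eq_iff)
    ultimately show "\<exists>y x. (y \<noteq> 0 \<or> x \<noteq> 0) \<and> Y = vec.span {vector [0, y, x]}" by blast
  next
    assume "\<exists>y x. (y \<noteq> 0 \<or> x \<noteq> 0) \<and> Y = vec.span {vector [0, y, x]}"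
    then show "pg_sub 0 Y \<and> Y \<subseteq> {w. w$1 = 0}"
      by (auto simp: in_span_singleton vec3_eq_iff)
  qed
  have "S = {\<Psi> (vec.span {vector [0, y, x]}) | y x. y \<noteq> 0 \<or> x \<noteq> 0}"
    unfolding S pts \<Psi>_infinity by blast
  also have "\<dots> = \<Psi> ` {Y. pg_sub 0 Y \<and> Y \<subseteq> {w. w$1 = 0}}"
    unfolding pts' by blast
  finally show ?thesis .
qed

lemma \<Psi>_affine:
  assumes "\<Phi> v $ 1 \<noteq> 0"
  shows "\<Psi> (vec.span {\<Phi> v}) = vec.span {v}"
proof (intro equalityI subsetI)
  fix x assume "x \<in> \<Psi> (vec.span {\<Phi> v})"
  then obtain c where c: "\<Phi> x = c *s \<Phi> v" by (auto simp: \<Psi>_def in_span_singleton)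
  then have "\<Phi> x $ 1 = c * \<Phi> v $ 1" by simp
  then have "frob c = c" using frob_\<Phi>1[of x] frob_\<Phi>1[of v] assms by simp
  then obtain d where "c = emb d" using frob_fixed_iff by blast
  then have "\<Phi> x = \<Phi> (d *s v)" using c by (simp add: \<Phi>_scale)
  then show "x \<in> vec.span {v}" by (auto simp: \<Phi>_eq_iff in_span_singleton)
next
  fix x assume "x \<in> vec.span {v}"
  then show "x \<in> \<Psi> (vec.span {\<Phi> v})" by (auto simp: \<Psi>_def in_span_singleton \<Phi>_scale)
qed

lemma affine_rep:
  assumes "pg_sub 0 Y" "\<not> Y \<subseteq> {w. w$1 = 0}"
  obtains v where "Y = vec.span {\<Phi> v}" "\<Phi> v $ 1 = 1"
proof -
  obtain w where w: "w \<in> Y" "w$1 \<noteq> 0" using assms by blast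
  let ?w = "inverse (w$1) *s w"
  have w1: "?w $ 1 = 1" using w by simp
  then obtain v where v: "\<Phi> v = ?w" using \<Phi>_surj[of ?w] by (metis frob_1)
  have "Y = vec.span {w}" using assms w by (intro pg_sub_0_eq_span) auto
  also have "\<dots> = vec.span {?w}" using w
    by (subst span_singleton_eq_iff) (auto intro!: exI[of _ "inverse (w$1)"] simp: vec3_eq_iff)
  finally have "Y = vec.span {\<Phi> v}" by (simp only: v)
  moreover have "\<Phi> v $ 1 = 1" unfolding v by (rule w1)
  ultimately show thesis by (rule that)
qed

lemma affine_points_iff:
  "X \<in> affine_points H \<longleftrightarrow> (\<exists>Y. pg_sub 0 Y \<and> \<not> Y \<subseteq> {w. w$1 = 0} \<and> X = \<Psi> Y)"
proof
  assume "X \<in> affine_points H"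
  then have X: "pg_sub 0 X" "\<not> X \<subseteq> H" by (auto simp: affine_points_def)
  then obtain v where v: "v \<in> X" "v \<notin> H" by blast
  then have "v \<noteq> 0" by (auto simp: in_H_iff)
  then have "X = vec.span {v}" using X v by (intro pg_sub_0_eq_span)
  then have "X = \<Psi> (vec.span {\<Phi> v})" using v by (simp add: \<Psi>_affine in_H_iff)
  moreover have "\<Phi> v \<in> vec.span {\<Phi> v}" by (simp add: vec.span_base)
  ultimately show "\<exists>Y. pg_sub 0 Y \<and> \<not> Y \<subseteq> {w. w$1 = 0} \<and> X = \<Psi> Y"
    using v \<open>v \<noteq> 0\<close> by (intro exI[of _ "vec.span {\<Phi> v}"]) (auto simp: in_H_iff)
next
  assume "\<exists>Y. pg_sub 0 Y \<and> \<not> Y \<subseteq> {w. w$1 = 0} \<and> X = \<Psi> Y"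
  then obtain Y where Y: "pg_sub 0 Y" "\<not> Y \<subseteq> {w. w$1 = 0}" "X = \<Psi> Y" by blast
  obtain v where v: "Y = vec.span {\<Phi> v}" "\<Phi> v $ 1 = 1" by (rule affine_rep[OF Y(1,2)])
  then have "X = vec.span {v}" using Y by (simp add: \<Psi>_affine)
  moreover have "v \<notin> H" using v by (simp add: in_H_iff)
  moreover have "v \<noteq> 0" using v by auto
  ultimately show "X \<in> affine_points H"
    using vec.span_base[of v "{v}"] by (auto simp: affine_points_def)
qed

lemma bb_points_eq: "bb_points H S = \<Psi> ` pg2_points"
proof -
  have "affine_points H = \<Psi> ` {Y. pg_sub 0 Y \<and> \<not> Y \<subseteq> {w. w$1 = 0}}"
  proof (rule set_eqI)
    show "X \<in> affine_points H \<longleftrightarrow> X \<in> \<Psi> ` {Y. pg_sub 0 Y \<and> \<not> Y \<subseteq> {w. w$1 = 0}}" for X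
      unfolding affine_points_iff[of X] image_iff by blast
  qed
  then have "bb_points H S = \<Psi> ` ({Y. pg_sub 0 Y \<and> \<not> Y \<subseteq> {w. w$1 = 0}} \<union> {Y. pg_sub 0 Y \<and> Y \<subseteq> {w. w$1 = 0}})"
    by (simp only: bb_points_def S_eq image_Un)
  also have "{Y. pg_sub 0 Y \<and> \<not> Y \<subseteq> {w. w$1 = 0}} \<union> {Y. pg_sub 0 Y \<and> Y \<subseteq> {w. w$1 = 0}} = pg2_points"
    unfolding pg2_points_def by blast
  finally show ?thesis .
qed

lemma \<Psi>_nonzero:
  assumes "pg_sub 0 Y"
  obtains v where "v \<noteq> 0" "v \<in> \<Psi> Y"
proof (cases "Y \<subseteq> {w. w$1 = 0}")
  case True
  obtain w where w: "w \<noteq> 0" "Y = vec.span {w}" using assms pg_sub_0_iff by blast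
  then have "w \<in> Y" by (simp add: vec.span_base)
  then have "w$1 = 0" using True by blast
  then obtain v where "\<Phi> v = w" using \<Phi>_surj[of w] by auto
  then show thesis using that w \<open>w \<in> Y\<close> by (auto simp: \<Psi>_def)
next
  case False
  then obtain v where v: "Y = vec.span {\<Phi> v}" "\<Phi> v $ 1 = 1" by (rule affine_rep[OF assms])
  then have "v \<noteq> 0" by auto
  then show thesis using that[of v] v by (auto simp: \<Psi>_def vec.span_base)
qed

text \<open>
  A nonzero rational vector with coordinates in \<open>Y\<close> determines \<open>Y\<close>.
\<close>
lemma \<Psi>_inj: "inj_on \<Psi> pg2_points"
proof (rule inj_onI)
  fix Y Z assume YZ: "Y \<in> pg2_points" "Z \<in> pg2_points" "\<Psi> Y = \<Psi> Z"
  then obtain v where v: "v \<noteq> 0" "v \<in> \<Psi> Y" using \<Psi>_nonzero by (auto simp: pg2_points_def)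
  then have "\<Phi> v \<noteq> 0" "\<Phi> v \<in> Y" "\<Phi> v \<in> Z" using YZ by (auto simp: \<Psi>_def)
  then have "Y = vec.span {\<Phi> v}" "Z = vec.span {\<Phi> v}"
    using YZ pg_sub_0_eq_span[of Y "\<Phi> v"] pg_sub_0_eq_span[of Z "\<Phi> v"] by (simp_all add: pg2_points_def)
  then show "Y = Z" by simp
qed

text \<open>
  The line \<open>c = 0\<close> goes to the spread. For any other line \<open>W\<close>, the rational vectors with coordinates in
  \<open>W\<close> form a 3-space, spanned by one affine point and the spread element given by \<open>W \<inter> {c = 0}\<close>.
\<close>
lemma \<Psi>_line:
  assumes "l \<in> pg2_lines"
  shows "\<Psi> ` l \<in> bb_lines H S"
proof -
  obtain W where W: "pg_sub 1 W" and l: "l = {X. pg_sub 0 X \<and> X \<subseteq> W}"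
    using assms by (auto simp: pg2_lines_def)
  have subW: "vec.subspace W" using W by (simp add: pg_sub_def)
  have sub0: "vec.subspace {w :: 'k ^ 3. w$1 = 0}" by (rule vec.subspaceI) auto
  show ?thesis
  proof (cases "W \<subseteq> {w. w$1 = 0}")
    case True
    have "pg_sub 1 {w :: 'k ^ 3. w$1 = 0}"
      using pg_sub_kernel3[of "vector [1, 0, 0] :: 'k ^ 3"] by (simp add: vec3_eq_iff)
    then have "W = {w. w$1 = 0}" using True W by (intro vec.subspace_dim_equal) (auto simp: pg_sub_def)
    then have "\<Psi> ` l = S" unfolding l S_eq by simp
    then show ?thesis by (simp add: bb_lines_def)
  next
    case False
    then obtain w where w: "w \<in> W" "w$1 \<noteq> 0" by blast
    let ?w = "inverse (w$1) *s w"
    have w1: "?w $ 1 = 1" "?w \<in> W" using w subW by (auto simp: vec.subspace_scale)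
    then obtain v where v: "\<Phi> v = ?w" using \<Phi>_surj[of ?w] by (metis frob_1)
    then have v1: "\<Phi> v $ 1 = 1" "\<Phi> v \<in> W" using w1 by simp_all
    define W0 where "W0 = W \<inter> {w. w$1 = 0}"
    have subW0: "vec.subspace W0" unfolding W0_def using subW sub0 by (rule vec.subspace_inter)
    have "vec.span (insert (\<Phi> v) W0) = W"
    proof (rule vec.span_subspace)
      show "insert (\<Phi> v) W0 \<subseteq> W" using v1 by (auto simp: W0_def)
      show "W \<subseteq> vec.span (insert (\<Phi> v) W0)"
      proof
        fix x assume "x \<in> W"
        then have "x - x$1 *s \<Phi> v \<in> W0"
          using v1 subW by (auto simp: W0_def intro: vec.subspace_diff vec.subspace_scale)
        then show "x \<in> vec.span (insert (\<Phi> v) W0)"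
          using vec.span_base by (auto simp: vec.span_breakdown_eq)
      qed
    qed (fact subW)
    moreover have "\<Phi> v \<notin> W0" using v1 by (simp add: W0_def)
    then have "\<Phi> v \<notin> vec.span W0" using subW0 by (metis vec.span_eq_iff)
    then have "vec.dim (vec.span (insert (\<Phi> v) W0)) = vec.dim W0 + 1" by (simp add: vec.dim_insert)
    ultimately have "vec.dim W = vec.dim W0 + 1" by simp
    then have W0: "pg_sub 0 W0" using W subW0 by (simp add: pg_sub_def)
    define \<sigma> where "\<sigma> = \<Psi> W0"
    have \<sigma>S: "\<sigma> \<in> S" unfolding S_eq \<sigma>_def using W0 by (auto simp: W0_def)
    have \<sigma>: "vec.subspace \<sigma>" "vec.dim \<sigma> = 3" "\<sigma> \<subseteq> H"
      using spread \<sigma>S by (auto simp: two_spread_def pg_sub_def)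
    have \<sigma>L: "\<sigma> \<subseteq> \<Psi> W" by (auto simp: \<sigma>_def \<Psi>_def W0_def)
    have vL: "v \<in> \<Psi> W" using v1 by (simp add: \<Psi>_def)
    have vH: "v \<notin> H" using v1 by (simp add: in_H_iff)
    have "vec.span (insert v \<sigma>) = \<Psi> W"
    proof (rule vec.span_subspace)
      show "insert v \<sigma> \<subseteq> \<Psi> W" using vL \<sigma>L by simp
      show "\<Psi> W \<subseteq> vec.span (insert v \<sigma>)"
      proof
        fix x assume x: "x \<in> \<Psi> W"
        obtain c where c: "\<Phi> x $ 1 = emb c" using frob_\<Phi>1[of x] frob_fixed_iff by (metis rangeE)
        have "x - c *s v \<in> \<sigma>" using c v1 x subW
          by (auto simp: \<sigma>_def \<Psi>_def W0_def \<Phi>_diff \<Phi>_scale intro: vec.subspace_diff vec.subspace_scale)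
        then show "x \<in> vec.span (insert v \<sigma>)" using vec.span_base by (auto simp: vec.span_breakdown_eq)
      qed
    qed (use subW in \<open>rule subspace_\<Psi>\<close>)
    moreover have "v \<notin> \<sigma>" using \<sigma>(3) vH by blast
    then have "v \<notin> vec.span \<sigma>" using \<sigma>(1) by (metis vec.span_eq_iff)
    then have "vec.dim (vec.span (insert v \<sigma>)) = vec.dim \<sigma> + 1" by (simp add: vec.dim_insert)
    ultimately have "vec.dim (\<Psi> W) = 4" using \<sigma>(2) by simp
    then have L: "pg_sub 3 (\<Psi> W)" using subspace_\<Psi>[OF subW] by (simp add: pg_sub_def)
    have "\<Psi> ` l = {X \<in> affine_points H. X \<subseteq> \<Psi> W} \<union> {\<sigma>}"
    proof (intro equalityI subsetI)
      fix X assume "X \<in> \<Psi> ` l"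
      then obtain Y where Y: "pg_sub 0 Y" "Y \<subseteq> W" "X = \<Psi> Y" unfolding l by blast
      show "X \<in> {X \<in> affine_points H. X \<subseteq> \<Psi> W} \<union> {\<sigma>}"
      proof (cases "Y \<subseteq> {w. w$1 = 0}")
        case True
        then have "Y \<subseteq> W0" using Y by (auto simp: W0_def)
        then have "Y = W0" using Y W0 by (intro vec.subspace_dim_equal) (auto simp: pg_sub_def)
        then show ?thesis using Y by (simp add: \<sigma>_def)
      next
        case False
        then have "X \<in> affine_points H" unfolding affine_points_iff using Y by blast
        moreover have "X \<subseteq> \<Psi> W" using Y by (auto simp: \<Psi>_def)
        ultimately show ?thesis by simp
      qed
    next
      fix X assume "X \<in> {X \<in> affine_points H. X \<subseteq> \<Psi> W} \<union> {\<sigma>}"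
      then consider "X = \<sigma>" | "X \<in> affine_points H" "X \<subseteq> \<Psi> W" by blast
      then show "X \<in> \<Psi> ` l"
      proof cases
        case 1
        then show ?thesis using W0 unfolding l \<sigma>_def by (auto simp: W0_def)
      next
        case 2
        then obtain Y where Y: "pg_sub 0 Y" "X = \<Psi> Y" unfolding affine_points_iff by blast
        obtain x where x: "x \<noteq> 0" "x \<in> \<Psi> Y" using \<Psi>_nonzero[OF Y(1)] by blast
        then have "\<Phi> x \<in> Y" "\<Phi> x \<in> W" "\<Phi> x \<noteq> 0" using 2 Y by (auto simp: \<Psi>_def)
        then have "Y = vec.span {\<Phi> x}" using Y by (intro pg_sub_0_eq_span)
        then have "Y \<subseteq> W" using \<open>\<Phi> x \<in> W\<close> subW by (simp add: vec.span_minimal)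
        then show ?thesis using Y unfolding l by blast
      qed
    qed
    moreover have "\<not> \<Psi> W \<subseteq> H" using vL vH by blast
    ultimately show ?thesis using L \<sigma>S \<sigma>L unfolding bb_lines_def by blast
  qed
qed

theorem collineation_identification:
  assumes "bb_identification H S \<iota>"
  shows "collineation (\<iota> \<circ> \<Psi>)"
  unfolding collineation_def
proof
  have "bij_betw \<Psi> pg2_points (bb_points H S)"
    using \<Psi>_inj bb_points_eq by (simp add: bij_betw_def)
  then show "bij_betw (\<iota> \<circ> \<Psi>) pg2_points pg2_points"
    using assms unfolding bb_identification_def by (metis bij_betw_trans)
  show "\<forall>l\<in>pg2_lines. (\<iota> \<circ> \<Psi>) ` l \<in> pg2_lines"
  proof
    fix l :: "('k ^ 3) set set" assume "l \<in> pg2_lines"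
    then have "\<Psi> ` l \<in> bb_lines H S" by (rule \<Psi>_line)
    then have "\<iota> ` \<Psi> ` l \<in> pg2_lines" using assms unfolding bb_identification_def by blast
    then show "(\<iota> \<circ> \<Psi>) ` l \<in> pg2_lines" by (simp add: image_comp)
  qed
qed

end


section \<open>The normal form of the two directrices\<close>

lemma quadratic_two_roots:
  fixes a b c x y :: "'a::field"
  assumes "a * x^2 + b * x + c = 0" "a * y^2 + b * y + c = 0" "x \<noteq> y"
  shows "b = - (a * (x + y))" "c = a * (x * y)"
proof -
  have "(x - y) * (a * (x + y) + b) = (a * x^2 + b * x + c) - (a * y^2 + b * y + c)"
    by (simp add: power2_eq_square algebra_simps)
  then have "a * (x + y) + b = 0" using assms by simp
  then show b: "b = - (a * (x + y))" by (simp add: eq_neg_iff_add_eq_0 add.commute)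
  show "c = a * (x * y)" using assms(1) unfolding b by (simp add: power2_eq_square algebra_simps)
qed

lemma quadratic_three_roots:
  fixes a b c x y z :: "'a::field"
  assumes "a * x^2 + b * x + c = 0" "a * y^2 + b * y + c = 0" "a * z^2 + b * z + c = 0"
    "x \<noteq> y" "y \<noteq> z" "x \<noteq> z"
  shows "a = 0" "b = 0" "c = 0"
proof -
  have "- (a * (x + y)) = - (a * (x + z))"
    using quadratic_two_roots(1)[OF assms(1,2,4)] quadratic_two_roots(1)[OF assms(1,3,6)] by metis
  then show a: "a = 0" using assms(5) by simp
  show "b = 0" "c = 0" using quadratic_two_roots[OF assms(1,2,4)] a by simp_all
qed

lemma cubic_three_roots:
  fixes a b c x y z :: "'a::field"
  assumes "x^3 + a * x^2 + b * x + c = 0" "y^3 + a * y^2 + b * y + c = 0"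
    "z^3 + a * z^2 + b * z + c = 0" "x \<noteq> y" "y \<noteq> z" "x \<noteq> z"
  shows "a = - (x + y + z)" "b = x * y + y * z + z * x" "c = - (x * y * z)"
proof -
  let ?a = "a + (x + y + z)" and ?b = "b - (x * y + y * z + z * x)" and ?c = "c + x * y * z"
  have eq: "?a * u^2 + ?b * u + ?c = u^3 + a * u^2 + b * u + c - (u - x) * (u - y) * (u - z)" for u
    by (simp add: power2_eq_square power3_eq_cube algebra_simps)
  have "?a * x^2 + ?b * x + ?c = 0" "?a * y^2 + ?b * y + ?c = 0" "?a * z^2 + ?b * z + ?c = 0"
    using assms(1-3) unfolding eq by simp_all
  then have "?a = 0" "?b = 0" "?c = 0" using quadratic_three_roots assms(4-6) by blast+
  then show "a = - (x + y + z)" "b = x * y + y * z + z * x" "c = - (x * y * z)"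
    by (metis eq_neg_iff_add_eq_0, simp, metis eq_neg_iff_add_eq_0)
qed

lemma span_scale_singleton:
  fixes v :: "'a::field ^ 'n"
  assumes "c \<noteq> 0"
  shows "vec.span {c *s v} = vec.span {v}"
  using assms span_singleton_eq_iff[of v "c *s v"] by (cases "v = 0") auto

lemma span_span_Un: "vec.span (vec.span {u} \<union> vec.span {v}) = vec.span {u, v}"
proof (rule antisym)
  show "vec.span (vec.span {u} \<union> vec.span {v}) \<subseteq> vec.span {u, v}"
    by (intro vec.span_minimal Un_least vec.subspace_span) (auto simp: vec.span_base)
  have "{u, v} \<subseteq> vec.span {u} \<union> vec.span {v}" by (auto simp: vec.span_base)
  then show "vec.span {u, v} \<subseteq> vec.span (vec.span {u} \<union> vec.span {v})" by (rule vec.span_mono)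
qed

text \<open>
  The frame together with a twisted cubic \<open>m\<close>, in normal form with respect to it, that passes through
  \<open>r\<close> and its conjugates at the parameters \<open>z\<close>, \<open>frob z\<close>, \<open>frob (frob z)\<close>. The indices \<open>1, 2, 3\<close> of \<open>P\<close>
  and \<open>Q\<close> count Frobenius powers, so index \<open>3\<close> is the point on \<open>g\<close> itself.
\<close>
locale normal_form = transversal_frame q emb H S g e p r
  for q and emb :: "'f::{field,finite} \<Rightarrow> 'k::{field,finite}" and H S g e p r +
  fixes z :: 'k and m :: "nat \<Rightarrow> 'k ^ 7" and P Q :: "nat \<Rightarrow> ('k ^ 7) set"
  assumes z: "frob z \<noteq> z"
    and P: "P 1 = vec.span {frobv p}" "P 2 = vec.span {frobv (frobv p)}" "P 3 = vec.span {p}"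
    and Q: "Q 1 = vec.span {frobv r}" "Q 2 = vec.span {frobv (frobv r)}" "Q 3 = vec.span {r}"
    and m: "\<And>s t. (\<Sum>j\<le>3. (s ^ (3 - j) * t ^ j) *s m j) =
      transversal_frame.comb q emb e p r
        ((s - z * t) * (s - frob z * t) * (s - frob (frob z) * t)) 0 0 0
        (t * (s - frob z * t) * (s - frob (frob z) * t))
        (t * (s - z * t) * (s - frob (frob z) * t))
        (t * (s - z * t) * (s - frob z * t))"
begin

abbreviation z1 where "z1 \<equiv> frob z"
abbreviation z2 where "z2 \<equiv> frob (frob z)"

text \<open>
  Linear forms in the parameter \<open>(s, t)\<close> that vanish at \<open>(z, 1)\<close> and its conjugates.
\<close>
definition D0 where "D0 s t = s - z * t"
definition D1 where "D1 s t = s - z1 * t"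
definition D2 where "D2 s t = s - z2 * t"

lemma z_distinct: "z \<noteq> z1" "z1 \<noteq> z2" "z \<noteq> z2" "z1 \<noteq> z" "z2 \<noteq> z1" "z2 \<noteq> z" "z \<noteq> 0"
proof -
  show 1: "z \<noteq> z1" "z1 \<noteq> z" using z by auto
  then show "z1 \<noteq> z2" "z2 \<noteq> z1" by simp_all
  show "z \<noteq> z2" "z2 \<noteq> z" using z by (metis frob_frob_frob)+
  show "z \<noteq> 0" using z by auto
qed

text \<open>
  Vectors of the conic and of the twisted cubic at the parameter \<open>(s, t)\<close>.
\<close>
definition Cp where "Cp s t = comb 0 (D1 s t * D2 s t) (D0 s t * D2 s t) (D0 s t * D1 s t) 0 0 0"
definition Np where "Np s t = comb (D0 s t * D1 s t * D2 s t) 0 0 0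
  (t * D1 s t * D2 s t) (t * D0 s t * D2 s t) (t * D0 s t * D1 s t)"

lemma m_Np: "(\<Sum>j\<le>3. (s ^ (3 - j) * t ^ j) *s m j) = Np s t"
  unfolding m Np_def D0_def D1_def D2_def ..

lemma curve_point_m: "curve_point 3 m s t = vec.span {Np s t}"
  by (simp add: curve_point_def m_Np)

lemma D_nz:
  assumes "(s, t) \<noteq> (0, 0)"
  shows "D0 s t \<noteq> 0 \<or> D1 s t \<noteq> 0" "D1 s t \<noteq> 0 \<or> D2 s t \<noteq> 0" "D0 s t \<noteq> 0 \<or> D2 s t \<noteq> 0"
    "D0 s t = 0 \<Longrightarrow> t \<noteq> 0" "D1 s t = 0 \<Longrightarrow> t \<noteq> 0" "D2 s t = 0 \<Longrightarrow> t \<noteq> 0"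
proof -
  have st: "s \<noteq> 0 \<or> t \<noteq> 0" using assms by simp
  have d: "D0 s t - D1 s t = (z1 - z) * t" "D1 s t - D2 s t = (z2 - z1) * t"
    "D0 s t - D2 s t = (z2 - z) * t"
    by (simp_all add: D0_def D1_def D2_def algebra_simps)
  show t: "D0 s t = 0 \<Longrightarrow> t \<noteq> 0" "D1 s t = 0 \<Longrightarrow> t \<noteq> 0" "D2 s t = 0 \<Longrightarrow> t \<noteq> 0"
    using st by (auto simp: D0_def D1_def D2_def)
  show "D0 s t \<noteq> 0 \<or> D1 s t \<noteq> 0" using d(1) t(1) z_distinct(4) by auto
  show "D1 s t \<noteq> 0 \<or> D2 s t \<noteq> 0" using d(2) t(2) z_distinct(5) by auto
  show "D0 s t \<noteq> 0 \<or> D2 s t \<noteq> 0" using d(3) t(1) z_distinct(6) by auto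
qed

lemma Cp_scale: "Cp (c * s) (c * t) = c^2 *s Cp s t"
  unfolding Cp_def comb_scale comb_eq_iff D0_def D1_def D2_def
  by (simp add: power2_eq_square algebra_simps)

lemma Np_scale: "Np (c * s) (c * t) = c^3 *s Np s t"
  unfolding Np_def comb_scale comb_eq_iff D0_def D1_def D2_def
  by (simp add: power3_eq_cube algebra_simps)

lemma comb_eq_0: "comb c x0 x1 x2 y0 y1 y2 = 0 \<longleftrightarrow>
    c = 0 \<and> x0 = 0 \<and> x1 = 0 \<and> x2 = 0 \<and> y0 = 0 \<and> y1 = 0 \<and> y2 = 0"
  using comb_eq_iff[of c x0 x1 x2 y0 y1 y2 0 0 0 0 0 0 0] by (simp add: comb_0)

lemma Cp_nz: 
  assumes "(s, t) \<noteq> (0, 0)"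
  shows "Cp s t \<noteq> 0"
  using D_nz(1-3)[OF assms] unfolding Cp_def comb_eq_0 mult_eq_0_iff by blast

lemma Np_nz: 
  assumes "(s, t) \<noteq> (0, 0)"
  shows "Np s t \<noteq> 0"
  using D_nz[OF assms] unfolding Np_def comb_eq_0 mult_eq_0_iff by blast

lemma proportional_iff:
  fixes s t s' t' :: 'k
  assumes "(s, t) \<noteq> (0, 0)" "(s', t') \<noteq> (0, 0)"
  shows "s * t' = s' * t \<longleftrightarrow> (\<exists>k. k \<noteq> 0 \<and> s' = k * s \<and> t' = k * t)"
proof
  assume eq: "s * t' = s' * t"
  show "\<exists>k. k \<noteq> 0 \<and> s' = k * s \<and> t' = k * t"
  proof (cases "s = 0")
    case True
    then have "t \<noteq> 0" "s' = 0" "t' \<noteq> 0" using assms eq by auto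
    then show ?thesis using True by (intro exI[of _ "t' / t"]) simp
  next
    case False
    then have "t' = s' / s * t" using eq by (simp add: field_simps)
    moreover have "s' \<noteq> 0" using calculation assms by auto
    ultimately show ?thesis using False by (intro exI[of _ "s' / s"]) simp
  qed
qed auto

lemma Cp_span_eq_iff:
  assumes "(s, t) \<noteq> (0, 0)" "(s', t') \<noteq> (0, 0)"
  shows "vec.span {Cp s t} = vec.span {Cp s' t'} \<longleftrightarrow> s * t' = s' * t"
proof
  assume "vec.span {Cp s t} = vec.span {Cp s' t'}"
  then obtain k where k: "k \<noteq> 0" "Cp s' t' = k *s Cp s t"
    using span_singleton_eq_iff[OF Cp_nz[OF assms(1)]] by blast
  then have e: "D1 s' t' * D2 s' t' = k * (D1 s t * D2 s t)"
    "D0 s' t' * D2 s' t' = k * (D0 s t * D2 s t)" "D0 s' t' * D1 s' t' = k * (D0 s t * D1 s t)"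
    by (simp_all add: Cp_def comb_scale comb_eq_iff)
  consider "D0 s t = 0" | "D1 s t = 0" | "D2 s t = 0"
    | "D0 s t \<noteq> 0" "D1 s t \<noteq> 0" "D2 s t \<noteq> 0" by blast
  then show "s * t' = s' * t"
  proof cases
    case 1
    then have "D0 s' t' = 0" using e D_nz[OF assms(1)] k(1) by auto
    then show ?thesis using 1 by (simp add: D0_def mult_ac)
  next
    case 2
    then have "D1 s' t' = 0" using e D_nz[OF assms(1)] k(1) by auto
    then show ?thesis using 2 by (simp add: D1_def mult_ac)
  next
    case 3
    then have "D2 s' t' = 0" using e D_nz[OF assms(1)] k(1) by auto
    then show ?thesis using 3 by (simp add: D2_def mult_ac)
  next
    case 4
    have "D2 s' t' \<noteq> 0" using e(1) k(1) 4 by auto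
    moreover have "D2 s' t' * D2 s t * (D0 s' t' * D1 s t - D1 s' t' * D0 s t) =
        (D0 s' t' * D2 s' t') * (D1 s t * D2 s t) - (D1 s' t' * D2 s' t') * (D0 s t * D2 s t)"
      by (simp add: algebra_simps)
    then have "D2 s' t' * D2 s t * (D0 s' t' * D1 s t - D1 s' t' * D0 s t) = 0"
      unfolding e by (simp add: algebra_simps)
    ultimately have "D0 s' t' * D1 s t - D1 s' t' * D0 s t = 0" using 4 by simp
    moreover have "D0 s' t' * D1 s t - D1 s' t' * D0 s t = (z - z1) * (s' * t - s * t')"
      by (simp add: D0_def D1_def algebra_simps)
    ultimately show ?thesis using z_distinct by simp
  qed
next
  assume "s * t' = s' * t"
  then obtain k where "k \<noteq> 0" "s' = k * s" "t' = k * t" using proportional_iff[OF assms] by blast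
  then show "vec.span {Cp s t} = vec.span {Cp s' t'}"
    by (simp add: Cp_scale span_scale_singleton)
qed

lemma Np_span_eq_iff:
  assumes "(s, t) \<noteq> (0, 0)" "(s', t') \<noteq> (0, 0)"
  shows "vec.span {Np s t} = vec.span {Np s' t'} \<longleftrightarrow> s * t' = s' * t"
proof
  assume "vec.span {Np s t} = vec.span {Np s' t'}"
  then obtain k where k: "k \<noteq> 0" "Np s' t' = k *s Np s t"
    using span_singleton_eq_iff[OF Np_nz[OF assms(1)]] by blast
  then have e: "D0 s' t' * D1 s' t' * D2 s' t' = k * (D0 s t * D1 s t * D2 s t)"
    "t' * D1 s' t' * D2 s' t' = k * (t * D1 s t * D2 s t)"
    "t' * D0 s' t' * D2 s' t' = k * (t * D0 s t * D2 s t)"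
    "t' * D0 s' t' * D1 s' t' = k * (t * D0 s t * D1 s t)"
    by (simp_all add: Np_def comb_scale comb_eq_iff)
  consider "D0 s t = 0" | "D1 s t = 0" | "D2 s t = 0"
    | "D0 s t \<noteq> 0" "D1 s t \<noteq> 0" "D2 s t \<noteq> 0" by blast
  then show "s * t' = s' * t"
  proof cases
    case 1
    then have "t' * D1 s' t' * D2 s' t' \<noteq> 0" using e(2) D_nz[OF assms(1)] k(1) by simp
    then have "D0 s' t' = 0" using e(1) 1 by auto
    then show ?thesis using 1 by (simp add: D0_def mult_ac)
  next
    case 2
    then have "t' * D0 s' t' * D2 s' t' \<noteq> 0" using e(3) D_nz[OF assms(1)] k(1) by simp
    then have "D1 s' t' = 0" using e(1) 2 by auto
    then show ?thesis using 2 by (simp add: D1_def mult_ac)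
  next
    case 3
    then have "t' * D0 s' t' * D1 s' t' \<noteq> 0" using e(4) D_nz[OF assms(1)] k(1) by simp
    then have "D2 s' t' = 0" using e(1) 3 by auto
    then show ?thesis using 3 by (simp add: D2_def mult_ac)
  next
    case 4
    have nz: "D1 s' t' \<noteq> 0" "D2 s' t' \<noteq> 0" using e(1) k(1) 4 by auto
    have "D1 s' t' * D2 s' t' * (D1 s t * D2 s t) * (t' * D0 s t - D0 s' t' * t) =
        (t' * D1 s' t' * D2 s' t') * (D0 s t * D1 s t * D2 s t) -
        (D0 s' t' * D1 s' t' * D2 s' t') * (t * D1 s t * D2 s t)"
      by (simp add: algebra_simps)
    also have "\<dots> = 0" unfolding e by (simp add: algebra_simps)
    finally have "t' * D0 s t - D0 s' t' * t = 0" using 4 nz by simp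
    then show ?thesis by (simp add: D0_def algebra_simps)
  qed
next
  assume "s * t' = s' * t"
  then obtain k where "k \<noteq> 0" "s' = k * s" "t' = k * t" using proportional_iff[OF assms] by blast
  then show "vec.span {Np s t} = vec.span {Np s' t'}"
    by (simp add: Np_scale span_scale_singleton)
qed

lemma span_Cp_vertex:
  "vec.span {Cp z 1} = P 3" "vec.span {Cp z1 1} = P 1" "vec.span {Cp z2 1} = P 2"
proof -
  have "Cp z 1 = ((z - z1) * (z - z2)) *s p" "Cp z1 1 = ((z1 - z) * (z1 - z2)) *s frobv p"
    "Cp z2 1 = ((z2 - z) * (z2 - z1)) *s frobv (frobv p)"
    by (simp_all add: Cp_def D0_def D1_def D2_def comb_def)
  then show "vec.span {Cp z 1} = P 3" "vec.span {Cp z1 1} = P 1" "vec.span {Cp z2 1} = P 2"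
    using z_distinct by (simp_all add: P span_scale_singleton del: One_nat_def)
qed

lemma span_Np_vertex:
  "vec.span {Np z 1} = Q 3" "vec.span {Np z1 1} = Q 1" "vec.span {Np z2 1} = Q 2"
proof -
  have "Np z 1 = ((z - z1) * (z - z2)) *s r" "Np z1 1 = ((z1 - z) * (z1 - z2)) *s frobv r"
    "Np z2 1 = ((z2 - z) * (z2 - z1)) *s frobv (frobv r)"
    by (simp_all add: Np_def D0_def D1_def D2_def comb_def)
  then show "vec.span {Np z 1} = Q 3" "vec.span {Np z1 1} = Q 1" "vec.span {Np z2 1} = Q 2"
    using z_distinct by (simp_all add: Q span_scale_singleton del: One_nat_def)
qed

text \<open>
  The equation of the conic parametrised by \<open>Cp\<close>, in the coordinates \<open>x\<close>, \<open>y\<close>, \<open>w\<close> with respect to \<open>p\<close>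
  and its conjugates. It expresses the linear relation
  \<open>(z1 - z2) D0 + (z2 - z) D1 + (z - z1) D2 = 0\<close>.
\<close>
definition conic_eq :: "'k \<Rightarrow> 'k \<Rightarrow> 'k \<Rightarrow> bool" where
  "conic_eq x y w \<longleftrightarrow> (z1 - z2) * y * w + (z2 - z) * w * x + (z - z1) * x * y = 0"

text \<open>
  The plane spanned by \<open>p\<close> and its conjugates, and the conic in it.
\<close>
definition plane_p :: "('k ^ 7) set" where
  "plane_p = {comb 0 x y w 0 0 0 | x y w. True}"

definition conic_p :: "('k ^ 7) set set" where
  "conic_p = {vec.span {comb 0 x y w 0 0 0} | x y w. (x, y, w) \<noteq> (0, 0, 0) \<and> conic_eq x y w}"

lemma conic_p_iff:
  assumes "(x, y, w) \<noteq> (0, 0, 0)"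
  shows "vec.span {comb 0 x y w 0 0 0} \<in> conic_p \<longleftrightarrow> conic_eq x y w"
proof
  assume "vec.span {comb 0 x y w 0 0 0} \<in> conic_p"
  then obtain x' y' w' where w': "(x', y', w') \<noteq> (0, 0, 0)" "conic_eq x' y' w'"
    "vec.span {comb 0 x' y' w' 0 0 0} = vec.span {comb 0 x y w 0 0 0}"
    by (auto simp: conic_p_def)
  moreover have "comb 0 x' y' w' 0 0 0 \<noteq> 0" using w'(1) by (auto simp: comb_eq_0)
  ultimately obtain k where k: "k \<noteq> 0" "comb 0 x y w 0 0 0 = k *s comb 0 x' y' w' 0 0 0"
    using span_singleton_eq_iff by blast
  then have "x = k * x'" "y = k * y'" "w = k * w'" by (simp_all add: comb_scale comb_eq_iff)
  then have "(z1 - z2) * y * w + (z2 - z) * w * x + (z - z1) * x * y =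
      k * k * ((z1 - z2) * y' * w' + (z2 - z) * w' * x' + (z - z1) * x' * y')"
    by (simp add: algebra_simps)
  then show "conic_eq x y w" using w'(2) by (simp add: conic_eq_def)
qed (use assms in \<open>auto simp: conic_p_def\<close>)

lemma conic_p_eq: "conic_p = {vec.span {Cp s t} | s t. (s, t) \<noteq> (0, 0)}"
proof (intro equalityI subsetI)
  fix X assume "X \<in> {vec.span {Cp s t} | s t. (s, t) \<noteq> (0, 0)}"
  then obtain s t where st: "(s, t) \<noteq> (0, 0)" "X = vec.span {Cp s t}" by blast
  let ?D0 = "D0 s t" and ?D1 = "D1 s t" and ?D2 = "D2 s t"
  have "(z1 - z2) * ?D0 + (z2 - z) * ?D1 + (z - z1) * ?D2 = 0"
    by (simp add: D0_def D1_def D2_def algebra_simps)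
  moreover have "(z1 - z2) * (?D0 * ?D2) * (?D0 * ?D1) + (z2 - z) * (?D0 * ?D1) * (?D1 * ?D2)
      + (z - z1) * (?D1 * ?D2) * (?D0 * ?D2) =
      ?D0 * ?D1 * ?D2 * ((z1 - z2) * ?D0 + (z2 - z) * ?D1 + (z - z1) * ?D2)"
    by (simp add: algebra_simps)
  ultimately have "conic_eq (?D1 * ?D2) (?D0 * ?D2) (?D0 * ?D1)"
    unfolding conic_eq_def by simp
  moreover have "(?D1 * ?D2, ?D0 * ?D2, ?D0 * ?D1) \<noteq> (0, 0, 0)"
    using Cp_nz[OF st(1)] by (auto simp: Cp_def comb_eq_0)
  ultimately show "X \<in> conic_p" unfolding st(2) Cp_def using conic_p_iff by blast
next
  fix X assume "X \<in> conic_p"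
  then obtain x y w where xyw: "(x, y, w) \<noteq> (0, 0, 0)" "conic_eq x y w"
    "X = vec.span {comb 0 x y w 0 0 0}" by (auto simp: conic_p_def)
  have eq: "(z1 - z2) * (y * w) + (z2 - z) * (w * x) + (z - z1) * (x * y) = 0"
    using xyw(2) by (simp add: conic_eq_def mult.assoc)
  have vertex: "\<exists>s t. (s, t) \<noteq> (0, 0) \<and> X = vec.span {Cp s t}" if "X = P 1 \<or> X = P 2 \<or> X = P 3"
    using that span_Cp_vertex by (metis prod.inject zero_neq_one)
  have "\<exists>s t. (s, t) \<noteq> (0, 0) \<and> X = vec.span {Cp s t}"
  proof (cases "x * y * w = 0")
    case True
    then have "y * w = 0" "w * x = 0" "x * y = 0" using eq z_distinct by auto
    then consider "x = 0" "y = 0" "w \<noteq> 0" | "x = 0" "w = 0" "y \<noteq> 0" | "y = 0" "w = 0" "x \<noteq> 0"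
      using xyw(1) by auto
    then have "X = P 1 \<or> X = P 2 \<or> X = P 3"
      by cases (simp_all add: xyw(3) comb_def P span_scale_singleton del: One_nat_def)
    then show ?thesis by (rule vertex)
  next
    case False
    \<comment> \<open>Solve \<open>D0 s t = y w\<close> and \<open>D1 s t = w x\<close>; the equation of the conic then gives \<open>D2 s t = x y\<close>.\<close>
    define t where "t = (y * w - w * x) / (z1 - z)"
    define s where "s = y * w + z * t"
    have tz: "t * (z1 - z) = y * w - w * x" using z_distinct by (simp add: t_def)
    have d0: "D0 s t = y * w" by (simp add: D0_def s_def)
    have d1: "D1 s t = w * x" using tz by (simp add: D1_def s_def algebra_simps)
    have "(z - z1) * D2 s t = (z - z1) * (x * y)"
    proof -
      have "(z - z1) * D2 s t = - (z1 - z2) * D0 s t - (z2 - z) * D1 s t"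
        by (simp add: D0_def D1_def D2_def algebra_simps)
      also have "\<dots> = (z - z1) * (x * y)" using eq unfolding d0 d1 by (simp add: algebra_simps)
      finally show ?thesis .
    qed
    then have d2: "D2 s t = x * y" using z_distinct by simp
    have "Cp s t = (x * y * w) *s comb 0 x y w 0 0 0"
      by (simp add: Cp_def d0 d1 d2 comb_scale comb_eq_iff mult_ac)
    then have "X = vec.span {Cp s t}" using xyw(3) by (simp only: span_scale_singleton[OF False])
    moreover have "(s, t) \<noteq> (0, 0)" using d0 False by (auto simp: D0_def)
    ultimately show ?thesis by blast
  qed
  then show "X \<in> {vec.span {Cp s t} | s t. (s, t) \<noteq> (0, 0)}" by blast
qed

text \<open>
  The ruled surface whose generators join the points of the two curves with equal parameters.
\<close>
definition surface :: "('k ^ 7) set set" where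
  "surface = {X. pg_sub 0 X \<and> (\<exists>s t. (s, t) \<noteq> (0, 0) \<and> X \<subseteq> vec.span {Cp s t, Np s t})}"

lemma ruled_surface_eq:
  assumes "\<And>s t. (s, t) \<noteq> (0, 0) \<Longrightarrow> \<phi> (vec.span {Cp s t}) = vec.span {Np s t}"
  shows "ruled_surface conic_p \<phi> = surface"
proof -
  have "(\<exists>Y\<in>conic_p. X \<subseteq> vec.span (Y \<union> \<phi> Y)) \<longleftrightarrow>
      (\<exists>s t. (s, t) \<noteq> (0, 0) \<and> X \<subseteq> vec.span {Cp s t, Np s t})" for X
  proof
    assume "\<exists>Y\<in>conic_p. X \<subseteq> vec.span (Y \<union> \<phi> Y)"
    then obtain s t where st: "(s, t) \<noteq> (0, 0)"
      "X \<subseteq> vec.span (vec.span {Cp s t} \<union> \<phi> (vec.span {Cp s t}))"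
      unfolding conic_p_eq by blast
    then have "X \<subseteq> vec.span {Cp s t, Np s t}" using assms[OF st(1)] by (simp add: span_span_Un)
    then show "\<exists>s t. (s, t) \<noteq> (0, 0) \<and> X \<subseteq> vec.span {Cp s t, Np s t}" using st(1) by blast
  next
    assume "\<exists>s t. (s, t) \<noteq> (0, 0) \<and> X \<subseteq> vec.span {Cp s t, Np s t}"
    then obtain s t where st: "(s, t) \<noteq> (0, 0)" "X \<subseteq> vec.span {Cp s t, Np s t}" by blast
    then have "X \<subseteq> vec.span (vec.span {Cp s t} \<union> \<phi> (vec.span {Cp s t}))"
      using assms[OF st(1)] by (simp add: span_span_Un)
    then show "\<exists>Y\<in>conic_p. X \<subseteq> vec.span (Y \<union> \<phi> Y)" using st(1) unfolding conic_p_eq by blast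
  qed
  then show ?thesis by (simp add: ruled_surface_def surface_def)
qed

text \<open>
  Let \<open>cb\<close> be any quadratic parametrisation of the conic such that \<open>\<phi>\<close> takes the point with parameter
  \<open>(s, t)\<close> to the point of the cubic with the same parameter. The prescribed values of \<open>\<phi>\<close> put the
  three vertices at the parameters \<open>z\<close>, \<open>z1\<close>, \<open>z2\<close>, so each coordinate of \<open>cb\<close> vanishes at two of them
  and is a multiple of the corresponding coordinate of \<open>Cp\<close>. The three factors agree because the
  points at \<open>(1, 0)\<close> and \<open>(0, 1)\<close> satisfy the equation of the conic.
\<close>
lemma quadratic_parametrisation:
  fixes x y w :: "'k \<Rightarrow> 'k \<Rightarrow> 'k"
  defines "cb \<equiv> \<lambda>s t. comb 0 (x s t) (y s t) (w s t) 0 0 0"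
  assumes x: "\<And>s t. x s t = x0 * s^2 + x1 * (s * t) + x2 * t^2"
    and y: "\<And>s t. y s t = y0 * s^2 + y1 * (s * t) + y2 * t^2"
    and w: "\<And>s t. w s t = w0 * s^2 + w1 * (s * t) + w2 * t^2"
    and C: "\<And>s t. (s, t) \<noteq> (0, 0) \<Longrightarrow> vec.span {cb s t} \<in> conic_p"
    and onto: "\<And>X. X \<in> conic_p \<Longrightarrow> \<exists>s t. (s, t) \<noteq> (0, 0) \<and> X = vec.span {cb s t}"
    and \<phi>: "\<And>s t. (s, t) \<noteq> (0, 0) \<Longrightarrow> \<phi> (vec.span {cb s t}) = vec.span {Np s t}"
    and PQ: "\<forall>i\<in>{1,2,3}. \<phi> (P i) = Q i"
    and st: "(s, t) \<noteq> (0, 0)"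
  shows "vec.span {cb s t} = vec.span {Cp s t}"
proof -
  have cb_scale: "cb (c * s) (c * t) = c^2 *s cb s t" for c s t
    by (simp add: cb_def x y w comb_scale comb_eq_iff power2_eq_square algebra_simps)
  have vertex: "vec.span {cb u 1} = X" if u: "vec.span {Cp u 1} = X" "\<phi> X = vec.span {Np u 1}" for u X
  proof -
    have "X \<in> conic_p" unfolding conic_p_eq using u(1) by fastforce
    then obtain s t where st: "(s, t) \<noteq> (0, 0)" "X = vec.span {cb s t}" using onto by blast
    then have "vec.span {Np s t} = vec.span {Np u 1}" using \<phi>[OF st(1)] u(2) by simp
    then have "s = u * t" using Np_span_eq_iff[OF st(1), of u 1] by simp
    then have t: "t \<noteq> 0" "cb s t = t^2 *s cb u 1" using st(1) cb_scale[of t u 1] by (auto simp: mult.commute)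
    then show ?thesis using st(2) by (simp add: span_scale_singleton)
  qed
  have v0: "vec.span {cb z 1} = vec.span {p}"
    using vertex[OF span_Cp_vertex(1)] span_Np_vertex(1) PQ P by simp
  have v1: "vec.span {cb z1 1} = vec.span {frobv p}"
    using vertex[OF span_Cp_vertex(2)] span_Np_vertex(2) PQ P by simp
  have v2: "vec.span {cb z2 1} = vec.span {frobv (frobv p)}"
    using vertex[OF span_Cp_vertex(3)] span_Np_vertex(3) PQ P by simp
  have "cb z 1 \<in> vec.span {p}" "cb z1 1 \<in> vec.span {frobv p}" "cb z2 1 \<in> vec.span {frobv (frobv p)}"
    using v0 v1 v2 vec.span_base[of _ "{_}"] by (metis singletonI)+
  then obtain k0 k1 k2 where "cb z 1 = k0 *s p" "cb z1 1 = k1 *s frobv p" "cb z2 1 = k2 *s frobv (frobv p)"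
    by (auto simp: in_span_singleton)
  then have "cb z 1 = comb 0 k0 0 0 0 0 0" "cb z1 1 = comb 0 0 k1 0 0 0 0" "cb z2 1 = comb 0 0 0 k2 0 0 0"
    by (simp_all add: comb_def)
  then have zeros: "x z1 1 = 0" "x z2 1 = 0" "y z 1 = 0" "y z2 1 = 0" "w z 1 = 0" "w z1 1 = 0"
    by (simp_all add: cb_def comb_eq_iff)
  have "x0 * z1^2 + x1 * z1 + x2 = 0" "x0 * z2^2 + x1 * z2 + x2 = 0" "z1 \<noteq> z2"
    using zeros z_distinct by (simp_all add: x)
  note x12 = quadratic_two_roots[OF this]
  have xe: "x s t = x0 * (D1 s t * D2 s t)" for s t
    unfolding x x12 D1_def D2_def by (simp add: power2_eq_square algebra_simps)
  have "y0 * z^2 + y1 * z + y2 = 0" "y0 * z2^2 + y1 * z2 + y2 = 0" "z \<noteq> z2"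
    using zeros z_distinct by (simp_all add: y)
  note y12 = quadratic_two_roots[OF this]
  have ye: "y s t = y0 * (D0 s t * D2 s t)" for s t
    unfolding y y12 D0_def D2_def by (simp add: power2_eq_square algebra_simps)
  have "w0 * z^2 + w1 * z + w2 = 0" "w0 * z1^2 + w1 * z1 + w2 = 0" "z \<noteq> z1"
    using zeros z_distinct by (simp_all add: w)
  note w12 = quadratic_two_roots[OF this]
  have we: "w s t = w0 * (D0 s t * D1 s t)" for s t
    unfolding w w12 D0_def D1_def by (simp add: power2_eq_square algebra_simps)
  have nz: "(x s t, y s t, w s t) \<noteq> (0, 0, 0)" if st': "(s, t) \<noteq> (0, 0)" for s t
  proof
    assume "(x s t, y s t, w s t) = (0, 0, 0)"
    then have "cb s t = 0" by (simp add: cb_def comb_0)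
    then have "vec.span {cb s t} = {0}" by simp
    moreover obtain s' t' where "(s', t') \<noteq> (0, 0)" "vec.span {cb s t} = vec.span {Cp s' t'}"
      using C[OF st'] unfolding conic_p_eq by blast
    ultimately show False using Cp_nz vec.span_base[of "Cp s' t'" "{Cp s' t'}"] by simp
  qed
  have "x0 \<noteq> 0" "y0 \<noteq> 0" "w0 \<noteq> 0"
    using nz[of z 1] nz[of z1 1] nz[of z2 1] zeros xe[of z 1] ye[of z1 1] we[of z2 1] by auto
  have "conic_eq (x s t) (y s t) (w s t)" if "(s, t) \<noteq> (0, 0)" for s t
    using C[OF that] conic_p_iff[OF nz[OF that]] by (simp add: cb_def)
  from this[of 1 0] this[of 0 1] have
    "conic_eq x0 y0 w0" "conic_eq (x0 * (z1 * z2)) (y0 * (z * z2)) (w0 * (z * z1))"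
    by (simp_all add: xe ye we D0_def D1_def D2_def)
  then have e1: "(z1 - z2) * (y0 * w0) + (z2 - z) * (w0 * x0) + (z - z1) * (x0 * y0) = 0"
    and "z * z1 * z2 * ((z1 - z2) * z * (y0 * w0) + (z2 - z) * z1 * (w0 * x0) + (z - z1) * z2 * (x0 * y0)) = 0"
    by (simp_all add: conic_eq_def algebra_simps)
  then have e2: "(z1 - z2) * z * (y0 * w0) + (z2 - z) * z1 * (w0 * x0) + (z - z1) * z2 * (x0 * y0) = 0"
    using z_distinct by simp
  have "(z1 - z2) * (z2 - z) * (y0 * w0 - w0 * x0) =
      z2 * ((z1 - z2) * (y0 * w0) + (z2 - z) * (w0 * x0) + (z - z1) * (x0 * y0)) -
      ((z1 - z2) * z * (y0 * w0) + (z2 - z) * z1 * (w0 * x0) + (z - z1) * z2 * (x0 * y0))"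
    by (simp add: algebra_simps)
  then have "y0 * w0 = w0 * x0" unfolding e1 e2 using z_distinct by simp
  then have xy: "y0 = x0" using \<open>w0 \<noteq> 0\<close> by simp
  have id: "(z - z1) * (x0 * y0 - y0 * w0) =
      (z1 - z2) * (y0 * w0) + (z2 - z) * (w0 * x0) + (z - z1) * (x0 * y0) + (z2 - z) * (y0 * w0 - w0 * x0)"
    by (simp add: algebra_simps)
  have "(z2 - z) * (y0 * w0 - w0 * x0) = 0" using \<open>y0 * w0 = w0 * x0\<close> by simp
  then have "(z - z1) * (x0 * y0 - y0 * w0) = 0" by (simp only: id e1 add_0_left)
  then have xw: "w0 = x0" using \<open>y0 \<noteq> 0\<close> z_distinct xy by simp
  have "cb s t = x0 *s Cp s t"
    by (simp add: cb_def Cp_def comb_scale comb_eq_iff xe ye we xy xw)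
  then show ?thesis using \<open>x0 \<noteq> 0\<close> by (simp add: span_scale_singleton)
qed

lemma m_curve: "curve 3 m = {vec.span {Np s t} | s t. (s, t) \<noteq> (0, 0)}"
  by (simp add: curve_def curve_point_m)

text \<open>
  A projectivity with matrix \<open>(a1, b1; c1, d1)\<close> is reduced to the identity on parameters by
  composing the parametrisation of the conic with the adjugate matrix.
\<close>
lemma conic_cubic_surface_unique:
  assumes "conic_cubic_surface plane_p conic_p m P Q B"
  shows "B = surface"
proof -
  obtain b \<phi> where nrc: "normal_rational_curve_in 2 plane_p b" and crv: "curve 2 b = conic_p"
    and proj: "projectivity 2 b 3 m \<phi>" and PQ: "\<forall>i\<in>{1,2,3}. \<phi> (P i) = Q i"
    and B: "B = ruled_surface conic_p \<phi>"
    using assms unfolding conic_cubic_surface_def by blast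
  obtain a1 b1 c1 d1 where det: "a1 * d1 - b1 * c1 \<noteq> 0"
    and \<phi>: "\<And>s t. (s, t) \<noteq> (0, 0) \<Longrightarrow>
        \<phi> (curve_point 2 b s t) = curve_point 3 m (a1 * s + b1 * t) (c1 * s + d1 * t)"
    using proj unfolding projectivity_def by blast
  have "b j \<in> plane_p" if "j \<le> 2" for j
  proof -
    have "b j \<in> vec.span (b ` {..2})" using that by (intro vec.span_base) simp
    then show ?thesis using nrc by (simp add: normal_rational_curve_in_def)
  qed
  then have "\<exists>x y w. b j = comb 0 x y w 0 0 0" if "j \<le> 2" for j
    using that unfolding plane_p_def by blast
  from this[of 0] this[of 1] this[of 2] obtain x0 y0 w0 x1 y1 w1 x2 y2 w2 where
    b: "b 0 = comb 0 x0 y0 w0 0 0 0" "b 1 = comb 0 x1 y1 w1 0 0 0" "b 2 = comb 0 x2 y2 w2 0 0 0"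
    by auto
  have sum2: "(\<Sum>j\<le>2. (s ^ (2 - j) * t ^ j) *s b j) = s^2 *s b 0 + (s * t) *s b 1 + t^2 *s b 2" for s t
    by (simp add: numeral_2_eq_2)
  define cf :: "'k \<Rightarrow> 'k \<Rightarrow> 'k \<Rightarrow> 'k \<Rightarrow> 'k \<Rightarrow> 'k" where
    "cf u0 u1 u2 s t = u0 * (d1 * s - b1 * t)^2 + u1 * ((d1 * s - b1 * t) * (a1 * t - c1 * s))
       + u2 * (a1 * t - c1 * s)^2" for u0 u1 u2 s t
  define cb where "cb s t = comb 0 (cf x0 x1 x2 s t) (cf y0 y1 y2 s t) (cf w0 w1 w2 s t) 0 0 0" for s t
  have cb: "curve_point 2 b (d1 * s - b1 * t) (a1 * t - c1 * s) = vec.span {cb s t}" for s t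
    unfolding curve_point_def sum2 b cb_def cf_def
    by (simp add: comb_scale comb_add mult_ac)
  have nz: "(d1 * s - b1 * t, a1 * t - c1 * s) \<noteq> (0, 0)" if "(s, t) \<noteq> (0, 0)" for s t
  proof
    assume 0: "(d1 * s - b1 * t, a1 * t - c1 * s) = (0, 0)"
    have "(a1 * d1 - b1 * c1) * s = a1 * (d1 * s - b1 * t) + b1 * (a1 * t - c1 * s)"
      "(a1 * d1 - b1 * c1) * t = c1 * (d1 * s - b1 * t) + d1 * (a1 * t - c1 * s)"
      by (simp_all add: algebra_simps)
    then show False using 0 det that by simp
  qed
  have cf: "\<exists>v0 v1 v2. \<forall>s t. cf u0 u1 u2 s t = v0 * s^2 + v1 * (s * t) + v2 * t^2" for u0 u1 u2
  proof (intro exI allI)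
    show "cf u0 u1 u2 s t = (u0 * d1^2 - u1 * d1 * c1 + u2 * c1^2) * s^2 +
        (u1 * (a1 * d1 + b1 * c1) - 2 * u0 * b1 * d1 - 2 * u2 * a1 * c1) * (s * t) +
        (u0 * b1^2 - u1 * a1 * b1 + u2 * a1^2) * t^2" for s t
      by (simp add: cf_def power2_eq_square algebra_simps)
  qed
  obtain v0 v1 v2 where v: "\<And>s t. cf x0 x1 x2 s t = v0 * s^2 + v1 * (s * t) + v2 * t^2" using cf by blast
  obtain v0' v1' v2' where v': "\<And>s t. cf y0 y1 y2 s t = v0' * s^2 + v1' * (s * t) + v2' * t^2" using cf by blast
  obtain v0'' v1'' v2'' where v'': "\<And>s t. cf w0 w1 w2 s t = v0'' * s^2 + v1'' * (s * t) + v2'' * t^2"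
    using cf by blast
  have C: "vec.span {cb s t} \<in> conic_p" if "(s, t) \<noteq> (0, 0)" for s t
    using nz[OF that] unfolding crv[symmetric] curve_def cb[symmetric] by blast
  have onto: "\<exists>s t. (s, t) \<noteq> (0, 0) \<and> X = vec.span {cb s t}" if X: "X \<in> conic_p" for X
  proof -
    obtain s' t' where st': "(s', t') \<noteq> (0, 0)" "X = curve_point 2 b s' t'"
      using X unfolding crv[symmetric] curve_def by blast
    let ?k = "inverse (a1 * d1 - b1 * c1)"
    let ?s = "?k * (a1 * s' + b1 * t')" and ?t = "?k * (c1 * s' + d1 * t')"
    have "d1 * ?s - b1 * ?t = ?k * (a1 * d1 - b1 * c1) * s'" "a1 * ?t - c1 * ?s = ?k * (a1 * d1 - b1 * c1) * t'"
      by (simp_all add: algebra_simps)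
    then have s't': "d1 * ?s - b1 * ?t = s'" "a1 * ?t - c1 * ?s = t'" using det by simp_all
    then have "X = vec.span {cb ?s ?t}" using st'(2) cb[of ?s ?t] by simp
    moreover have "(?s, ?t) \<noteq> (0, 0)" using s't' st'(1) by (metis diff_zero mult_zero_right prod.inject)
    ultimately show ?thesis by blast
  qed
  have \<phi>cb: "\<phi> (vec.span {cb s t}) = vec.span {Np s t}" if "(s, t) \<noteq> (0, 0)" for s t
  proof -
    have "\<phi> (vec.span {cb s t}) = vec.span {Np (a1 * (d1 * s - b1 * t) + b1 * (a1 * t - c1 * s))
        (c1 * (d1 * s - b1 * t) + d1 * (a1 * t - c1 * s))}"
      using \<phi>[OF nz[OF that]] unfolding cb curve_point_m .
    also have "a1 * (d1 * s - b1 * t) + b1 * (a1 * t - c1 * s) = (a1 * d1 - b1 * c1) * s"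
      by (simp add: algebra_simps)
    also have "c1 * (d1 * s - b1 * t) + d1 * (a1 * t - c1 * s) = (a1 * d1 - b1 * c1) * t"
      by (simp add: algebra_simps)
    finally show ?thesis using det by (simp only: Np_scale span_scale_singleton power_eq_0_iff simp_thms)
  qed
  have "vec.span {cb s t} = vec.span {Cp s t}" if "(s, t) \<noteq> (0, 0)" for s t
    unfolding cb_def
    by (rule quadratic_parametrisation[OF v v' v'' _ _ _ PQ that])
       (erule C[unfolded cb_def] onto[unfolded cb_def] \<phi>cb[unfolded cb_def])+
  then have "\<phi> (vec.span {Cp s t}) = vec.span {Np s t}" if "(s, t) \<noteq> (0, 0)" for s t
    using \<phi>cb[OF that] that by metis
  then show ?thesis unfolding B by (rule ruled_surface_eq)
qed

lemma conic_cubic_surface_exists: "conic_cubic_surface plane_p conic_p m P Q surface"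
proof -
  define b where "b = (\<lambda>j :: nat. if j = 0 then comb 0 1 1 1 0 0 0
    else if j = 1 then comb 0 (- (z1 + z2)) (- (z + z2)) (- (z + z1)) 0 0 0
    else comb 0 (z1 * z2) (z * z2) (z * z1) 0 0 0 :: 'k ^ 7)"
  have b012: "b 0 = comb 0 1 1 1 0 0 0" "b 1 = comb 0 (- (z1 + z2)) (- (z + z2)) (- (z + z1)) 0 0 0"
    "b 2 = comb 0 (z1 * z2) (z * z2) (z * z1) 0 0 0" by (simp_all add: b_def)
  have sum2: "(\<Sum>j\<le>2. (s ^ (2 - j) * t ^ j) *s b j) = s^2 *s b 0 + (s * t) *s b 1 + t^2 *s b 2" for s t
    by (simp add: numeral_2_eq_2)
  have sumCp: "(\<Sum>j\<le>2. (s ^ (2 - j) * t ^ j) *s b j) = Cp s t" for s t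
    unfolding sum2 b012 Cp_def comb_scale comb_add comb_eq_iff D0_def D1_def D2_def
    by (simp add: power2_eq_square algebra_simps)
  have cpb: "curve_point 2 b s t = vec.span {Cp s t}" for s t
    by (simp add: curve_point_def sumCp)
  have crv: "curve 2 b = conic_p" unfolding curve_def conic_p_eq cpb ..
  have sub: "vec.subspace plane_p"
  proof (rule vec.subspaceI)
    show "0 \<in> plane_p" unfolding plane_p_def using comb_0 by (metis (mono_tags, lifting) mem_Collect_eq)
    show "u + v \<in> plane_p" if uv: "u \<in> plane_p" "v \<in> plane_p" for u v
    proof -
      obtain x y w x' y' w' where "u = comb 0 x y w 0 0 0" "v = comb 0 x' y' w' 0 0 0"
        using uv unfolding plane_p_def by blast
      then have "u + v = comb 0 (x + x') (y + y') (w + w') 0 0 0" by (simp add: comb_add)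
      then show ?thesis unfolding plane_p_def by blast
    qed
    show "c *s u \<in> plane_p" if u: "u \<in> plane_p" for c u
    proof -
      obtain x y w where "u = comb 0 x y w 0 0 0" using u unfolding plane_p_def by blast
      then have "c *s u = comb 0 (c * x) (c * y) (c * w) 0 0 0" by (simp add: comb_scale)
      then show ?thesis unfolding plane_p_def by blast
    qed
  qed
  have "plane_p = range (\<lambda>v :: 'k ^ 3. comb 0 (v$1) (v$2) (v$3) 0 0 0)"
  proof (intro equalityI subsetI)
    fix u assume "u \<in> plane_p"
    then obtain x y w where u: "u = comb 0 x y w 0 0 0" unfolding plane_p_def by blast
    then have "u = (\<lambda>v :: 'k ^ 3. comb 0 (v$1) (v$2) (v$3) 0 0 0) (vector [x, y, w])" by simp
    then show "u \<in> range (\<lambda>v :: 'k ^ 3. comb 0 (v$1) (v$2) (v$3) 0 0 0)" by (rule range_eqI)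
  qed (auto simp: plane_p_def)
  moreover have "inj (\<lambda>v :: 'k ^ 3. comb 0 (v$1) (v$2) (v$3) 0 0 0)"
    by (rule injI) (simp add: comb_eq_iff vec3_eq_iff)
  ultimately have "card plane_p = CARD('k) ^ (2 + 1)" by (simp add: card_image)
  then have pgE: "pg_sub 2 plane_p" using sub by (simp only: pg_sub_card_iff)
  have "vec.span (b ` {..2}) = plane_p"
  proof (rule vec.span_subspace)
    show "b ` {..2} \<subseteq> plane_p" by (auto simp: b_def plane_p_def)
    show "plane_p \<subseteq> vec.span (b ` {..2})"
    proof
      fix u assume "u \<in> plane_p"
      then obtain x y w where u: "u = comb 0 x y w 0 0 0" unfolding plane_p_def by blast
      have "u = (x / ((z - z1) * (z - z2))) *s Cp z 1 + (y / ((z1 - z) * (z1 - z2))) *s Cp z1 1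
          + (w / ((z2 - z) * (z2 - z1))) *s Cp z2 1"
        using z_distinct by (simp add: u Cp_def comb_scale comb_add comb_eq_iff D0_def D1_def D2_def)
      moreover have "Cp s t \<in> vec.span (b ` {..2})" for s t
        unfolding sumCp[symmetric] by (intro vec.span_sum vec.span_scale vec.span_base) simp
      ultimately show "u \<in> vec.span (b ` {..2})" by (simp only: vec.span_add vec.span_scale)
    qed
  qed (fact sub)
  then have nrc: "normal_rational_curve_in 2 plane_p b" using pgE by (simp add: normal_rational_curve_in_def)
  define \<phi> where "\<phi> Y = (THE Z. \<exists>s t. (s, t) \<noteq> (0, 0) \<and> Y = vec.span {Cp s t} \<and> Z = vec.span {Np s t})" for Y
  have \<phi>: "\<phi> (vec.span {Cp s t}) = vec.span {Np s t}" if st: "(s, t) \<noteq> (0, 0)" for s t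
    unfolding \<phi>_def
  proof (rule the_equality)
    show "\<exists>s' t'. (s', t') \<noteq> (0, 0) \<and> vec.span {Cp s t} = vec.span {Cp s' t'} \<and> vec.span {Np s t} = vec.span {Np s' t'}"
      using st by blast
    fix Z assume "\<exists>s' t'. (s', t') \<noteq> (0, 0) \<and> vec.span {Cp s t} = vec.span {Cp s' t'} \<and> Z = vec.span {Np s' t'}"
    then obtain s' t' where s't': "(s', t') \<noteq> (0, 0)" "vec.span {Cp s t} = vec.span {Cp s' t'}" "Z = vec.span {Np s' t'}"
      by blast
    then have "vec.span {Np s t} = vec.span {Np s' t'}"
      using Cp_span_eq_iff[OF st s't'(1)] Np_span_eq_iff[OF st s't'(1)] by simp
    then show "Z = vec.span {Np s t}" using s't' by simp
  qed
  have bij: "bij_betw \<phi> (curve 2 b) (curve 3 m)"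
    unfolding bij_betw_def
  proof
    show "inj_on \<phi> (curve 2 b)"
    proof (rule inj_onI)
      fix X Y assume "X \<in> curve 2 b" "Y \<in> curve 2 b" and eq: "\<phi> X = \<phi> Y"
      then obtain s t s' t' where st: "(s, t) \<noteq> (0, 0)" "X = vec.span {Cp s t}"
        "(s', t') \<noteq> (0, 0)" "Y = vec.span {Cp s' t'}"
        unfolding crv conic_p_eq by blast
      then have "vec.span {Np s t} = vec.span {Np s' t'}" using eq \<phi>[OF st(1)] \<phi>[OF st(3)] by simp
      then show "X = Y"
        using Cp_span_eq_iff[OF st(1,3)] Np_span_eq_iff[OF st(1,3)] st(2,4) by simp
    qed
    show "\<phi> ` curve 2 b = curve 3 m"
    proof (intro equalityI subsetI)
      fix Z assume "Z \<in> \<phi> ` curve 2 b"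
      then obtain s t where "(s, t) \<noteq> (0, 0)" "Z = \<phi> (vec.span {Cp s t})"
        unfolding crv conic_p_eq by blast
      then show "Z \<in> curve 3 m" using \<phi>[of s t] unfolding m_curve by auto
    next
      fix Z assume "Z \<in> curve 3 m"
      then obtain s t where st: "(s, t) \<noteq> (0, 0)" "Z = vec.span {Np s t}" unfolding m_curve by blast
      then have "Z = \<phi> (vec.span {Cp s t})" using \<phi>[OF st(1)] by simp
      moreover have "vec.span {Cp s t} \<in> curve 2 b" unfolding crv conic_p_eq using st(1) by blast
      ultimately show "Z \<in> \<phi> ` curve 2 b" by (rule image_eqI)
    qed
  qed
  have "projectivity 2 b 3 m \<phi>"
    unfolding projectivity_def cpb curve_point_m
  proof (intro conjI bij exI allI impI)
    show "(1 :: 'k) * 1 - 0 * 0 \<noteq> 0" by simp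
    show "\<phi> (vec.span {Cp s t}) = vec.span {Np (1 * s + 0 * t) (0 * s + 1 * t)}"
      if "(s, t) \<noteq> (0, 0)" for s t using \<phi>[OF that] by simp
  qed
  moreover have "\<forall>i\<in>{1,2,3}. \<phi> (P i) = Q i"
    using \<phi>[of z 1] \<phi>[of z1 1] \<phi>[of z2 1] by (simp add: span_Cp_vertex span_Np_vertex del: One_nat_def)
  moreover have "surface = ruled_surface conic_p \<phi>" using ruled_surface_eq[OF \<phi>] by simp
  ultimately show ?thesis unfolding conic_cubic_surface_def using nrc crv by blast
qed

text \<open>
  The matrix of the subplane, taking \<open>(s, t, \<rho>)\<close> to \<open>(s - z t, t, \<rho>)\<close>.
\<close>
definition subplane_matrix :: "'k ^ 3 ^ 3" where
  "subplane_matrix = vector [vector [1, - z, 0], vector [0, 1, 0], vector [0, 0, 1]]"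

lemma subplane_matrix_mult: "subplane_matrix *v v = vector [v$1 - z * v$2, v$2, v$3]"
  by (simp add: subplane_matrix_def vec3_eq_iff matrix_vector_mult_def sum_3)

lemma invertible_subplane_matrix: "invertible subplane_matrix"
  by (simp add: invertible_det_nz det_3 subplane_matrix_def)

text \<open>
  A rational affine point on the generator with parameter \<open>(s, t)\<close> over \<open>GF(q^3)\<close> lies in the subplane.
  Comparing its \<open>r\<close>-coordinate \<open>t / D0\<close> with the conjugate coordinate \<open>t / D1\<close> shows that \<open>s / t\<close> is fixed
  by the Frobenius map.
\<close>
lemma rational_generator_point:
  assumes "w$1 = 1" "(s, t) \<noteq> (0, 0)" "ratK w = a *s Cp s t + b *s Np s t"
  shows "\<exists>x :: 'f ^ 3. x \<noteq> 0 \<and> vec.span {w} = vec.span {subplane_matrix *v emb_vec emb x}"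
proof -
  let ?D0 = "D0 s t" and ?D1 = "D1 s t" and ?D2 = "D2 s t"
  have e: "1 = b * (?D0 * ?D1 * ?D2)" "w$3 = a * (?D1 * ?D2)" "frob (w$3) = a * (?D0 * ?D2)"
    "w$2 = b * (t * ?D1 * ?D2)" "frob (w$2) = b * (t * ?D0 * ?D2)"
    using assms(3)[unfolded ratK_def Cp_def Np_def comb_scale comb_add comb_eq_iff assms(1)
        mult_zero_right add_0_left add_0_right] by blast+
  have nz: "?D0 \<noteq> 0" "?D1 \<noteq> 0" "?D2 \<noteq> 0" using e(1) by auto
  define a' where "a' = a * (?D0 * ?D1 * ?D2)"
  have "w$2 * ?D0 = t * (b * (?D0 * ?D1 * ?D2))" "frob (w$2) * ?D1 = t * (b * (?D0 * ?D1 * ?D2))"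
    unfolding e(5) by (simp_all add: e(4) mult_ac)
  then have w2: "w$2 * ?D0 = t" "frob (w$2) * ?D1 = t" by (simp_all flip: e(1))
  have w3: "w$3 * ?D0 = a'" "frob (w$3) * ?D1 = a'"
    unfolding e(3) a'_def by (simp_all add: e(2) mult_ac)
  show ?thesis
  proof (cases "t = 0")
    case True
    then have s: "?D0 = s" "?D1 = s" "s \<noteq> 0" using assms(2) by (auto simp: D0_def D1_def)
    then have "frob (w$3) = w$3" using w3 by (metis mult_right_cancel)
    then obtain c where c: "w$3 = emb c" using frob_fixed_iff by blast
    have "w$2 = 0" using w2(1) True nz by simp
    then have "w = subplane_matrix *v emb_vec emb (vector [1, 0, c])"
      using c assms(1) by (simp add: subplane_matrix_mult vec3_eq_iff)
    moreover have "vector [1, 0, c] \<noteq> (0 :: 'f ^ 3)" by (simp add: vec3_eq_iff)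
    ultimately show ?thesis by metis
  next
    case False
    define k where "k = s / t"
    have d: "?D0 = t * (k - z)" "?D1 = t * (k - z1)" using False by (simp_all add: D0_def D1_def k_def field_simps)
    have w2k: "w$2 * (k - z) = 1" "frob (w$2) * (k - z1) = 1"
      using w2 False unfolding d by (simp_all add: mult.left_commute)
    have "frob (w$2) * (frob k - z1) = 1" using arg_cong[OF w2k(1), of frob] by simp
    then have "frob (w$2) * (frob k - z1) = frob (w$2) * (k - z1)" "frob (w$2) \<noteq> 0"
      using w2k(2) by auto
    then have k: "frob k = k" by simp
    then obtain k' where k': "k = emb k'" using frob_fixed_iff by blast
    define \<rho> where "\<rho> = a' / t"
    have w3k: "w$3 * (k - z) = \<rho>" "frob (w$3) * (k - z1) = \<rho>"
      using w3 False unfolding d \<rho>_def by (simp_all add: field_simps)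
    have "frob \<rho> = \<rho>" using arg_cong[OF w3k(1), of frob] w3k(2) k by simp
    then obtain c where c: "\<rho> = emb c" using frob_fixed_iff by blast
    have "(k - z) *s w = subplane_matrix *v emb_vec emb (vector [k', 1, c])"
      using w2k(1) w3k(1) assms(1) k' c by (simp add: subplane_matrix_mult vec3_eq_iff algebra_simps)
    moreover have "k - z \<noteq> 0" using w2k by auto
    ultimately have "vec.span {w} = vec.span {subplane_matrix *v emb_vec emb (vector [k', 1, c])}"
      by (metis span_scale_singleton)
    moreover have "vector [k', 1, c] \<noteq> (0 :: 'f ^ 3)" by (simp add: vec3_eq_iff)
    ultimately show ?thesis by blast
  qed
qed

lemma subplane_point_on_generator:
  fixes x :: "'f ^ 3"
  assumes "vec.span {w} = vec.span {subplane_matrix *v emb_vec emb x}" "w$1 = 1"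
  shows "\<exists>s t a b. (s, t) \<noteq> (0, 0) \<and> ratK w = a *s Cp s t + b *s Np s t"
proof -
  define s where "s = emb (x$1)"
  define t where "t = emb (x$2)"
  define \<rho> where "\<rho> = emb (x$3)"
  have fr: "frob s = s" "frob t = t" "frob \<rho> = \<rho>" by (simp_all add: s_def t_def \<rho>_def)
  have "w \<in> vec.span {subplane_matrix *v emb_vec emb x}"
    using assms(1) vec.span_base[of w "{w}"] by simp
  then obtain c where "w = c *s (subplane_matrix *v emb_vec emb x)" by (auto simp: in_span_singleton)
  then have w: "1 = c * D0 s t" "w$2 = c * t" "w$3 = c * \<rho>"
    using assms(2) by (simp_all add: subplane_matrix_mult D0_def s_def t_def \<rho>_def)
  let ?D0 = "D0 s t" and ?D1 = "D1 s t" and ?D2 = "D2 s t"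
  have fD: "frob ?D0 = ?D1" "frob ?D1 = ?D2" by (simp_all add: D0_def D1_def D2_def fr)
  have c1: "1 = frob c * ?D1" using arg_cong[OF w(1), of frob] by (simp add: fD)
  have c2: "1 = frob (frob c) * ?D2" using arg_cong[OF c1, of frob] by (simp add: fD)
  have nz: "?D0 \<noteq> 0" "?D1 \<noteq> 0" "?D2 \<noteq> 0" using w(1) c1 c2 by auto
  then have c: "c = 1 / ?D0" "frob c = 1 / ?D1" "frob (frob c) = 1 / ?D2"
    using w(1) c1 c2 by (simp_all add: field_simps)
  let ?b = "1 / (?D0 * ?D1 * ?D2)"
  have "ratK w = (\<rho> * ?b) *s Cp s t + ?b *s Np s t"
    unfolding ratK_def Cp_def Np_def comb_scale comb_add comb_eq_iff w(2,3) assms(2)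
    using nz by (simp add: c fr fD)
  moreover have "(s, t) \<noteq> (0, 0)" using nz(1) by (auto simp: D0_def)
  ultimately show ?thesis by blast
qed

lemma affine_rational_surface:
  assumes "\<Phi> v $ 1 = 1"
  shows "vec.span {v} \<in> rational_points emb surface \<longleftrightarrow>
    (\<exists>x :: 'f ^ 3. x \<noteq> 0 \<and> vec.span {\<Phi> v} = vec.span {subplane_matrix *v emb_vec emb x})"
proof -
  have v: "v \<noteq> 0" using assms by auto
  have "vec.span {v} \<in> rational_points emb surface \<longleftrightarrow>
      (\<exists>s t. (s, t) \<noteq> (0, 0) \<and> ratK (\<Phi> v) \<in> vec.span {Cp s t, Np s t})"
  proof -
    have "vec.span {u} \<subseteq> W \<longleftrightarrow> u \<in> W" if "vec.subspace W" for u :: "'k ^ 7" and W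
      using that vec.span_base[of u "{u}"] vec.span_minimal[of "{u}" W] by blast
    then show ?thesis using v
      by (simp add: rational_points_def surface_def pg_ext_point ratK_\<Phi>)
  qed
  also have "\<dots> \<longleftrightarrow> (\<exists>s t a b. (s, t) \<noteq> (0, 0) \<and> ratK (\<Phi> v) = a *s Cp s t + b *s Np s t)"
    unfolding in_span_pair by blast
  also have "\<dots> \<longleftrightarrow> (\<exists>x :: 'f ^ 3. x \<noteq> 0 \<and> vec.span {\<Phi> v} = vec.span {subplane_matrix *v emb_vec emb x})"
    using rational_generator_point[OF assms] subplane_point_on_generator[OF _ assms] by meson
  finally show ?thesis .
qed

lemma rational_surface_subplane:
  "(rational_points emb surface \<inter> affine_points H) \<union> {\<Psi> (vec.span {vector [0, 0, 1]})} =
     \<Psi> ` {vec.span {subplane_matrix *v emb_vec emb x} | x :: 'f ^ 3. x \<noteq> 0}"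
proof (intro equalityI subsetI)
  fix X assume "X \<in> (rational_points emb surface \<inter> affine_points H) \<union> {\<Psi> (vec.span {vector [0, 0, 1]})}"
  then consider "X = \<Psi> (vec.span {vector [0, 0, 1]})"
    | "X \<in> rational_points emb surface" "X \<in> affine_points H" by blast
  then show "X \<in> \<Psi> ` {vec.span {subplane_matrix *v emb_vec emb x} | x :: 'f ^ 3. x \<noteq> 0}"
  proof cases
    case 1
    have "subplane_matrix *v emb_vec emb (vector [0, 0, 1] :: 'f ^ 3) = vector [0, 0, 1]"
      by (simp add: subplane_matrix_mult vec3_eq_iff)
    then have "vec.span {vector [0, 0, 1]} = vec.span {subplane_matrix *v emb_vec emb (vector [0, 0, 1] :: 'f ^ 3)}"
      by simp
    moreover have "vector [0, 0, 1] \<noteq> (0 :: 'f ^ 3)" by (simp add: vec3_eq_iff)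
    ultimately show ?thesis unfolding 1 by blast
  next
    case 2
    then obtain Y where Y: "pg_sub 0 Y" "\<not> Y \<subseteq> {w. w$1 = 0}" "X = \<Psi> Y" unfolding affine_points_iff by blast
    obtain v where v: "Y = vec.span {\<Phi> v}" "\<Phi> v $ 1 = 1" by (rule affine_rep[OF Y(1,2)])
    then have "X = vec.span {v}" using Y by (simp add: \<Psi>_affine)
    then obtain x :: "'f ^ 3" where "x \<noteq> 0" "Y = vec.span {subplane_matrix *v emb_vec emb x}"
      using 2(1) affine_rational_surface[OF v(2)] v(1) by auto
    then show ?thesis unfolding Y(3) by blast
  qed
next
  fix X assume "X \<in> \<Psi> ` {vec.span {subplane_matrix *v emb_vec emb x} | x :: 'f ^ 3. x \<noteq> 0}"
  then obtain x :: "'f ^ 3" where x: "x \<noteq> 0" "X = \<Psi> (vec.span {subplane_matrix *v emb_vec emb x})" by blast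
  let ?w = "subplane_matrix *v emb_vec emb x"
  show "X \<in> (rational_points emb surface \<inter> affine_points H) \<union> {\<Psi> (vec.span {vector [0, 0, 1]})}"
  proof (cases "?w $ 1 = 0")
    case True
    then have e: "emb (x$1) = z * emb (x$2)" by (simp add: subplane_matrix_mult)
    have x2: "x$2 = 0"
    proof (rule ccontr)
      assume "x$2 \<noteq> 0"
      then have "z = emb (x$1 / x$2)" using e by (simp add: field_simps)
      then show False using z by (metis frob_emb)
    qed
    then have x1: "x$1 = 0" using e by simp
    then have "?w = emb (x$3) *s vector [0, 0, 1]" using x2 by (simp add: subplane_matrix_mult vec3_eq_iff)
    moreover have "emb (x$3) \<noteq> 0" using x(1) x1 x2 by (auto simp: vec3_eq_iff)
    ultimately have "vec.span {?w} = vec.span {vector [0, 0, 1]}" by (metis span_scale_singleton)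
    then show ?thesis using x(2) by simp
  next
    case False
    then have "?w \<noteq> 0" by auto
    then have Y: "pg_sub 0 (vec.span {?w})" by simp
    have nY: "\<not> vec.span {?w} \<subseteq> {w. w$1 = 0}" using False vec.span_base[of ?w "{?w}"] by blast
    obtain v where v: "vec.span {?w} = vec.span {\<Phi> v}" "\<Phi> v $ 1 = 1" by (rule affine_rep[OF Y nY])
    then have X: "X = vec.span {v}" using x(2) by (simp add: \<Psi>_affine)
    have "X \<in> rational_points emb surface"
      unfolding X affine_rational_surface[OF v(2)] using x(1) v(1) by metis
    moreover have "X \<in> affine_points H" unfolding affine_points_iff using x(2) Y nY by blast
    ultimately show ?thesis by blast
  qed
qed

theorem surface_tangent_subplane:
  assumes "bb_identification H S \<iota>"
  shows "corresponds_to_tangent_subplane emb H S \<iota> (\<Psi> (vec.span {vector [0, 0, 1]}))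
    (rational_points emb surface)"
proof -
  let ?T = "\<Psi> (vec.span {vector [0, 0, 1]})"
  let ?D = "(rational_points emb surface \<inter> affine_points H) \<union> {?T}"
  let ?\<Delta> = "{vec.span {subplane_matrix *v emb_vec emb x} | x :: 'f ^ 3. x \<noteq> 0}"
  have "order_q_subplane emb ?\<Delta>"
    unfolding order_q_subplane_iff using invertible_subplane_matrix by blast
  then have "order_q_subplane emb ((\<iota> \<circ> \<Psi>) ` ?\<Delta>)"
    by (rule collineation_order_q_subplane[OF collineation_identification[OF assms]])
  then have sub: "order_q_subplane emb (\<iota> ` ?D)"
    unfolding rational_surface_subplane by (simp only: image_comp)
  have "pg_sub 0 (vec.span {vector [0, 0, 1] :: 'k ^ 3})" by (simp add: vec3_eq_iff)
  moreover have "vec.span {vector [0, 0, 1] :: 'k ^ 3} \<subseteq> {w. w$1 = 0}"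
    by (auto simp: in_span_singleton)
  ultimately have T: "?T \<in> S" unfolding S_eq by blast
  have "affine_points H \<inter> S = {}"
    using spread unfolding affine_points_def two_spread_def by blast
  then have DS: "?D \<inter> S = {?T}" using T by blast
  have "inj_on \<iota> (bb_points H S)"
    using assms unfolding bb_identification_def bij_betw_def by blast
  then have "\<iota> ` ?D \<inter> \<iota> ` S = \<iota> ` (?D \<inter> S)"
    using T by (subst inj_on_image_Int[of \<iota> "bb_points H S"]) (auto simp: bb_points_def)
  then show ?thesis using sub unfolding corresponds_to_tangent_subplane_def DS Let_def by simp
qed

end


section \<open>Reduction to the normal form\<close>

text \<open>
  The symmetric bilinear form belonging to the quadratic form with coefficient matrix \<open>A\<close>.
\<close>
definition polar_form :: "'a::field ^ 'n ^ 'n \<Rightarrow> 'a ^ 'n \<Rightarrow> 'a ^ 'n \<Rightarrow> 'a" where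
  "polar_form A u v = (\<Sum>i\<in>UNIV. \<Sum>j\<in>UNIV. A $ i $ j * (u $ i * v $ j + v $ i * u $ j))"

lemma quad_form_add: "quad_form A (u + v) = quad_form A u + quad_form A v + polar_form A u v"
  by (simp add: quad_form_def polar_form_def algebra_simps flip: sum.distrib)

lemma quad_form_scale: "quad_form A (c *s v) = c^2 * quad_form A v"
  by (simp add: quad_form_def sum_distrib_left power2_eq_square mult_ac)

lemma polar_form_scale: "polar_form A (c *s u) (d *s v) = c * d * polar_form A u v"
  by (simp add: polar_form_def sum_distrib_left algebra_simps)

lemma polar_form_add_left: "polar_form A (u + u') v = polar_form A u v + polar_form A u' v"
  by (simp add: polar_form_def algebra_simps flip: sum.distrib)

lemma polar_form_add_right: "polar_form A u (v + v') = polar_form A u v + polar_form A u v'"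
  by (simp add: polar_form_def algebra_simps flip: sum.distrib)

lemma polar_form_commute: "polar_form A u v = polar_form A v u"
  by (simp add: polar_form_def add.commute)

context cubic_extension
begin

lemma frob_sum: "frob (\<Sum>i\<in>I. f i) = (\<Sum>i\<in>I. frob (f i))"
  by (induction I rule: infinite_finite_induct) auto

lemma quad_form_emb_vec: "quad_form (map_matrix emb A) (emb_vec emb v) = emb (quad_form A v)"
  by (simp add: quad_form_def map_matrix_def)

lemma quad_form_frobv: "quad_form (map_matrix emb A) (frobv v) = frob (quad_form (map_matrix emb A) v)"
  by (simp add: quad_form_def map_matrix_def frobv_def frob_sum)

lemma polar_form_frobv:
  "polar_form (map_matrix emb A) (frobv u) (frobv v) = frob (polar_form (map_matrix emb A) u v)"
  by (simp add: polar_form_def map_matrix_def frobv_def frob_sum)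

text \<open>
  A conic defined over \<open>GF(q)\<close> that passes through \<open>p\<close>, and hence through its conjugates.
\<close>
lemma quad_form_conjugate_zeros:
  fixes A :: "'f ^ 'n ^ 'n" and p :: "'k ^ 'n"
  assumes "quad_form (map_matrix emb A) p = 0"
  defines "a \<equiv> polar_form (map_matrix emb A) (frobv p) (frobv (frobv p))"
  shows "quad_form (map_matrix emb A) (x *s p + y *s frobv p + w *s frobv (frobv p)) =
    a * y * w + frob a * w * x + frob (frob a) * x * y"
proof -
  let ?B = "map_matrix emb A"
  have 0: "quad_form ?B (frobv p) = 0" "quad_form ?B (frobv (frobv p)) = 0"
    using assms(1) by (simp_all add: quad_form_frobv)
  have a1: "polar_form ?B (frobv (frobv p)) p = frob a"
    using polar_form_frobv[of A "frobv p" "frobv (frobv p)"] by (simp add: a_def)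
  have a2: "polar_form ?B p (frobv p) = frob (frob a)"
    using polar_form_frobv[of A "frobv (frobv p)" p] by (simp add: a1)
  show ?thesis
    by (simp add: quad_form_add polar_form_add_left polar_form_add_right quad_form_scale polar_form_scale assms(1) 0
        a2 polar_form_commute[of ?B p "frobv (frobv p)"] a1 a_def[symmetric] algebra_simps)
qed

lemma pg_ext_conjugate_plane:
  fixes u :: "'k ^ 'n"
  assumes "\<pi> = {v. emb_vec emb v \<in> vec.span (\<Union>i<3. frob_image q i (vec.span {u}))}" "pg_sub 2 \<pi>"
  shows "pg_ext emb \<pi> = vec.span {u, frobv u, frobv (frobv u)}"
proof (rule vec.subspace_dim_equal)
  show "pg_ext emb \<pi> \<subseteq> vec.span {u, frobv u, frobv (frobv u)}"
    unfolding pg_ext_def by (rule vec.span_minimal) (auto simp: assms(1) span_conjugates)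
  have "vec.dim (vec.span {u, frobv u, frobv (frobv u)}) \<le> card {u, frobv u, frobv (frobv u)}"
    by (rule vec.dim_le_card) auto
  also have "\<dots> \<le> 3" by (simp add: card_insert_if)
  finally show "vec.dim (vec.span {u, frobv u, frobv (frobv u)}) \<le> vec.dim (pg_ext emb \<pi>)"
    using assms(2) by (simp add: dim_pg_ext pg_sub_def)
qed (simp_all add: pg_ext_def)

end

context transversal_frame
begin

text \<open>
  The plane spanned by \<open>p\<close> and its conjugates meets the three transversal lines in these points.
\<close>
lemma vertex_points:
  assumes E: "E = vec.span {p, frobv p, frobv (frobv p)}"
  shows "E \<inter> frob_image q 1 g = vec.span {frobv p}" "E \<inter> frob_image q 2 g = vec.span {frobv (frobv p)}"
    "E \<inter> frob_image q 3 g = vec.span {p}"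
proof -
  have E: "u \<in> E \<longleftrightarrow> (\<exists>x y w. u = comb 0 x y w 0 0 0)" for u
    by (simp add: E in_span_triple comb_def)
  have g: "u \<in> g \<longleftrightarrow> (\<exists>x y. u = comb 0 x 0 0 y 0 0)" for u
    by (simp add: g_eq in_span_pair comb_def)
  have surj: "\<exists>x'. x = frob x'" for x by (metis frob_frob_frob)
  have g1: "u \<in> frobv ` g \<longleftrightarrow> (\<exists>x y. u = comb 0 0 x 0 0 y 0)" for u
  proof -
    have "u \<in> frobv ` g \<longleftrightarrow> (\<exists>x y. u = comb 0 0 (frob x) 0 0 (frob y) 0)"
    proof -
      have "frobv (comb 0 x 0 0 y 0 0) = comb 0 0 (frob x) 0 0 (frob y) 0" for x y
        by (simp add: frobv_comb)
      then show ?thesis unfolding image_iff Bex_def g by metis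
    qed
    then show ?thesis using surj by metis
  qed
  have g2: "u \<in> (\<lambda>v. frobv (frobv v)) ` g \<longleftrightarrow> (\<exists>x y. u = comb 0 0 0 x 0 0 y)" for u
  proof -
    have "u \<in> (\<lambda>v. frobv (frobv v)) ` g \<longleftrightarrow> (\<exists>x y. u = comb 0 0 0 (frob (frob x)) 0 0 (frob (frob y)))"
    proof -
      have "frobv (frobv (comb 0 x 0 0 y 0 0)) = comb 0 0 0 (frob (frob x)) 0 0 (frob (frob y))" for x y
        by (simp add: frobv_comb)
      then show ?thesis unfolding image_iff Bex_def g by metis
    qed
    then show ?thesis using surj by metis
  qed
  have s: "u \<in> vec.span {p} \<longleftrightarrow> (\<exists>x. u = comb 0 x 0 0 0 0 0)"
    "u \<in> vec.span {frobv p} \<longleftrightarrow> (\<exists>x. u = comb 0 0 x 0 0 0 0)"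
    "u \<in> vec.span {frobv (frobv p)} \<longleftrightarrow> (\<exists>x. u = comb 0 0 0 x 0 0 0)" for u
    by (simp_all add: in_span_singleton comb_def)
  show "E \<inter> frob_image q 1 g = vec.span {frobv p}" "E \<inter> frob_image q 2 g = vec.span {frobv (frobv p)}"
    "E \<inter> frob_image q 3 g = vec.span {p}"
    unfolding frob_image_simps set_eq_iff Int_iff E g g1 g2 s by (auto simp: comb_eq_iff)
qed

lemma swap_points: "transversal_frame q emb H S g e r p"
  by unfold_locales (use pg_H spread transversal e_notin g_eq in \<open>simp_all add: insert_commute\<close>)

text \<open>
  The \<open>e\<close>-coordinate of the cubic is a cubic form over \<open>GF(q)\<close> vanishing at the conjugate parameters \<open>z\<close>,
  \<open>frob z\<close>, \<open>frob (frob z)\<close> of \<open>r\<close> and its conjugates. Its leading coefficient is nonzero, as otherwise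
  it would be zero identically and the cubic would lie in \<open>H\<close>; so \<open>m 0\<close> is affine. Relative to \<open>m 0\<close>, the
  \<open>r\<close>-coordinate is \<open>t\<close> times a quadratic form that vanishes at \<open>frob z\<close> and \<open>frob (frob z)\<close>.
\<close>
lemma twisted_cubic_normal_form:
  fixes m :: "nat \<Rightarrow> 'f ^ 7"
  assumes \<alpha>: "\<alpha> = {v. emb_vec emb v \<in> vec.span (\<Union>i<3. frob_image q i (vec.span {r}))}" "\<alpha> \<in> S" "\<alpha> \<subseteq> \<Sigma>"
    and \<Sigma>: "pg_sub 3 \<Sigma>" "e \<in> \<Sigma>" and nrc: "normal_rational_curve_in 3 \<Sigma> m"
    and Q3: "vec.span {r} \<in> curve 3 (emb_vec emb \<circ> m)"
  obtains z v where "frob z \<noteq> z" "v \<noteq> 0" "m 0 \<notin> H"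
    "\<And>s t. (\<Sum>j\<le>3. (s ^ (3 - j) * t ^ j) *s (emb_vec emb \<circ> m) j) =
       ((s - z * t) * (s - frob z * t) * (s - frob (frob z) * t)) *s emb_vec emb (m 0)
       + ((t * (s - frob z * t) * (s - frob (frob z) * t)) *s (v *s r)
       + (t * (s - z * t) * (s - frob (frob z) * t)) *s frobv (v *s r)
       + (t * (s - z * t) * (s - frob z * t)) *s frobv (frobv (v *s r)))"
proof -
  have \<alpha>_dim: "pg_sub 2 \<alpha>" "\<alpha> \<subseteq> H" using spread \<alpha>(2) by (auto simp: two_spread_def)
  have \<Sigma>_sub: "\<Sigma> \<subseteq> vec.span (insert e \<alpha>)"
  proof -
    have "e \<notin> \<alpha>" using \<alpha>_dim e_notin by blast
    then have "e \<notin> vec.span \<alpha>" using \<alpha>_dim(1) by (metis pg_sub_def vec.span_eq_iff)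
    then have "vec.dim (vec.span (insert e \<alpha>)) = 4"
      using \<alpha>_dim(1) by (simp add: vec.dim_insert pg_sub_def)
    moreover have "vec.span (insert e \<alpha>) \<subseteq> \<Sigma>"
      using \<Sigma> \<alpha>(3) by (intro vec.span_minimal) (auto simp: pg_sub_def)
    ultimately have "vec.span (insert e \<alpha>) = \<Sigma>"
      using \<Sigma>(1) by (intro vec.subspace_dim_equal) (auto simp: pg_sub_def)
    then show ?thesis by simp
  qed
  have m\<Sigma>: "m j \<in> \<Sigma>" if "j \<le> 3" for j
    using nrc that vec.span_base[of "m j" "m ` {..3}"] by (auto simp: normal_rational_curve_in_def)
  have \<Phi>m: "\<Phi> (m j) $ 3 = 0" if "j \<le> 3" for j
  proof -
    have "m j \<in> vec.span (insert e \<alpha>)" using \<Sigma>_sub m\<Sigma>[OF that] by blast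
    then obtain c where "m j - c *s e \<in> vec.span \<alpha>" by (auto simp: vec.span_breakdown_eq)
    then have "m j - c *s e \<in> \<alpha>" using \<alpha>_dim(1) by (metis pg_sub_def vec.span_eq_iff)
    then obtain a b d where "emb_vec emb (m j - c *s e) = a *s r + b *s frobv r + d *s frobv (frobv r)"
      unfolding \<alpha>(1) span_conjugates in_span_triple by blast
    then have "ratK (\<Phi> (m j)) = comb (emb c) 0 0 0 a b d"
      by (simp add: ratK_\<Phi> comb_def algebra_simps)
    then show ?thesis by (simp add: ratK_def comb_eq_iff)
  qed
  define f where "f j = \<Phi> (m j) $ 1" for j
  define y where "y j = \<Phi> (m j) $ 2" for j
  have mj: "emb_vec emb (m j) = comb (f j) 0 0 0 (y j) (frob (y j)) (frob (frob (y j)))" if "j \<le> 3" for j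
    using ratK_\<Phi>[of "m j"] \<Phi>m[OF that] by (simp add: ratK_def f_def y_def)
  have ff: "frob (f j) = f j" for j by (simp add: f_def frob_\<Phi>1)
  have sum3: "(\<Sum>j\<le>3. (s ^ (3 - j) * t ^ j) *s (emb_vec emb \<circ> m) j) =
      s^3 *s emb_vec emb (m 0) + (s^2 * t) *s emb_vec emb (m 1) + (s * t^2) *s emb_vec emb (m 2)
      + t^3 *s emb_vec emb (m 3)" for s t
    by (simp add: numeral_3_eq_3 numeral_2_eq_2)
  obtain s t where st: "(s, t) \<noteq> (0, 0)"
    "vec.span {r} = vec.span {\<Sum>j\<le>3. (s ^ (3 - j) * t ^ j) *s (emb_vec emb \<circ> m) j}"
    using Q3 unfolding curve_def curve_point_def by blast
  have "r \<noteq> 0" using yr_xp_eq_0[of 1 0] by simp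
  then obtain k where k: "k \<noteq> 0" "(\<Sum>j\<le>3. (s ^ (3 - j) * t ^ j) *s (emb_vec emb \<circ> m) j) = k *s r"
    using st(2) span_singleton_eq_iff by blast
  have "comb 0 0 0 0 k 0 0 = s^3 *s emb_vec emb (m 0) + (s^2 * t) *s emb_vec emb (m 1)
      + (s * t^2) *s emb_vec emb (m 2) + t^3 *s emb_vec emb (m 3)"
    using k(2) unfolding sum3 by (simp add: comb_def)
  then have E0: "s^3 * f 0 + s^2 * t * f 1 + s * t^2 * f 2 + t^3 * f 3 = 0"
    "s^3 * y 0 + s^2 * t * y 1 + s * t^2 * y 2 + t^3 * y 3 = k"
    "s^3 * frob (y 0) + s^2 * t * frob (y 1) + s * t^2 * frob (y 2) + t^3 * frob (y 3) = 0"
    "s^3 * frob (frob (y 0)) + s^2 * t * frob (frob (y 1)) + s * t^2 * frob (frob (y 2))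
      + t^3 * frob (frob (y 3)) = 0"
    by (simp_all add: mj comb_scale comb_add comb_eq_iff)
  have t: "t \<noteq> 0"
  proof
    assume t: "t = 0"
    then have "s \<noteq> 0" using st(1) by simp
    then have "y 0 = 0" using E0(3) t by simp
    then show False using E0(2) t k(1) by simp
  qed
  define z where "z = s / t"
  have s: "s = z * t" using t by (simp add: z_def)
  have hom: "(z * t)^3 * a + (z * t)^2 * t * b + z * t * t^2 * c + t^3 * d = t^3 * (a * z^3 + b * z^2 + c * z + d)"
    for a b c d by (simp add: power2_eq_square power3_eq_cube algebra_simps)
  have r0: "f 0 * z^3 + f 1 * z^2 + f 2 * z + f 3 = 0"
    and yk: "y 0 * z^3 + y 1 * z^2 + y 2 * z + y 3 \<noteq> 0"
    and y1: "frob (y 0) * z^3 + frob (y 1) * z^2 + frob (y 2) * z + frob (y 3) = 0"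
    and y2: "frob (frob (y 0)) * z^3 + frob (frob (y 1)) * z^2 + frob (frob (y 2)) * z + frob (frob (y 3)) = 0"
    using E0 t k(1) unfolding s hom by auto
  let ?z1 = "frob z" and ?z2 = "frob (frob z)"
  have r1: "f 0 * ?z1^3 + f 1 * ?z1^2 + f 2 * ?z1 + f 3 = 0"
    using arg_cong[OF r0, of frob] by (simp add: ff)
  have r2: "f 0 * ?z2^3 + f 1 * ?z2^2 + f 2 * ?z2 + f 3 = 0"
    using arg_cong[OF r1, of frob] by (simp add: ff)
  \<comment> \<open>The coordinates along the conjugates of \<open>r\<close> vanish at \<open>z\<close>; apply the Frobenius map.\<close>
  have yz1: "y 0 * ?z1^3 + y 1 * ?z1^2 + y 2 * ?z1 + y 3 = 0"
    using arg_cong[OF y2, of frob] by simp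
  have yz2: "y 0 * ?z2^3 + y 1 * ?z2^2 + y 2 * ?z2 + y 3 = 0"
    using arg_cong[OF arg_cong[OF y1, of frob], of frob] by simp
  have zz: "frob z \<noteq> z" using yk yz1 by auto
  then have dist: "z \<noteq> ?z1" "?z1 \<noteq> ?z2" "z \<noteq> ?z2" by (auto, metis frob_frob_frob)
  have f0: "f 0 \<noteq> 0"
  proof
    assume f0: "f 0 = 0"
    then have "f 1 = 0" "f 2 = 0" "f 3 = 0"
      using quadratic_three_roots[of "f 1" z "f 2" "f 3" ?z1 ?z2] r0 r1 r2 dist by simp_all
    moreover have "j = 0 \<or> j = 1 \<or> j = 2 \<or> j = 3" if "j \<le> 3" for j :: nat
      using that by arith
    ultimately have "f j = 0" if "j \<le> 3" for j
      using f0 that by metis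
    then have "m ` {..3} \<subseteq> H" by (auto simp: in_H_iff f_def)
    then have "vec.span (m ` {..3}) \<subseteq> H" using pg_H by (intro vec.span_minimal) (auto simp: pg_sub_def)
    then show False using nrc \<Sigma>(2) e_notin by (auto simp: normal_rational_curve_in_def)
  qed
  \<comment> \<open>Coordinates of \<open>m j\<close> in the frame with \<open>m 0\<close> in place of \<open>e\<close>.\<close>
  define c where "c j = f j / f 0" for j
  define u where "u j = y j - c j * y 0" for j
  have fc: "f j = c j * f 0" and fr_c: "frob (c j) = c j" for j using f0 by (simp_all add: c_def ff)
  have root: "x^3 + c 1 * x^2 + c 2 * x + c 3 = 0"
    if "f 0 * x^3 + f 1 * x^2 + f 2 * x + f 3 = 0" for x
  proof -
    have "f 0 * (x^3 + c 1 * x^2 + c 2 * x + c 3) = 0"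
      using that unfolding fc[of 1] fc[of 2] fc[of 3] by (simp add: algebra_simps)
    then show ?thesis using f0 by simp
  qed
  note c = cubic_three_roots[OF root[OF r0] root[OF r1] root[OF r2] dist]
  have uroot: "u 1 * x^2 + u 2 * x + u 3 = y 0 * x^3 + y 1 * x^2 + y 2 * x + y 3"
    if "f 0 * x^3 + f 1 * x^2 + f 2 * x + f 3 = 0" for x
  proof -
    have "u 1 * x^2 + u 2 * x + u 3 = y 0 * x^3 + y 1 * x^2 + y 2 * x + y 3 -
        y 0 * (x^3 + c 1 * x^2 + c 2 * x + c 3)"
      by (simp add: u_def algebra_simps)
    then show ?thesis using root[OF that] by simp
  qed
  have "u 1 * ?z1^2 + u 2 * ?z1 + u 3 = 0" "u 1 * ?z2^2 + u 2 * ?z2 + u 3 = 0"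
    using uroot[OF r1] uroot[OF r2] yz1 yz2 by simp_all
  note u = quadratic_two_roots[OF this dist(2)]
  have u1: "u 1 \<noteq> 0" using uroot[OF r0] yk u by auto
  let ?M0 = "emb_vec emb (m 0)"
  have M: "emb_vec emb (m j) = c j *s ?M0 + u j *s r + frob (u j) *s frobv r + frob (frob (u j)) *s frobv (frobv r)"
    if "j \<le> 3" for j
    unfolding mj[OF that] mj[of 0, simplified]
    by (simp add: comb_def u_def fc[of j] fr_c vec.scale_right_distrib vec.scale_left_diff_distrib
        vector_smult_assoc algebra_simps)
  have "(\<Sum>j\<le>3. (a ^ (3 - j) * b ^ j) *s (emb_vec emb \<circ> m) j) =
       ((a - z * b) * (a - ?z1 * b) * (a - ?z2 * b)) *s ?M0
       + ((b * (a - ?z1 * b) * (a - ?z2 * b)) *s (u 1 *s r)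
       + (b * (a - z * b) * (a - ?z2 * b)) *s frobv (u 1 *s r)
       + (b * (a - z * b) * (a - ?z1 * b)) *s frobv (frobv (u 1 *s r)))" for a b
  proof -
    have le: "(1 :: nat) \<le> 3" "(2 :: nat) \<le> 3" "(3 :: nat) \<le> 3" by simp_all
    show ?thesis unfolding sum3 M[OF le(1)] M[OF le(2)] M[OF le(3)] u c frobv_scale
      by (simp add: vec_eq_iff power2_eq_square power3_eq_cube algebra_simps)
  qed
  moreover have "m 0 \<notin> H" using f0 by (simp add: in_H_iff f_def)
  ultimately show thesis using that[OF zz u1] by blast
qed

lemma rescale:
  assumes "e' \<notin> H" "a \<noteq> 0" "b \<noteq> 0"
  shows "transversal_frame q emb H S g e' (a *s p) (b *s r)"
proof unfold_locales
  have "vec.span {p, r} = vec.span {a *s p, b *s r}"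
  proof (intro equalityI subsetI)
    fix x assume "x \<in> vec.span {p, r}"
    then obtain c d where "x = c *s p + d *s r" by (auto simp: in_span_pair)
    then have "x = (c / a) *s (a *s p) + (d / b) *s (b *s r)" using assms by (simp add: vector_smult_assoc)
    then show "x \<in> vec.span {a *s p, b *s r}" unfolding in_span_pair by blast
  next
    fix x assume "x \<in> vec.span {a *s p, b *s r}"
    then obtain c d where "x = c *s (a *s p) + d *s (b *s r)" by (auto simp: in_span_pair)
    then have "x = (c * a) *s p + (d * b) *s r" by (simp add: vector_smult_assoc)
    then show "x \<in> vec.span {p, r}" unfolding in_span_pair by blast
  qed
  then show "g = vec.span {a *s p, b *s r}" using g_eq by simp
qed (use pg_H spread transversal assms in auto)

text \<open>
  The conic has an equation \<open>a y w + \<sigma>a w x + \<sigma>\<sigma>a x y = 0\<close> with \<open>a\<close> nonzero. Replacing \<open>p\<close> by \<open>(a / \<mu>) p\<close>, where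
  \<open>\<mu> = \<sigma>z - \<sigma>\<sigma>z\<close>, turns it into a multiple of the equation that defines the conic of the normal form.
\<close>
theorem tangent_subplane_of_frame:
  fixes m :: "nat \<Rightarrow> 'f ^ 7" and A :: "'f ^ 7 ^ 7" and P Q :: "nat \<Rightarrow> ('k ^ 7) set"
  assumes \<iota>: "bb_identification H S \<iota>"
    and \<pi>: "\<pi> = {v. emb_vec emb v \<in> vec.span (\<Union>i<3. frob_image q i (vec.span {p}))}" "\<pi> \<in> S"
    and conic: "conic_in \<pi> A"
    and P: "\<And>i. P i = pg_ext emb \<pi> \<inter> frob_image q i g"
    and P_conic: "P 3 \<in> conic_ext emb \<pi> A"
    and \<Sigma>: "pg_sub 3 \<Sigma>" "e \<in> \<Sigma>"
    and \<alpha>: "\<alpha> = {v. emb_vec emb v \<in> vec.span (\<Union>i<3. frob_image q i (vec.span {r}))}" "\<alpha> \<in> S" "\<alpha> \<subseteq> \<Sigma>"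
    and nrc: "normal_rational_curve_in 3 \<Sigma> m"
    and Q: "\<And>i. Q i = pg_ext emb \<alpha> \<inter> frob_image q i g"
    and Q_cubic: "Q 3 \<in> curve 3 (emb_vec emb \<circ> m)"
  shows "\<exists>B0. (\<forall>B'. conic_cubic_surface (pg_ext emb \<pi>) (conic_ext emb \<pi> A) (emb_vec emb \<circ> m) P Q B' \<longleftrightarrow> B' = B0) \<and>
     corresponds_to_tangent_subplane emb H S \<iota> \<pi> (rational_points emb B0)"
proof -
  let ?B = "map_matrix emb A"
  have pg: "pg_sub 2 \<pi>" "pg_sub 2 \<alpha>" using spread \<pi>(2) \<alpha>(2) by (auto simp: two_spread_def)
  have ext\<pi>: "pg_ext emb \<pi> = vec.span {p, frobv p, frobv (frobv p)}"
    by (rule pg_ext_conjugate_plane[OF \<pi>(1) pg(1)])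
  have ext\<alpha>: "pg_ext emb \<alpha> = vec.span {r, frobv r, frobv (frobv r)}"
    by (rule pg_ext_conjugate_plane[OF \<alpha>(1) pg(2)])
  have Pv: "P 1 = vec.span {frobv p}" "P 2 = vec.span {frobv (frobv p)}" "P 3 = vec.span {p}"
    unfolding P by (rule vertex_points[OF ext\<pi>])+
  have Qv: "Q 1 = vec.span {frobv r}" "Q 2 = vec.span {frobv (frobv r)}" "Q 3 = vec.span {r}"
    unfolding Q by (rule transversal_frame.vertex_points[OF swap_points ext\<alpha>])+
  obtain z v where z: "frob z \<noteq> z" and v: "v \<noteq> 0" and m0: "m 0 \<notin> H"
    and m: "\<And>s t. (\<Sum>j\<le>3. (s ^ (3 - j) * t ^ j) *s (emb_vec emb \<circ> m) j) =
       ((s - z * t) * (s - frob z * t) * (s - frob (frob z) * t)) *s emb_vec emb (m 0)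
       + ((t * (s - frob z * t) * (s - frob (frob z) * t)) *s (v *s r)
       + (t * (s - z * t) * (s - frob (frob z) * t)) *s frobv (v *s r)
       + (t * (s - z * t) * (s - frob z * t)) *s frobv (frobv (v *s r)))"
  proof (rule twisted_cubic_normal_form[OF \<alpha> \<Sigma> nrc Q_cubic[unfolded Qv]], goal_cases)
    case (1 z v)
    show thesis by (rule that[of z v]; fact 1)
  qed
  define a where "a = polar_form ?B (frobv p) (frobv (frobv p))"
  have qp: "quad_form ?B p = 0"
    using P_conic unfolding Pv conic_ext_def by (simp add: vec.span_base)
  have qf: "quad_form ?B (x *s p + y *s frobv p + w *s frobv (frobv p)) =
      a * y * w + frob a * w * x + frob (frob a) * x * y" for x y w
    unfolding a_def by (rule quad_form_conjugate_zeros[OF qp])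
  have a: "a \<noteq> 0"
  proof
    assume "a = 0"
    obtain u where u: "u \<in> \<pi>" "quad_form A u \<noteq> 0" using conic by (auto simp: conic_in_def)
    have "emb_vec emb u \<in> pg_ext emb \<pi>" using u(1) by (simp add: pg_ext_def vec.span_base)
    then obtain x y w where "emb_vec emb u = x *s p + y *s frobv p + w *s frobv (frobv p)"
      unfolding ext\<pi> in_span_triple by blast
    then have "emb (quad_form A u) = 0" using qf[of x y w] \<open>a = 0\<close> by (simp flip: quad_form_emb_vec)
    then show False using u(2) by simp
  qed
  define \<mu> where "\<mu> = frob z - frob (frob z)"
  have \<mu>: "\<mu> \<noteq> 0" using z by (simp add: \<mu>_def)
  define l where "l = a / \<mu>"
  have l: "l \<noteq> 0" "a = l * \<mu>" using a \<mu> by (simp_all add: l_def)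
  interpret F: transversal_frame q emb H S g "m 0" "l *s p" "v *s r"
    by (rule rescale[OF m0 l(1) v])
  interpret N: normal_form q emb H S g "m 0" "l *s p" "v *s r" z "emb_vec emb \<circ> m" P Q
  proof unfold_locales
    show "(\<Sum>j\<le>3. (s ^ (3 - j) * t ^ j) *s (emb_vec emb \<circ> m) j) =
        F.comb ((s - z * t) * (s - frob z * t) * (s - frob (frob z) * t)) 0 0 0
          (t * (s - frob z * t) * (s - frob (frob z) * t)) (t * (s - z * t) * (s - frob (frob z) * t))
          (t * (s - z * t) * (s - frob z * t))" for s t
      unfolding m F.comb_def by simp
    have "frob v \<noteq> 0" "frob (frob v) \<noteq> 0" "frob l \<noteq> 0" "frob (frob l) \<noteq> 0" using v l(1) by simp_all
    then show "P 1 = vec.span {frobv (l *s p)}" "P 2 = vec.span {frobv (frobv (l *s p))}"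
      "P 3 = vec.span {l *s p}" "Q 1 = vec.span {frobv (v *s r)}"
      "Q 2 = vec.span {frobv (frobv (v *s r))}" "Q 3 = vec.span {v *s r}"
      using v l(1) by (simp_all add: Pv Qv span_scale_singleton del: One_nat_def)
  qed (rule z)
  have F_comb: "F.comb 0 x y w 0 0 0 = (x * l) *s p + (y * frob l) *s frobv p + (w * frob (frob l)) *s frobv (frobv p)"
    for x y w by (simp add: F.comb_def vector_smult_assoc)
  have plane: "pg_ext emb \<pi> = N.plane_p"
  proof (intro equalityI subsetI)
    fix u assume "u \<in> pg_ext emb \<pi>"
    then obtain x y w where "u = x *s p + y *s frobv p + w *s frobv (frobv p)"
      unfolding ext\<pi> in_span_triple by blast
    then have "u = F.comb 0 (x / l) (y / frob l) (w / frob (frob l)) 0 0 0"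
      using l(1) by (simp add: F_comb)
    then show "u \<in> N.plane_p" unfolding N.plane_p_def by blast
  next
    fix u assume "u \<in> N.plane_p"
    then show "u \<in> pg_ext emb \<pi>" unfolding N.plane_p_def F_comb ext\<pi> in_span_triple by blast
  qed
  have qfN: "quad_form ?B (F.comb 0 x y w 0 0 0) = 0 \<longleftrightarrow> N.conic_eq x y w" for x y w
  proof -
    have "quad_form ?B (F.comb 0 x y w 0 0 0) = l * frob l * frob (frob l) *
        ((frob z - frob (frob z)) * y * w + (frob (frob z) - z) * w * x + (z - frob z) * x * y)"
      unfolding F_comb qf l(2) \<mu>_def by (simp add: algebra_simps)
    then show ?thesis using l(1) by (simp add: N.conic_eq_def)
  qed
  have conic_eq: "conic_ext emb \<pi> A = N.conic_p"
  proof (intro equalityI subsetI)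
    fix X assume X: "X \<in> conic_ext emb \<pi> A"
    then obtain u where u: "u \<noteq> 0" "X = vec.span {u}" by (auto simp: conic_ext_def pg_sub_0_iff)
    then have "u \<in> pg_ext emb \<pi>" "quad_form ?B u = 0"
      using X vec.span_base[of u "{u}"] by (auto simp: conic_ext_def)
    then obtain x y w where xyw: "u = F.comb 0 x y w 0 0 0" unfolding plane N.plane_p_def by blast
    moreover have "N.conic_eq x y w" using qfN xyw \<open>quad_form ?B u = 0\<close> by simp
    moreover have "(x, y, w) \<noteq> (0, 0, 0)" using u(1) xyw by (auto simp: F.comb_0)
    ultimately show "X \<in> N.conic_p" unfolding N.conic_p_def u(2) by blast
  next
    fix X assume "X \<in> N.conic_p"
    then obtain x y w where xyw: "(x, y, w) \<noteq> (0, 0, 0)" "N.conic_eq x y w"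
      "X = vec.span {F.comb 0 x y w 0 0 0}" unfolding N.conic_p_def by blast
    have "F.comb 0 x y w 0 0 0 \<noteq> 0" using xyw(1) N.comb_eq_0 by auto
    moreover have "F.comb 0 x y w 0 0 0 \<in> pg_ext emb \<pi>" unfolding plane N.plane_p_def by blast
    then have "X \<subseteq> pg_ext emb \<pi>" unfolding xyw(3) by (intro vec.span_minimal) (auto simp: pg_ext_def)
    moreover have "quad_form ?B u = 0" if "u \<in> X" for u
      using that qfN xyw(2) unfolding xyw(3) by (auto simp: in_span_singleton quad_form_scale)
    ultimately show "X \<in> conic_ext emb \<pi> A" by (simp add: conic_ext_def xyw(3))
  qed
  have "conic_cubic_surface (pg_ext emb \<pi>) (conic_ext emb \<pi> A) (emb_vec emb \<circ> m) P Q B' \<longleftrightarrow> B' = N.surface" for B'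
    unfolding plane conic_eq using N.conic_cubic_surface_unique N.conic_cubic_surface_exists by blast
  moreover have "F.\<Psi> (vec.span {vector [0, 0, 1]}) = \<pi>"
    unfolding F.\<Psi>_infinity \<pi>(1) using l(1) by (simp add: span_scale_singleton)
  then have "corresponds_to_tangent_subplane emb H S \<iota> \<pi> (rational_points emb N.surface)"
    using N.surface_tangent_subplane[OF \<iota>] by simp
  ultimately show ?thesis by blast
qed

end

theorem theorem2p2:
  fixes q :: nat
    and emb :: "'f::{field,finite} \<Rightarrow> 'k::{field,finite}"
    and H :: "('f ^ 7) set"
    and S :: "('f ^ 7) set set"
    and g :: "('k ^ 7) set"
    and \<iota> :: "('f ^ 7) set \<Rightarrow> ('k ^ 3) set"
    and \<pi> \<alpha> \<Sigma> :: "('f ^ 7) set"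
    and A :: "'f ^ 7 ^ 7"
    and m :: "nat \<Rightarrow> 'f ^ 7"
    and P Q :: "nat \<Rightarrow> ('k ^ 7) set"
  assumes "primepow q" and "CARD('f) = q" and "CARD('k) = q ^ 3" and "field_embedding emb"
    and "pg_sub 5 H"
    and "regular_two_spread q emb H S"
    and "transversal_line q emb H S g"
    and "bb_identification H S \<iota>"
    and "\<pi> \<in> S"
    and "conic_in \<pi> A"
    and "\<And>i. P i = pg_ext emb \<pi> \<inter> frob_image q i g"
    and "\<And>i. i \<in> {1,2,3} \<Longrightarrow> P i \<in> conic_ext emb \<pi> A"
    and "pg_sub 3 \<Sigma>" and "\<not> \<Sigma> \<subseteq> H"
    and "\<alpha> \<in> S" and "\<alpha> \<subseteq> \<Sigma>" and "\<alpha> \<noteq> \<pi>"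
    and "normal_rational_curve_in 3 \<Sigma> m"
    and "\<And>i. Q i = pg_ext emb \<alpha> \<inter> frob_image q i g"
    and "\<And>i. i \<in> {1,2,3} \<Longrightarrow> Q i \<in> curve 3 (emb_vec emb \<circ> m)"
  shows "(\<exists>!B'. conic_cubic_surface (pg_ext emb \<pi>) (conic_ext emb \<pi> A) (emb_vec emb \<circ> m) P Q B') \<and>
         (\<forall>B'. conic_cubic_surface (pg_ext emb \<pi>) (conic_ext emb \<pi> A) (emb_vec emb \<circ> m) P Q B' \<longrightarrow>
               corresponds_to_tangent_subplane emb H S \<iota> \<pi> (rational_points emb B'))"
proof -
  interpret cubic_extension q emb
    by unfold_locales (fact assms)+
  have spread: "two_spread q H S" using assms(6) by (simp add: regular_two_spread_def)
  have S: "S = {{v. emb_vec emb v \<in> vec.span (\<Union>i<3. frob_image q i P)} | P. pg_sub 0 P \<and> P \<subseteq> g}"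
    and g: "pg_sub 1 g" using assms(7) by (simp_all add: transversal_line_def)
  have ex: "\<exists>u. u \<noteq> 0 \<and> u \<in> g \<and> \<sigma> = {v. emb_vec emb v \<in> vec.span (\<Union>i<3. frob_image q i (vec.span {u}))}"
    if \<sigma>: "\<sigma> \<in> S" for \<sigma>
  proof -
    obtain X where X: "pg_sub 0 X" "X \<subseteq> g" "\<sigma> = {v. emb_vec emb v \<in> vec.span (\<Union>i<3. frob_image q i X)}"
      using \<sigma> unfolding S by blast
    obtain u where u: "u \<noteq> 0" "X = vec.span {u}" using X(1) pg_sub_0_iff by blast
    then have "u \<in> g" using X(2) vec.span_base[of u "{u}"] by blast
    then show ?thesis using u X(3) by blast
  qed
  obtain p where p: "p \<noteq> 0" "p \<in> g"
    "\<pi> = {v. emb_vec emb v \<in> vec.span (\<Union>i<3. frob_image q i (vec.span {p}))}" using ex[OF assms(9)] by blast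
  obtain r where r: "r \<noteq> 0" "r \<in> g"
    "\<alpha> = {v. emb_vec emb v \<in> vec.span (\<Union>i<3. frob_image q i (vec.span {r}))}" using ex[OF assms(15)] by blast
  have "vec.span {p, r} = g"
  proof (rule vec.subspace_dim_equal)
    show "vec.span {p, r} \<subseteq> g" using p(2) r(2) g by (intro vec.span_minimal) (auto simp: pg_sub_def)
    have "vec.span {p} \<noteq> vec.span {r}" using assms(17) p(3) r(3) by auto
    then have "p \<notin> vec.span {r}" using p(1) pg_sub_0_eq_span[of "vec.span {r}" p] r(1) by auto
    then have "vec.dim (vec.span {p, r}) = 2" using r(1) by (simp add: vec.dim_insert)
    then show "vec.dim g \<le> vec.dim (vec.span {p, r})" using g by (simp add: pg_sub_def)
  qed (use g in \<open>simp_all add: pg_sub_def\<close>)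
  then have g_eq: "g = vec.span {p, r}" by simp
  obtain e where e: "e \<in> \<Sigma>" "e \<notin> H" using assms(14) by blast
  interpret transversal_frame q emb H S g e p r
    by unfold_locales (fact assms spread e g_eq)+
  have P3: "P 3 \<in> conic_ext emb \<pi> A" and Q3: "Q 3 \<in> curve 3 (emb_vec emb \<circ> m)"
    using assms(12)[of 3] assms(20)[of 3] by simp_all
  from tangent_subplane_of_frame[OF assms(8) p(3) assms(9,10,11) P3 assms(13) e(1) r(3)
      assms(15,16,18,19) Q3]
  obtain B0 where
    "\<forall>B'. conic_cubic_surface (pg_ext emb \<pi>) (conic_ext emb \<pi> A) (emb_vec emb \<circ> m) P Q B' \<longleftrightarrow> B' = B0"
    "corresponds_to_tangent_subplane emb H S \<iota> \<pi> (rational_points emb B0)"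
    by (elim exE conjE)
  then show ?thesis by simp
qed

end
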